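(* Let $\beta\in\{1,2,4\}$ and $N\in\mathbb{N}$, and let $\mathcal{L}_0,\mathcal{L}_1^{(\beta)},\mathcal{L}_2^{(\beta)}$ be the operators on $\mathbb{C}[u,u^{-1};\mathbf{v}]$ defined in the context (they do not depend on $N$; $\mathcal{L}_0,\mathcal{L}_1^{(\beta)}$ are first order pseudodifferential operators and $\mathcal{L}_2^{(\beta)}$ is a second order differential operator). Put $$\mathcal{D}_N^{(\beta)}=\mathcal{L}_0+\frac1N\mathcal{L}_1^{(\beta)}+\frac1{N^2}\mathcal{L}_2^{(\beta)}.$$ Then for every $P\in\mathbb{C}[u,u^{-1};\mathbf{v}]$, as functions on $K_N^{(\beta)}$, $$\Delta_N^{(\beta)}P_N^{(\beta)}=[\mathcal{D}_N^{(\beta)}P]_N^{(\beta)}.$$ Moreover, for all $\tau\in\mathbb{C}$ and $P\in\mathbb{C}[u,u^{-1};\mathbf{v}]$, $$e^{\frac{\tau}{2}\Delta_N^{(\beta)}}P_N^{(\beta)}=[e^{\frac{\tau}{2}\mathcal{D}_N^{(\beta)}}P]_N^{(\beta)}.$$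
   Context: Groups. $K_N^{(1)}=SO(N,\mathbb{R})$, $K_N^{(2)}=SU(N)$, $K_N^{(4)}=Sp(N)=\{A\in M_{2N}(\mathbb{C}): A^{\intercal}\Omega A=\Omega,\ A^*A=I_{2N}\}$, where $\Omega=\mathrm{diag}(\Omega_0,\dots,\Omega_0)$ ($N$ blocks) and $\Omega_0=\begin{pmatrix}0&1\\-1&0\end{pmatrix}$. Their Lie algebras carry the real inner products $\langle X,Y\rangle_{\mathfrak{so}(N,\mathbb{R})}=\frac N2\mathrm{Tr}(XY^* )$, $\langle X,Y\rangle_{\mathfrak{su}(N)}=N\,\mathrm{Tr}(XY^* )$, $\langle X,Y\rangle_{\mathfrak{sp}(N)}=N\,\mathrm{Tr}(XY^* )$. For $X$ in the Lie algebra, $(\widetilde Xf)(k)=\frac{d}{dt}f(ke^{tX})|_{t=0}$, and $\Delta_N^{(\beta)}=\sum_X\widetilde X^2$, the sum being over any orthonormal basis of the Lie algebra of $K_N^{(\beta)}$; it acts entrywise on matrix-valued functions. Trace polynomials. $\mathbb{C}[u,u^{-1};\mathbf{v}]$ is the algebra of polynomials in commuting variables $u,u^{-1},v_{\pm1},v_{\pm2},\dots$ (with $uu^{-1}=1$); convention $v_0=1$. Let $\mathrm{tr}=\frac1N\mathrm{Tr}$ on $M_N(\mathbb{C})$ and $\widetilde{\mathrm{tr}}=\frac1{2N}\mathrm{Tr}$ on $M_{2N}(\mathbb{C})$. For $P\in\mathbb{C}[u,u^{-1};\mathbf{v}]$, $P_N^{(\beta)}(A)=[P]_N^{(\beta)}(A)$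 is the matrix obtained by substituting $u=A$ and, for $k\ne0$, $v_k=\mathrm{tr}(A^k)$ if $\beta\in\{1,2\}$, $v_k=\widetilde{\mathrm{tr}}(A^k)$ if $\beta=4$. Operators on $\mathbb{C}[u,u^{-1};\mathbf{v}]$. $\mathcal{R}^+(\sum_{k\in\mathbb{Z}}u^kq_k(\mathbf{v}))=\sum_{k\ge0}u^kq_k(\mathbf{v})$, $\mathcal{R}^-(\sum_{k\in\mathbb{Z}}u^kq_k(\mathbf{v}))=\sum_{k\le-1}u^kq_k(\mathbf{v})$, and $\mathcal{M}_{u^k}P=u^kP$. Define $$\mathcal{N}=\sum_{|k|\ge1}|k|v_k\frac{\partial}{\partial v_k}+u\frac{\partial}{\partial u}(\mathcal{R}^+-\mathcal{R}^-),$$ $$\mathcal{Y}_1=\sum_{k=1}^\infty v_ku\mathcal{R}^+\frac{\partial}{\partial u}\mathcal{M}_{u^{-k}}\mathcal{R}^+-\sum_{k=-\infty}^{-1}v_ku\mathcal{R}^-\frac{\partial}{\partial u}\mathcal{M}_{u^{-k}}\mathcal{R}^-,$$ $$\mathcal{Y}_2=\sum_{k=2}^\infty\Big(\sum_{j=1}^{k-1}jv_jv_{k-j}\Big)\frac{\partial}{\partial v_k}-\sum_{k=-\infty}^{-2}\Big(\sum_{j=k+1}^{-1}jv_jv_{k-j}\Big)\frac{\partial}{\partial v_k},$$ $$\mathcal{Z}_1=\sum_{k=2}^\infty\Big(\sum_{j=1}^{k-1}(k-j)v_{k-2j}\Big)\frac{\partial}{\partial v_k}-\sum_{k=-\infty}^{-2}\Big(\sum_{j=k+1}^{-1}(k-j)v_{k-2j}\Big)\frac{\partial}{\partial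 v_k},$$ $$\mathcal{Z}_2=\sum_{k=1}^\infty u^{-k+1}\mathcal{R}^+\frac{\partial}{\partial u}\mathcal{M}_{u^{-k}}\mathcal{R}^+-\sum_{k=-\infty}^{-1}u^{-k+1}\mathcal{R}^-\frac{\partial}{\partial u}\mathcal{M}_{u^{-k}}\mathcal{R}^-,$$ $$\mathcal{K}_1=\mathcal{K}_1^+-\mathcal{K}_1^-,\quad \mathcal{K}_1^{+}=\sum_{|k|\ge1}ku^{-k+1}\frac{\partial^2}{\partial v_k\partial u},\quad \mathcal{K}_1^{-}=\sum_{|k|\ge1}ku^{k+1}\frac{\partial^2}{\partial v_k\partial u},$$ $$\mathcal{K}_2=\mathcal{K}_2^+-\mathcal{K}_2^-,\quad \mathcal{K}_2^{+}=\sum_{|j|,|k|\ge1}jkv_{k-j}\frac{\partial^2}{\partial v_j\partial v_k},\quad \mathcal{K}_2^{-}=\sum_{|j|,|k|\ge1}jkv_{k+j}\frac{\partial^2}{\partial v_j\partial v_k},$$ $$\mathcal{J}=2\sum_{|k|\ge1}kuv_k\frac{\partial^2}{\partial u\partial v_k}+\sum_{|j|,|k|\ge1}jkv_jv_k\frac{\partial^2}{\partial v_j\partial v_k}+\sum_{|k|\ge1}k^2v_k\frac{\partial}{\partial v_k}+u^2\frac{\partial^2}{\partial u^2}+u\frac{\partial}{\partial u}.$$ Set $\mathcal{L}_0=-\mathcal{N}-2\mathcal{Y}_1-2\mathcal{Y}_2$; $\mathcal{L}_1^{(1)}=\mathcal{N}+2\mathcal{Z}_1+2\mathcal{Z}_2$,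 $\mathcal{L}_2^{(1)}=2\mathcal{K}_1+\mathcal{K}_2$; $\mathcal{L}_1^{(2)}=0$, $\mathcal{L}_2^{(2)}=-2\mathcal{K}_1^--\mathcal{K}_2^-+\mathcal{J}$; $\mathcal{L}_1^{(4)}=-\frac12\mathcal{L}_1^{(1)}$, $\mathcal{L}_2^{(4)}=\frac14\mathcal{L}_2^{(1)}$. (All infinite sums are finite on each polynomial. "First order pseudodifferential operator" here means a linear combination of compositions of multiplication operators, the projections $\mathcal{R}^\pm$, and first order partial derivatives.) Exponentials. $e^{\frac\tau2\mathcal{D}_N^{(\beta)}}$ and $e^{\frac\tau2\Delta_N^{(\beta)}}$ (on trace polynomials) are defined by their power series; $\mathcal{D}_N^{(\beta)}$ preserves the finite-dimensional subspaces of bounded trace degree, where the trace degree of $u^{k_0}\prod_jv_j^{k_j}$ is $|k_0|+\sum_j|j|k_j$. *)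

theory Defs
  imports "HOL-Analysis.Analysis" "HOL-Library.Poly_Mapping"
begin

typedef nzint = "{k :: int. k \<noteq> 0}"
  morphisms int_of_nz nz_of_int
  by (rule exI[of _ 1]) simp

text \<open>The monomial \<open>u^a * (\<Prod>j. v_j ^ m j)\<close> is the pair \<open>(a, m)\<close>; the trace polynomials are the
  monoid algebra of these monomials over the complex numbers.\<close>

type_synonym tmono = "int \<times> (nzint \<Rightarrow>\<^sub>0 nat)"
type_synonym tpoly = "tmono \<Rightarrow>\<^sub>0 complex"
type_synonym tpop = "tpoly \<Rightarrow> tpoly"

definition u_pow :: "int \<Rightarrow> tpoly" where
  "u_pow k = Poly_Mapping.single (k, 0) 1"

definition v_var :: "int \<Rightarrow> tpoly" where
  "v_var k = (if k = 0 then 1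
          else Poly_Mapping.single (0, Poly_Mapping.single (nz_of_int k) 1) 1)"

definition scl :: "complex \<Rightarrow> tpop" where
  "scl c P = Poly_Mapping.single 0 c * P"

definition lin_ext :: "(tmono \<Rightarrow> tpoly) \<Rightarrow> tpop" where
  "lin_ext f P = (\<Sum>m\<in>Poly_Mapping.keys P. scl (Poly_Mapping.lookup P m) (f m))"

definition d_u :: tpop where
  "d_u = lin_ext (\<lambda>(a, m). Poly_Mapping.single (a - 1, m) (of_int a))"

text \<open>\<open>d_v k\<close> is only meaningful for \<open>k \<noteq> 0\<close>. When the variable does not occur in \<open>m\<close>, the
  subtraction of exponents is truncated but the coefficient is \<open>0\<close>.\<close>

definition d_v :: "int \<Rightarrow> tpop" where
  "d_v k = lin_ext (\<lambda>(a, m). Poly_Mapping.single (a, m - Poly_Mapping.single (nz_of_int k) 1)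
                              (of_nat (Poly_Mapping.lookup m (nz_of_int k))))"

definition R_plus :: tpop where
  "R_plus = lin_ext (\<lambda>(a, m). if a \<ge> 0 then Poly_Mapping.single (a, m) 1 else 0)"

definition R_minus :: tpop where
  "R_minus = lin_ext (\<lambda>(a, m). if a \<le> -1 then Poly_Mapping.single (a, m) 1 else 0)"

text \<open>\<open>sum' f I\<close> sums over the indices in \<open>I\<close> with nonzero summand; on each trace polynomial there are only
  finitely many of them in every sum below.\<close>

definition op_N :: tpop where
  "op_N P = sum' (\<lambda>k. of_int \<bar>k\<bar> * v_var k * d_v k P) {k. \<bar>k\<bar> \<ge> 1}
            + u_pow 1 * d_u (R_plus P - R_minus P)"

definition op_Y1 :: tpop where
  "op_Y1 P = sum' (\<lambda>k. v_var k * u_pow 1 * R_plus (d_u (u_pow (-k) * R_plus P))) {1..}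
             - sum' (\<lambda>k. v_var k * u_pow 1 * R_minus (d_u (u_pow (-k) * R_minus P))) {..-1}"

definition op_Y2 :: tpop where
  "op_Y2 P = sum' (\<lambda>k. (\<Sum>j=1..k-1. of_int j * v_var j * v_var (k - j)) * d_v k P) {2..}
             - sum' (\<lambda>k. (\<Sum>j=k+1..-1. of_int j * v_var j * v_var (k - j)) * d_v k P) {..-2}"

definition op_Z1 :: tpop where
  "op_Z1 P = sum' (\<lambda>k. (\<Sum>j=1..k-1. of_int (k - j) * v_var (k - 2 * j)) * d_v k P) {2..}
             - sum' (\<lambda>k. (\<Sum>j=k+1..-1. of_int (k - j) * v_var (k - 2 * j)) * d_v k P) {..-2}"

definition op_Z2 :: tpop where
  "op_Z2 P = sum' (\<lambda>k. u_pow (-k + 1) * R_plus (d_u (u_pow (-k) * R_plus P))) {1..}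
             - sum' (\<lambda>k. u_pow (-k + 1) * R_minus (d_u (u_pow (-k) * R_minus P))) {..-1}"

definition op_K1_plus :: tpop where
  "op_K1_plus P = sum' (\<lambda>k. of_int k * u_pow (-k + 1) * d_v k (d_u P)) {k. \<bar>k\<bar> \<ge> 1}"

definition op_K1_minus :: tpop where
  "op_K1_minus P = sum' (\<lambda>k. of_int k * u_pow (k + 1) * d_v k (d_u P)) {k. \<bar>k\<bar> \<ge> 1}"

definition op_K1 :: tpop where
  "op_K1 P = op_K1_plus P - op_K1_minus P"

definition op_K2_plus :: tpop where
  "op_K2_plus P = sum' (\<lambda>(j, k). of_int (j * k) * v_var (k - j) * d_v j (d_v k P))
                    {(j, k). \<bar>j\<bar> \<ge> 1 \<and> \<bar>k\<bar> \<ge> 1}"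

definition op_K2_minus :: tpop where
  "op_K2_minus P = sum' (\<lambda>(j, k). of_int (j * k) * v_var (k + j) * d_v j (d_v k P))
                     {(j, k). \<bar>j\<bar> \<ge> 1 \<and> \<bar>k\<bar> \<ge> 1}"

definition op_K2 :: tpop where
  "op_K2 P = op_K2_plus P - op_K2_minus P"

definition op_J :: tpop where
  "op_J P = 2 * sum' (\<lambda>k. of_int k * u_pow 1 * v_var k * d_u (d_v k P)) {k. \<bar>k\<bar> \<ge> 1}
            + sum' (\<lambda>(j, k). of_int (j * k) * v_var j * v_var k * d_v j (d_v k P))
                {(j, k). \<bar>j\<bar> \<ge> 1 \<and> \<bar>k\<bar> \<ge> 1}
            + sum' (\<lambda>k. of_int (k^2) * v_var k * d_v k P) {k. \<bar>k\<bar> \<ge> 1}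
            + u_pow 2 * d_u (d_u P) + u_pow 1 * d_u P"

datatype beta = Beta1 | Beta2 | Beta4

definition L0 :: tpop where
  "L0 P = - op_N P - 2 * op_Y1 P - 2 * op_Y2 P"

definition L1_real :: tpop where
  "L1_real P = op_N P + 2 * op_Z1 P + 2 * op_Z2 P"

definition L2_real :: tpop where
  "L2_real P = 2 * op_K1 P + op_K2 P"

fun L1 :: "beta \<Rightarrow> tpop" where
  "L1 Beta1 P = L1_real P"
| "L1 Beta2 P = 0"
| "L1 Beta4 P = scl (-1/2) (L1_real P)"

fun L2 :: "beta \<Rightarrow> tpop" where
  "L2 Beta1 P = L2_real P"
| "L2 Beta2 P = - 2 * op_K1_minus P - op_K2_minus P + op_J P"
| "L2 Beta4 P = scl (1/4) (L2_real P)"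

definition D_op :: "beta \<Rightarrow> nat \<Rightarrow> tpop" where
  "D_op b N P = L0 P + scl (1 / of_nat N) (L1 b P) + scl (1 / of_nat N ^ 2) (L2 b P)"

text \<open>The order \<open>r\<close> counts the partial derivatives in the composition; \<open>E\<close> collects additional
  factors of order \<open>0\<close>.\<close>

inductive op_comp :: "tpop set \<Rightarrow> nat \<Rightarrow> tpop \<Rightarrow> bool" for E where
  op_comp_id: "op_comp E 0 id"
| op_comp_mult: "op_comp E r T \<Longrightarrow> op_comp E r ((*) Q \<circ> T)"
| op_comp_extra: "S \<in> E \<Longrightarrow> op_comp E r T \<Longrightarrow> op_comp E r (S \<circ> T)"
| op_comp_d_u: "op_comp E r T \<Longrightarrow> op_comp E (Suc r) (d_u \<circ> T)"
| op_comp_d_v: "k \<noteq> 0 \<Longrightarrow> op_comp E r T \<Longrightarrow> op_comp E (Suc r) (d_v k \<circ> T)"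

text \<open>Linear combinations may be infinite, provided that they are finite on each trace polynomial.\<close>

definition op_lincomb :: "tpop set \<Rightarrow> tpop \<Rightarrow> bool" where
  "op_lincomb S T \<longleftrightarrow>
     (\<exists>(c :: nat \<Rightarrow> complex) W. (\<forall>i. W i \<in> S) \<and>
        (\<forall>P. finite {i. scl (c i) (W i P) \<noteq> 0} \<and> T P = sum' (\<lambda>i. scl (c i) (W i P)) UNIV))"

definition first_order_pseudodiff_op :: "tpop \<Rightarrow> bool" where
  "first_order_pseudodiff_op = op_lincomb {T. \<exists>r\<le>1. op_comp {R_plus, R_minus} r T}"

definition second_order_diff_op :: "tpop \<Rightarrow> bool" where
  "second_order_diff_op = op_lincomb {T. \<exists>r\<le>2. op_comp {} r T}"

definition mpow :: "'a::semiring_1^'m^'m \<Rightarrow> nat \<Rightarrow> 'a^'m^'m" where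
  "mpow A n = (((**) A) ^^ n) (mat 1)"

definition mpowi :: "'a::semiring_1^'m^'m \<Rightarrow> int \<Rightarrow> 'a^'m^'m" where
  "mpowi A k = (if k \<ge> 0 then mpow A (nat k) else mpow (matrix_inv A) (nat (- k)))"

definition mscale :: "complex \<Rightarrow> complex^'m^'m \<Rightarrow> complex^'m^'m" where
  "mscale c A = map_matrix ((*) c) A"

definition madj :: "complex^'m^'m \<Rightarrow> complex^'m^'m" where
  "madj A = map_matrix cnj (transpose A)"

definition mexp :: "complex^'m^'m \<Rightarrow> complex^'m^'m" where
  "mexp X = suminf (\<lambda>n. (1 / fact n) *\<^sub>R mpow X n)"

text \<open>\<open>SO(N, \<real>)\<close> inside the complex matrices.\<close>

definition SO :: "(complex^'n^'n) set" where
  "SO = map_matrix complex_of_real ` {A :: real^'n^'n. orthogonal_matrix A \<and> det A = 1}"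

definition SU :: "(complex^'n^'n) set" where
  "SU = {A. madj A ** A = mat 1 \<and> det A = 1}"

definition Omega0 :: "complex^2^2" where
  "Omega0 = vector [vector [0, 1], vector [-1, 0]]"

text \<open>Row and column indices of \<open>2N \<times> 2N\<close> matrices are pairs (block, position in the block).\<close>

definition Omega :: "complex^('n::finite \<times> 2)^('n \<times> 2)" where
  "Omega = (\<chi> p q. if fst p = fst q then Omega0 $ snd p $ snd q else 0)"

definition Sp :: "(complex^('n::finite \<times> 2)^('n \<times> 2)) set" where
  "Sp = {A. transpose A ** Omega ** A = Omega \<and> madj A ** A = mat 1}"

definition lie_algebra :: "(complex^'m^'m) set \<Rightarrow> (complex^'m^'m) set" where
  "lie_algebra G = {X. \<forall>t::real. mexp (t *\<^sub>R X) \<in> G}"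

text \<open>The trace is already real on the Lie algebras used here, which consist of
  skew-Hermitian matrices.\<close>

definition tr_inner :: "real \<Rightarrow> complex^'m^'m \<Rightarrow> complex^'m^'m \<Rightarrow> real" where
  "tr_inner c X Y = c * Re (trace (X ** madj Y))"

text \<open>\<open>span\<close> is the real linear span.\<close>

definition lie_orthonormal_basis ::
    "real \<Rightarrow> (complex^'m^'m) set \<Rightarrow> (complex^'m^'m) set \<Rightarrow> bool" where
  "lie_orthonormal_basis c G B \<longleftrightarrow>
     span B = lie_algebra G \<and>
     (\<forall>X\<in>B. \<forall>Y\<in>B. tr_inner c X Y = (if X = Y then 1 else 0))"

text \<open>Functions on \<open>G\<close> are represented by functions on all matrices; at points of \<open>G\<close>, the
  values below only depend on the restriction to \<open>G\<close> when \<open>X\<close> is in the Lie algebra of \<open>G\<close>.\<close>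

definition lie_deriv ::
    "complex^'m^'m \<Rightarrow> (complex^'m^'m \<Rightarrow> complex^'m^'m) \<Rightarrow> complex^'m^'m \<Rightarrow> complex^'m^'m" where
  "lie_deriv X f = (\<lambda>k. vector_derivative (\<lambda>t::real. f (k ** mexp (t *\<^sub>R X))) (at 0))"

definition laplacian ::
    "(complex^'m^'m) set \<Rightarrow> (complex^'m^'m \<Rightarrow> complex^'m^'m) \<Rightarrow> complex^'m^'m \<Rightarrow> complex^'m^'m" where
  "laplacian B f = (\<lambda>k. \<Sum>X\<in>B. lie_deriv X (lie_deriv X f) k)"

text \<open>The trace normalized by the matrix size, so \<open>1/N\<close> for \<open>N \<times> N\<close> matrices and \<open>1/(2N)\<close>
  for \<open>2N \<times> 2N\<close> matrices.\<close>

definition ntr :: "complex^'m^'m \<Rightarrow> complex" where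
  "ntr A = trace A / of_nat CARD('m)"

definition tp_eval :: "tpoly \<Rightarrow> complex^'m^'m \<Rightarrow> complex^'m^'m" where
  "tp_eval P A =
     (\<Sum>(a, m)\<in>Poly_Mapping.keys P.
        mscale (Poly_Mapping.lookup P (a, m) *
                (\<Prod>j\<in>Poly_Mapping.keys m. ntr (mpowi A (int_of_nz j)) ^ Poly_Mapping.lookup m j))
          (mpowi A a))"

text \<open>The power series of \<open>exp (c T)\<close>. The one on trace polynomials is taken coefficientwise: on a finite-dimensional \<open>T\<close>-invariant space of trace polynomials this is the
  limit in the unique vector space topology.\<close>

definition tp_exp :: "complex \<Rightarrow> tpop \<Rightarrow> tpop" where
  "tp_exp c T P =
     Abs_poly_mapping (\<lambda>m. suminf (\<lambda>n. c ^ n / fact n * Poly_Mapping.lookup ((T ^^ n) P) m))"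

definition fun_exp :: "complex \<Rightarrow>
    ((complex^'m^'m \<Rightarrow> complex^'m^'m) \<Rightarrow> (complex^'m^'m \<Rightarrow> complex^'m^'m)) \<Rightarrow>
    (complex^'m^'m \<Rightarrow> complex^'m^'m) \<Rightarrow> complex^'m^'m \<Rightarrow> complex^'m^'m" where
  "fun_exp c T f = (\<lambda>k. suminf (\<lambda>n. mscale (c ^ n / fact n) ((T ^^ n) f k)))"

end

theory Submission
  imports Defs
begin

text \<open>For an orthonormal basis \<open>B\<close> of the Lie algebra, \<open>\<Sum>X\<in>B. X C X\<close> and \<open>\<Sum>X\<in>B. tr(C X) X\<close> are
  determined by the orthogonal projection onto the Lie algebra, hence are explicit in \<open>C\<close>. Taking
  \<open>C = A\<^sup>k\<close> with \<open>A\<close> in the group, they are evaluations of trace polynomials at \<open>A\<close>, given in all three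
  cases by one formula with four constants. Both sides of the intertwining identity satisfy the same
  product rule under multiplication of a trace polynomial by \<open>v\<^sub>k\<close>, so it suffices to compare them on
  the powers of \<open>u\<close>, where the recursion for \<open>\<Delta>(A\<^sup>n\<^sup>+\<^sup>1)\<close> follows from the product rule. The same
  induction bounds the trace degree, and the exponential series become series in a finite dimensional
  space.\<close>

section \<open>Trace polynomials and linear operators on them\<close>

text \<open>\<open>R_plus\<close> and \<open>R_minus\<close> commute with multiplication by
  \<open>v_var k\<close> but not by \<open>u_pow 1\<close>, so the operator side has no product rule
  in \<open>u\<close> and its values on powers of \<open>u\<close> need a closed form. Along the
  flow \<open>A ** mexp (t *\<^sub>R X)\<close> the second derivative of a product of n factors
  \<open>A\<close> inserts two copies of \<open>X\<close> at n positions: n coincident pairs and n -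
  d pairs at each distance d. Between two copies stands a power of \<open>A\<close>, whose
  contraction commutes with \<open>A\<close>. The pair count is the weight
  \<open>\<bar>a - d\<bar>\<close> in \<open>Dop_u_pow\<close>; one more factor adds exactly the
  pairs containing the new position. The constants come from the complex linear projection p onto
  the complexified Lie algebra, to which a basis contracts up to the factor - 1/c. The identity part
  of p gives the leading trace and \<delta>, the subtracted trace for \<open>SU\<close> gives
  \<gamma>, and the transpose for \<open>SO\<close> or \<open>symp\<close> for \<open>Sp\<close>,
  which sends \<open>mpowi A k\<close> to \<open>mpowi A (- k)\<close>, gives \<alpha> and
  \<epsilon>. In the derivative computations group membership enters only through these
  contractions.\<close>

abbreviation monomial :: "tmono \<Rightarrow> tpoly" where
  "monomial m \<equiv> Poly_Mapping.single m 1"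

abbreviation nz :: "int \<Rightarrow> nzint" where
  "nz \<equiv> nz_of_int"

abbreviation lookup where "lookup \<equiv> Poly_Mapping.lookup"
abbreviation keys where "keys \<equiv> Poly_Mapping.keys"
abbreviation single where "single \<equiv> Poly_Mapping.single"

declare One_nat_def [simp del]

lemma int_of_nz_nz [simp]: "k \<noteq> 0 \<Longrightarrow> int_of_nz (nz k) = k"
  by (simp add: nz_of_int_inverse)

lemma nz_int_of_nz [simp]: "nz (int_of_nz k) = k"
  by (rule int_of_nz_inverse)

lemma int_of_nz_neq_0 [simp]: "int_of_nz k \<noteq> 0"
  using int_of_nz[of k] by simp

lemma nz_inject: "j \<noteq> 0 \<Longrightarrow> k \<noteq> 0 \<Longrightarrow> nz j = nz k \<longleftrightarrow> j = k"
  by (simp add: nz_of_int_inject)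

lemma nz_cases: obtains k where "k \<noteq> 0" "x = nz k"
  using int_of_nz_neq_0 nz_int_of_nz by metis

lemma v_var_0 [simp]: "v_var 0 = 1"
  by (simp add: v_var_def)

lemma v_var_mono: "k \<noteq> 0 \<Longrightarrow> v_var k = monomial (0, single (nz k) 1)"
  by (simp add: v_var_def)

lemma u_pow_0 [simp]: "u_pow 0 = 1"
  by (simp add: u_pow_def flip: zero_prod_def)

lemma u_pow_add: "u_pow (j + k) = u_pow j * u_pow k"
  by (simp add: u_pow_def mult_single)

lemma scl_add: "scl c (P + Q) = scl c P + scl c Q"
  by (simp add: scl_def distrib_left)

lemma scl_diff: "scl c (P - Q) = scl c P - scl c Q"
  by (simp add: scl_def right_diff_distrib)

lemma scl_0 [simp]: "scl c 0 = 0" "scl 0 P = 0"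
  by (simp_all add: scl_def)

lemma scl_1 [simp]: "scl 1 P = P"
  by (simp add: scl_def)

lemma scl_add_left: "scl (a + b) P = scl a P + scl b P"
  by (simp add: scl_def single_add distrib_right)

lemma scl_uminus_left: "scl (- a) P = - scl a P"
  by (simp add: scl_def single_uminus)

lemma scl_uminus: "scl a (- P) = - scl a P"
  by (simp add: scl_def)

lemma scl_mult [simp]: "scl a P * Q = scl a (P * Q)" "P * scl a Q = scl a (P * Q)"
  by (simp_all add: scl_def mult_ac)

lemma scl_scl [simp]: "scl a (scl b P) = scl (a * b) P"
  by (simp add: scl_def mult_single flip: mult.assoc)

lemma scl_sum: "scl c (sum f I) = (\<Sum>i\<in>I. scl c (f i))"
  by (simp add: scl_def sum_distrib_left)

lemma of_int_mult_eq_scl: "of_int k * P = scl (of_int k) P"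
  by (simp add: scl_def)

lemma numeral_mult_eq_scl: "numeral n * P = scl (numeral n) P"
  by (simp add: scl_def)

lemma lookup_scl [simp]: "lookup (scl c P) m = c * lookup P m"
  by (simp add: scl_def map.rep_eq when_def flip: mult_map_scale_conv_mult)

lemma tpoly_eq_sum: "finite S \<Longrightarrow> keys P \<subseteq> S \<Longrightarrow> P = (\<Sum>m\<in>S. scl (lookup P m) (monomial m))"
proof (rule poly_mapping_eqI)
  fix m assume "finite S" "keys P \<subseteq> S"
  then show "lookup P m = lookup (\<Sum>m\<in>S. scl (lookup P m) (monomial m)) m"
    by (auto simp: lookup_sum lookup_single when_def if_distrib in_keys_iff cong: if_cong)
qed

section \<open>Complex linear operators on trace polynomials\<close>

definition tp_linear :: "tpop \<Rightarrow> bool" where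
  "tp_linear T \<longleftrightarrow> (\<forall>P Q. T (P + Q) = T P + T Q) \<and> (\<forall>c P. T (scl c P) = scl c (T P))"

lemma tp_linearD:
  assumes "tp_linear T"
  shows "T (P + Q) = T P + T Q" "T (scl c P) = scl c (T P)" "T 0 = 0" "T (- P) = - T P"
    "T (P - Q) = T P - T Q" "T (of_int k * P) = of_int k * T P"
proof -
  show a: "T (P + Q) = T P + T Q" and s: "T (scl c P) = scl c (T P)" for P Q c
    using assms by (auto simp: tp_linear_def)
  show "T 0 = 0" using s[of 0 0] by simp
  show m: "T (- P) = - T P" for P using s[of "-1" P] by (simp add: scl_uminus_left)
  show "T (P - Q) = T P - T Q" using a[of P "-Q"] m[of Q] by simp
  show "T (of_int k * P) = of_int k * T P" by (simp add: of_int_mult_eq_scl s)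
qed

lemma tp_linear_sum:
  assumes "tp_linear T"
  shows "T (sum f I) = (\<Sum>i\<in>I. T (f i))"
  by (induction I rule: infinite_finite_induct) (simp_all add: tp_linearD(1,3)[OF assms])

lemma tp_linear_intros:
  "tp_linear (\<lambda>P. P)"
  "tp_linear (\<lambda>P. 0)"
  "tp_linear S \<Longrightarrow> tp_linear T \<Longrightarrow> tp_linear (\<lambda>P. S P + T P)"
  "tp_linear S \<Longrightarrow> tp_linear T \<Longrightarrow> tp_linear (\<lambda>P. S P - T P)"
  "tp_linear T \<Longrightarrow> tp_linear (\<lambda>P. - T P)"
  "tp_linear T \<Longrightarrow> tp_linear (\<lambda>P. Q * T P)"
  "tp_linear T \<Longrightarrow> tp_linear (\<lambda>P. T P * Q)"
  "tp_linear T \<Longrightarrow> tp_linear (\<lambda>P. scl c (T P))"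
  by (auto simp: tp_linear_def algebra_simps scl_add scl_diff scl_uminus)

lemma tp_linear_compose: "tp_linear S \<Longrightarrow> tp_linear T \<Longrightarrow> tp_linear (\<lambda>P. S (T P))"
  by (auto simp: tp_linear_def)

lemma tp_linear_eqI:
  assumes "tp_linear S" "tp_linear T" "\<And>m. S (monomial m) = T (monomial m)"
  shows "S P = T P"
proof -
  have P: "P = (\<Sum>m\<in>keys P. scl (lookup P m) (monomial m))"
    by (rule tpoly_eq_sum) auto
  have "S (\<Sum>m\<in>keys P. scl (lookup P m) (monomial m)) = T (\<Sum>m\<in>keys P. scl (lookup P m) (monomial m))"
    unfolding tp_linear_sum[OF assms(1)] tp_linear_sum[OF assms(2)]
    unfolding tp_linearD(2)[OF assms(1)] tp_linearD(2)[OF assms(2)] assms(3) ..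
  then show ?thesis using P by metis
qed

lemma lin_ext_superset:
  assumes "finite S" "keys P \<subseteq> S"
  shows "lin_ext f P = (\<Sum>m\<in>S. scl (lookup P m) (f m))"
  unfolding lin_ext_def using assms by (intro sum.mono_neutral_left) (auto simp: in_keys_iff)

lemma tp_linear_lin_ext: "tp_linear (lin_ext f)"
  unfolding tp_linear_def
proof safe
  fix P Q :: tpoly and c
  let ?S = "keys P \<union> keys Q"
  have "keys (P + Q) \<subseteq> ?S" by (rule keys_add)
  then show "lin_ext f (P + Q) = lin_ext f P + lin_ext f Q"
    by (simp add: lin_ext_superset[of ?S] lookup_add scl_add_left sum.distrib)
  have "keys (scl c P) \<subseteq> keys P" by (auto simp: in_keys_iff)
  then show "lin_ext f (scl c P) = scl c (lin_ext f P)"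
    by (simp add: lin_ext_superset[of "keys P"] scl_sum)
qed

lemma lin_ext_mono [simp]: "lin_ext f (monomial m) = f m"
  by (simp add: lin_ext_def)

text \<open>The number of v-factors decreases while the exponent of \<open>u\<close> stays put, so
  the base case has to cover all integer powers of \<open>u\<close> at once.\<close>

lemma tmono_induct [case_names u v]:
  assumes "\<And>a. R (a, 0)" "\<And>a m k. k \<noteq> 0 \<Longrightarrow> R (a, m) \<Longrightarrow> R (a, single (nz k) 1 + m)"
  shows "R (tm :: tmono)"
proof -
  have "R (a, m)" if "sum (lookup m) (keys m) = n" for a n m
    using that
  proof (induction n arbitrary: m)
    case 0
    then have "lookup m x = 0" for x
      by (metis finite_keys lookup_not_eq_zero_eq_in_keys sum_eq_0_iff)
    then have "m = 0" by (intro poly_mapping_eqI) auto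
    then show ?case using assms(1) by simp
  next
    case (Suc n)
    then have "\<exists>x. x \<in> keys m" by (metis ex_in_conv nat.simps(3) sum.empty)
    then obtain x where x: "x \<in> keys m" by auto
    obtain k where k: "k \<noteq> 0" "x = nz k" by (rule nz_cases)
    \<comment> \<open>Subtraction of exponents truncates at 0; \<open>x \<in> keys m\<close> makes
      it exact here.\<close>
    define m' where "m' = m - single x 1"
    have m: "m = single x 1 + m'"
      using x by (intro poly_mapping_eqI)
        (auto simp: m'_def lookup_add lookup_minus lookup_single when_def in_keys_iff)
    have "keys m' \<subseteq> keys m"
      by (auto simp: m'_def in_keys_iff lookup_minus)
    then have "sum (lookup m') (keys m') = sum (lookup m') (keys m)"
      by (intro sum.mono_neutral_left) (auto simp: in_keys_iff)
    moreover have "sum (lookup m) (keys m) = 1 + sum (lookup m') (keys m)"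
      using x by (subst m) (auto simp: lookup_add sum.distrib lookup_single when_def)
    ultimately have "sum (lookup m') (keys m') = n" using Suc by simp
    then show ?case using Suc.IH assms(2) k m by metis
  qed
  then show ?thesis by (cases tm) auto
qed

lemma v_var_mult_mono: "k \<noteq> 0 \<Longrightarrow> v_var k * monomial (a, m) = monomial (a, single (nz k) 1 + m)"
  by (simp add: v_var_mono mult_single)

lemma tpoly_mono_induct [case_names monomial add scl]:
  assumes m: "\<And>m. R (monomial m)" and add: "\<And>P Q. R P \<Longrightarrow> R Q \<Longrightarrow> R (P + Q)" and scl: "\<And>c P. R P \<Longrightarrow> R (scl c P)"
  shows "R (P :: tpoly)"
proof -
  \<comment> \<open>The empty sum has no case of its own; it arises as the multiple by 0 of a
    monomial.\<close>
  have "R 0" using scl[OF m, of 0] by simp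
  then have "R (\<Sum>m\<in>S. scl (lookup P m) (monomial m))" for S
    by (induction S rule: infinite_finite_induct) (auto intro: m add scl)
  moreover have "P = (\<Sum>m\<in>keys P. scl (lookup P m) (monomial m))"
    by (rule tpoly_eq_sum) auto
  ultimately show ?thesis by metis
qed

text \<open>The induction behind all later comparisons: v-factors are peeled off one at a time until
  a power of \<open>u\<close> remains.\<close>

lemma tpoly_induct [case_names u v add scl]:
  assumes u: "\<And>a. R (u_pow a)" and v: "\<And>k P. k \<noteq> 0 \<Longrightarrow> R P \<Longrightarrow> R (v_var k * P)"
    and add: "\<And>P Q. R P \<Longrightarrow> R Q \<Longrightarrow> R (P + Q)" and scl: "\<And>c P. R P \<Longrightarrow> R (scl c P)"
  shows "R (P :: tpoly)"
proof (rule tpoly_mono_induct)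
  fix m
  show "R (monomial m)"
  proof (induction m rule: tmono_induct)
    case (u a)
    then show ?case using assms(1)[of a] by (simp add: u_pow_def)
  next
    case (v a m k)
    then show ?case using assms(2)[OF v] by (simp add: v_var_mult_mono)
  qed
qed (rule add scl; assumption)+

section \<open>Derivatives and projections under multiplication by \<open>v_var j\<close>\<close>

lemma tp_linear_ops: "tp_linear d_u" "tp_linear (d_v k)" "tp_linear R_plus" "tp_linear R_minus"
  by (auto simp: d_u_def d_v_def R_plus_def R_minus_def tp_linear_lin_ext)

lemmas d_u_linear = tp_linear_ops(1)[THEN tp_linearD(1)] tp_linear_ops(1)[THEN tp_linearD(2)]
  tp_linear_ops(1)[THEN tp_linearD(3)] tp_linear_ops(1)[THEN tp_linearD(6)]
lemmas d_v_linear = tp_linear_ops(2)[THEN tp_linearD(1)] tp_linear_ops(2)[THEN tp_linearD(2)]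
  tp_linear_ops(2)[THEN tp_linearD(3)] tp_linear_ops(2)[THEN tp_linearD(6)]

text \<open>An operator given on monomials has a commutator with \<open>v_var j\<close> that is
  again given on monomials, by \<open>g\<close>. It is zero for \<open>d_u\<close>,
  \<open>R_plus\<close> and \<open>R_minus\<close>, and a Kronecker delta times the identity for
  \<open>d_v\<close>.\<close>

lemma lin_ext_v_mult:
  assumes "j \<noteq> 0" "\<And>a m. f (a, single (nz j) 1 + m) = v_var j * f (a, m) + g (a, m)"
  shows "lin_ext f (v_var j * P) = v_var j * lin_ext f P + lin_ext g P"
proof (rule tp_linear_eqI[where S="\<lambda>P. lin_ext f (v_var j * P)"
      and T="\<lambda>P. v_var j * lin_ext f P + lin_ext g P" and P=P])
  show "tp_linear (\<lambda>P. lin_ext f (v_var j * P))"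
    by (rule tp_linear_compose[OF tp_linear_lin_ext, of "(*) (v_var j)"])
      (rule tp_linear_intros(6)[OF tp_linear_intros(1)])
  show "tp_linear (\<lambda>P. v_var j * lin_ext f P + lin_ext g P)"
    by (rule tp_linear_intros(3) tp_linear_intros(6) tp_linear_lin_ext)+
  fix m :: tmono
  show "lin_ext f (v_var j * monomial m) = v_var j * lin_ext f (monomial m) + lin_ext g (monomial m)"
    by (cases m) (simp add: v_var_mult_mono[OF assms(1)] assms(2))
qed

lemma d_u_v_mult [simp]: "d_u (v_var j * P) = v_var j * d_u P"
proof (cases "j = 0")
  case False
  then show ?thesis
    unfolding d_u_def by (subst lin_ext_v_mult[OF False, where g="\<lambda>_. 0"])
      (auto simp: v_var_mono mult_single lin_ext_def)
qed simp

lemma R_plus_v_mult [simp]: "R_plus (v_var j * P) = v_var j * R_plus P"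
proof (cases "j = 0")
  case False
  then show ?thesis
    unfolding R_plus_def by (subst lin_ext_v_mult[OF False, where g="\<lambda>_. 0"])
      (auto simp: v_var_mono mult_single lin_ext_def)
qed simp

lemma R_minus_v_mult [simp]: "R_minus (v_var j * P) = v_var j * R_minus P"
proof (cases "j = 0")
  case False
  then show ?thesis
    unfolding R_minus_def by (subst lin_ext_v_mult[OF False, where g="\<lambda>_. 0"])
      (auto simp: v_var_mono mult_single lin_ext_def)
qed simp

lemma d_v_v_mult:
  assumes "j \<noteq> 0" "k \<noteq> 0"
  shows "d_v k (v_var j * P) = v_var j * d_v k P + (if k = j then P else 0)"
proof -
  have *: "d_v k (v_var j * P) = v_var j * d_v k P + lin_ext (\<lambda>m. if k = j then monomial m else 0) P"
    unfolding d_v_def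
  proof (rule lin_ext_v_mult[OF assms(1)], unfold prod.case, goal_cases)
    case (1 a m)
    let ?e = "single (nz j) 1 :: nzint \<Rightarrow>\<^sub>0 nat"
    let ?f = "single (nz k) 1 :: nzint \<Rightarrow>\<^sub>0 nat"
    show ?case
    proof (cases "k = j")
      case True
      have "(?e + m) - ?e = m"
        by (intro poly_mapping_eqI) (simp add: lookup_add lookup_minus)
      \<comment> \<open>The exponent e + 1 of v_j splits into e and 1. For e = 0 the truncated
        subtraction is wrong, but its coefficient is 0.\<close>
      moreover have "lookup m (nz j) \<noteq> 0 \<Longrightarrow> ?e + (m - ?e) = m"
        by (intro poly_mapping_eqI) (auto simp: lookup_add lookup_minus lookup_single when_def)
      ultimately show ?thesis
        unfolding \<open>k = j\<close> v_var_mono[OF assms(1)] mult_single lookup_add lookup_single_eq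
        by (cases "lookup m (nz j) = 0") (simp_all add: of_nat_add single_add add.commute)
    next
      case False
      then have "(?e + m) - ?f = ?e + (m - ?f)"
        using assms
        by (intro poly_mapping_eqI) (auto simp: lookup_add lookup_minus lookup_single when_def nz_inject)
      moreover have "lookup ?e (nz k) = 0"
        using False assms by (simp add: lookup_single when_def nz_inject)
      ultimately show ?thesis using False
        unfolding v_var_mono[OF assms(1)] mult_single lookup_add by simp
    qed
  qed
  have **: "lin_ext (\<lambda>m. if k = j then monomial m else 0) P = (if k = j then P else 0)"
  proof (cases "k = j")
    case True
    have "(\<Sum>m\<in>keys P. scl (lookup P m) (monomial m)) = P"
      by (rule tpoly_eq_sum[symmetric]) auto
    then show ?thesis unfolding lin_ext_def if_P[OF True] .
  next
    case False
    show ?thesis unfolding lin_ext_def if_not_P[OF False] scl_0 by (rule sum.neutral_const)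
  qed
  show ?thesis using * unfolding ** .
qed

lemma d_u_u_pow [simp]: "d_u (u_pow a) = of_int a * u_pow (a - 1)"
  unfolding of_int_mult_eq_scl u_pow_def d_u_def lin_ext_mono prod.case scl_def mult_single by simp

lemma R_plus_u_pow: "R_plus (u_pow a) = (if a \<ge> 0 then u_pow a else 0)"
  by (simp add: R_plus_def u_pow_def)

lemma R_minus_u_pow: "R_minus (u_pow a) = (if a \<le> -1 then u_pow a else 0)"
  by (simp add: R_minus_def u_pow_def)

lemma d_v_u_pow [simp]: "d_v k (u_pow a) = 0"
  by (simp add: d_v_def u_pow_def)

text \<open>\<open>op_J\<close> takes the mixed derivative in the opposite order to
  \<open>op_K1_plus\<close> and \<open>op_K1_minus\<close>; this brings them to one form.\<close>

lemma d_v_d_u: "k \<noteq> 0 \<Longrightarrow> d_v k (d_u P) = d_u (d_v k P)"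
  by (induction P rule: tpoly_induct)
    (simp_all add: d_v_v_mult d_u_linear d_v_linear)

section \<open>Locally finite sums of operators\<close>

text \<open>\<open>sum'\<close> takes the default value 0 on an infinite support; a finite set
  containing the support excludes that case.\<close>

lemma sum'_eq_sum: "finite S \<Longrightarrow> S \<subseteq> I \<Longrightarrow> {k\<in>I. f k \<noteq> 0} \<subseteq> S \<Longrightarrow> sum' f I = sum f S"
  by (auto simp: sum.G_def intro!: sum.mono_neutral_left finite_subset[of _ S])

lemma sum'_single:
  fixes g :: "'i \<Rightarrow> 'a::comm_monoid_add"
  shows "sum' (\<lambda>k. if k = j then g k else 0) I = (if j \<in> I then g j else 0)"
proof -
  have "sum' (\<lambda>k. if k = j then g k else 0) I = sum (\<lambda>k. if k = j then g k else 0) (I \<inter> {j})"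
    by (rule sum'_eq_sum) auto
  then show ?thesis by auto
qed

text \<open>The support may shrink under \<open>T\<close>. Finiteness is required of the support of
  \<open>f\<close> itself, since otherwise \<open>sum' f I\<close> is the default 0 whatever the
  left side is.\<close>

lemma sum'_compose_linear:
  assumes "tp_linear T" "finite {k\<in>I. f k \<noteq> 0}"
  shows "sum' (\<lambda>k. T (f k)) I = T (sum' f I)"
proof -
  let ?S = "{k\<in>I. f k \<noteq> 0}"
  have "{k\<in>I. T (f k) \<noteq> 0} \<subseteq> ?S" using tp_linearD(3)[OF assms(1)] by force
  then have "sum' (\<lambda>k. T (f k)) I = (\<Sum>k\<in>?S. T (f k))" using assms by (intro sum'_eq_sum) auto
  also have "\<dots> = T (sum f ?S)" by (simp add: tp_linear_sum[OF assms(1)])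
  also have "sum f ?S = sum' f I" using assms by (simp add: sum.G_def)
  finally show ?thesis .
qed

lemma tp_linear_sum':
  assumes "\<And>k. k \<in> I \<Longrightarrow> tp_linear (F k)" "\<And>P. finite {k\<in>I. F k P \<noteq> 0}"
  shows "tp_linear (\<lambda>P. sum' (\<lambda>k. F k P) I)"
  unfolding tp_linear_def
proof safe
  fix P Q c
  have "sum' (\<lambda>k. F k (P + Q)) I = sum' (\<lambda>k. F k P + F k Q) I"
    using assms by (intro sum.cong') (auto simp: tp_linear_def)
  then show "sum' (\<lambda>k. F k (P + Q)) I = sum' (\<lambda>k. F k P) I + sum' (\<lambda>k. F k Q) I"
    using assms by (simp add: sum.distrib')
  have "sum' (\<lambda>k. F k (scl c P)) I = sum' (\<lambda>k. scl c (F k P)) I"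
    using assms by (intro sum.cong') (auto simp: tp_linear_def)
  then show "sum' (\<lambda>k. F k (scl c P)) I = scl c (sum' (\<lambda>k. F k P) I)"
    using sum'_compose_linear[of "scl c", OF tp_linear_intros(8)[OF tp_linear_intros(1)] assms(2)] by simp
qed

text \<open>Only finitely many variables occur in a trace polynomial. This makes the infinite sums
  over v-derivatives genuine sums instead of the default 0.\<close>

lemma finite_d_v: "finite {k. k \<noteq> 0 \<and> d_v k P \<noteq> 0}"
proof (induction P rule: tpoly_induct)
  case (v j P)
  have "{k. k \<noteq> 0 \<and> d_v k (v_var j * P) \<noteq> 0} \<subseteq> insert j {k. k \<noteq> 0 \<and> d_v k P \<noteq> 0}"
    using v by (auto simp: d_v_v_mult split: if_splits)
  then show ?case using v finite_subset by blast
next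
  case (add P Q)
  have "{k. k \<noteq> 0 \<and> d_v k (P + Q) \<noteq> 0} \<subseteq> {k. k \<noteq> 0 \<and> d_v k P \<noteq> 0} \<union> {k. k \<noteq> 0 \<and> d_v k Q \<noteq> 0}"
    by (auto simp: d_v_linear)
  then show ?case using add finite_subset by blast
next
  case (scl c P)
  have "{k. k \<noteq> 0 \<and> d_v k (scl c P) \<noteq> 0} \<subseteq> {k. k \<noteq> 0 \<and> d_v k P \<noteq> 0}"
    by (auto simp: d_v_linear)
  then show ?case using scl finite_subset by blast
qed auto

section \<open>First and second order operators in the variables \<open>v_var k\<close>\<close>

definition vop :: "(int \<Rightarrow> tpoly) \<Rightarrow> int set \<Rightarrow> tpop" where
  "vop Q I P = sum' (\<lambda>k. Q k * d_v k P) I"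

lemma vop_finite:
  assumes "0 \<notin> I" shows "finite {k\<in>I. Q k * d_v k P \<noteq> 0}"
  by (rule finite_subset[OF _ finite_d_v[of P]]) (use assms in auto)

lemma tp_linear_vop:
  assumes "0 \<notin> I" shows "tp_linear (vop Q I)"
  unfolding vop_def
  by (intro tp_linear_sum' tp_linear_intros(6) tp_linear_ops vop_finite[OF assms])

lemma vop_u_pow [simp]: "vop Q I (u_pow a) = 0"
  by (simp add: vop_def sum.G_def)

text \<open>As a vector field with components \<open>Q k\<close>, the operator is a derivation: it
  kills \<open>u\<close> and sends \<open>v_var j\<close> to \<open>Q j\<close> if
  \<open>j \<in> I\<close> and to 0 otherwise.\<close>

lemma vop_v_mult:
  assumes "0 \<notin> I" "j \<noteq> 0"
  shows "vop Q I (v_var j * P) = v_var j * vop Q I P + (if j \<in> I then Q j * P else 0)"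
proof -
  have "vop Q I (v_var j * P) = sum' (\<lambda>k. v_var j * (Q k * d_v k P) + (if k = j then Q k * P else 0)) I"
    unfolding vop_def
  proof (rule sum.cong')
    fix k assume "k \<in> I"
    then have "k \<noteq> 0" using assms by metis
    then show "Q k * d_v k (v_var j * P) = v_var j * (Q k * d_v k P) + (if k = j then Q k * P else 0)"
      using assms by (simp add: d_v_v_mult distrib_left mult.left_commute)
  qed simp
  also have "\<dots> = sum' (\<lambda>k. v_var j * (Q k * d_v k P)) I + sum' (\<lambda>k. if k = j then Q k * P else 0) I"
  proof (rule sum.distrib')
    show "finite {k \<in> I. v_var j * (Q k * d_v k P) \<noteq> 0}"
      by (rule finite_subset[OF _ vop_finite[OF assms(1), of Q P]]) auto
    show "finite {k \<in> I. (if k = j then Q k * P else 0) \<noteq> 0}"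
      by (rule finite_subset[of _ "{j}"]) auto
  qed
  also have "sum' (\<lambda>k. v_var j * (Q k * d_v k P)) I = v_var j * vop Q I P"
    unfolding vop_def
    by (rule sum'_compose_linear) (rule tp_linear_intros(6) tp_linear_intros(1) vop_finite assms)+
  finally show ?thesis by (simp add: sum'_single)
qed

definition vop2 :: "(int \<Rightarrow> int \<Rightarrow> tpoly) \<Rightarrow> tpop" where
  "vop2 Q P = sum' (\<lambda>(j, k). Q j k * d_v j (d_v k P)) {(j, k). \<bar>j\<bar> \<ge> 1 \<and> \<bar>k\<bar> \<ge> 1}"

abbreviation nonzero_ints :: "int set" where
  "nonzero_ints \<equiv> {k. \<bar>k\<bar> \<ge> 1}"

lemma finite_d_v_d_v: "finite {(j, k). \<bar>j\<bar> \<ge> 1 \<and> \<bar>k\<bar> \<ge> 1 \<and> d_v j (d_v k P) \<noteq> 0}"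
proof (rule finite_subset)
  show "{(j, k). \<bar>j\<bar> \<ge> 1 \<and> \<bar>k\<bar> \<ge> 1 \<and> d_v j (d_v k P) \<noteq> 0} \<subseteq>
      (\<lambda>(k, j). (j, k)) ` (SIGMA k:{k. k \<noteq> 0 \<and> d_v k P \<noteq> 0}. {j. j \<noteq> 0 \<and> d_v j (d_v k P) \<noteq> 0})"
    by (force simp: d_v_linear)
qed (use finite_d_v in blast)

lemma vop2_finite:
  "finite {x \<in> {(j, k). \<bar>j\<bar> \<ge> 1 \<and> \<bar>k\<bar> \<ge> 1}. (case x of (j, k) \<Rightarrow> Q j k * d_v j (d_v k P)) \<noteq> 0}"
  by (rule finite_subset[OF _ finite_d_v_d_v[of P]]) auto

lemma tp_linear_vop2: "tp_linear (vop2 Q)"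
  unfolding vop2_def
proof (rule tp_linear_sum'[where F="\<lambda>x P. case x of (j, k) \<Rightarrow> Q j k * d_v j (d_v k P)"])
  show "tp_linear (\<lambda>P. case x of (j, k) \<Rightarrow> Q j k * d_v j (d_v k P))" for x
    by (cases x) (simp add: tp_linear_intros(6) tp_linear_compose[OF tp_linear_ops(2) tp_linear_ops(2)])
qed (rule vop2_finite)

lemma vop2_u_pow [simp]: "vop2 Q (u_pow a) = 0"
  unfolding vop2_def by (auto simp: sum.G_def d_v_linear intro!: sum.neutral)

text \<open>Indices outside the image may be dropped where \<open>f\<close> vanishes, so a double
  sum with a Kronecker delta collapses to a single one.\<close>

lemma sum'_reindex:
  assumes "inj_on h J" "h ` J \<subseteq> I" "\<And>i. i \<in> I - h ` J \<Longrightarrow> f i = 0" "\<And>j. j \<in> J \<Longrightarrow> f (h j) = g j"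
  shows "sum' f I = sum' g J"
proof -
  let ?S = "{j\<in>J. g j \<noteq> 0}"
  have S: "{i\<in>I. f i \<noteq> 0} = h ` ?S" using assms(2-4) by force
  have "inj_on h ?S" using assms(1) by (rule inj_on_subset) auto
  then show ?thesis unfolding sum.G_def S using assms(4)
    by (auto simp: finite_image_iff sum.reindex intro!: sum.cong)
qed

text \<open>Either of the two derivatives may hit the new factor \<open>v_var i\<close>, which
  leaves a vector field with symmetrised coefficient; both cannot, since \<open>v_var i\<close> is
  linear. This vector field is the origin of the cross term \<open>Gop\<close>.\<close>

lemma vop2_v_mult:
  assumes "i \<noteq> 0"
  shows "vop2 Q (v_var i * P) = v_var i * vop2 Q P + vop (\<lambda>k. Q i k + Q k i) nonzero_ints P"
proof -
  let ?I = "{(j, k). \<bar>j\<bar> \<ge> 1 \<and> \<bar>k\<bar> \<ge> 1} :: (int \<times> int) set"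
  let ?A = "\<lambda>(j, k). v_var i * (Q j k * d_v j (d_v k P))"
  let ?B = "\<lambda>(j, k). if j = i then Q j k * d_v k P else 0"
  let ?C = "\<lambda>(j, k). if k = i then Q j k * d_v j P else 0"
  have "vop2 Q (v_var i * P) = sum' (\<lambda>x. ?A x + (?B x + ?C x)) ?I"
    unfolding vop2_def using assms
    by (intro sum.cong') (auto simp: d_v_v_mult d_v_linear distrib_left mult.left_commute)
  also have "\<dots> = sum' ?A ?I + (sum' ?B ?I + sum' ?C ?I)"
  proof (subst sum.distrib')
    show "finite {x\<in>?I. ?A x \<noteq> 0}" by (rule finite_subset[OF _ vop2_finite[of Q P]]) auto
    have B: "finite {x\<in>?I. ?B x \<noteq> 0}"
      by (rule finite_subset[of _ "{i} \<times> {k. k \<noteq> 0 \<and> d_v k P \<noteq> 0}"]) (auto simp: finite_d_v split: if_splits)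
    have C: "finite {x\<in>?I. ?C x \<noteq> 0}"
      by (rule finite_subset[of _ "{k. k \<noteq> 0 \<and> d_v k P \<noteq> 0} \<times> {i}"]) (auto simp: finite_d_v split: if_splits)
    show "finite {x\<in>?I. ?B x + ?C x \<noteq> 0}"
      by (rule finite_subset[OF _ finite_UnI[OF B C]]) auto
    show "sum' ?A ?I + sum' (\<lambda>x. ?B x + ?C x) ?I = sum' ?A ?I + (sum' ?B ?I + sum' ?C ?I)"
      by (subst sum.distrib'[OF B C]) (rule refl)
  qed
  also have "sum' ?A ?I = v_var i * vop2 Q P"
  proof -
    have "?A = (\<lambda>x. v_var i * (case x of (j, k) \<Rightarrow> Q j k * d_v j (d_v k P)))" by auto
    then show ?thesis unfolding vop2_def
      using sum'_compose_linear[OF tp_linear_intros(6)[OF tp_linear_intros(1)] vop2_finite] by metis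
  qed
  also have "sum' ?B ?I = vop (Q i) nonzero_ints P"
    unfolding vop_def using assms by (intro sum'_reindex[where h="Pair i"]) (auto simp: inj_on_def)
  also have "sum' ?C ?I = vop (\<lambda>k. Q k i) nonzero_ints P"
    unfolding vop_def using assms by (intro sum'_reindex[where h="\<lambda>j. (j, i)"]) (auto simp: inj_on_def)
  also have "vop (Q i) nonzero_ints P + vop (\<lambda>k. Q k i) nonzero_ints P = vop (\<lambda>k. Q i k + Q k i) nonzero_ints P"
  proof -
    have "finite {k\<in>nonzero_ints. R k * d_v k P \<noteq> 0}" for R
      by (rule vop_finite) simp
    from sum.distrib'[OF this this, of "Q i" "\<lambda>k. Q k i"]
    show ?thesis unfolding vop_def distrib_right by (rule sym)
  qed
  finally show ?thesis .
qed

section \<open>Pseudodifferential operators in \<open>u\<close>\<close>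

definition rop_plus :: "(int \<Rightarrow> tpoly) \<Rightarrow> tpop" where
  "rop_plus Q P = sum' (\<lambda>k. Q k * R_plus (d_u (u_pow (- k) * R_plus P))) {1..}"

definition rop_minus :: "(int \<Rightarrow> tpoly) \<Rightarrow> tpop" where
  "rop_minus Q P = sum' (\<lambda>k. Q k * R_minus (d_u (u_pow (- k) * R_minus P))) {..-1}"

lemma tp_linear_rop_summand:
  "tp_linear (\<lambda>P. R_plus (d_u (u_pow k * R_plus P)))"
  "tp_linear (\<lambda>P. R_minus (d_u (u_pow k * R_minus P)))"
  by (rule tp_linear_compose[OF tp_linear_ops(3)
        tp_linear_compose[OF tp_linear_ops(1) tp_linear_intros(6)[OF tp_linear_ops(3)]]])
    (rule tp_linear_compose[OF tp_linear_ops(4)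
        tp_linear_compose[OF tp_linear_ops(1) tp_linear_intros(6)[OF tp_linear_ops(4)]]])

lemma rop_summand_v_mult:
  "R_plus (d_u (u_pow k * R_plus (v_var j * P))) = v_var j * R_plus (d_u (u_pow k * R_plus P))"
  "R_minus (d_u (u_pow k * R_minus (v_var j * P))) = v_var j * R_minus (d_u (u_pow k * R_minus P))"
  by (simp_all add: mult.left_commute[of "u_pow k"])

text \<open>The outer projection cuts the range at k <= a - 1 for \<open>R_plus\<close> but only at
  k >= a for \<open>R_minus\<close>; there the index k = a drops out because \<open>u_pow 0\<close>
  has derivative 0. Hence the two ranges mirror each other.\<close>

lemma rop_summand_u_pow:
  "k \<ge> 1 \<Longrightarrow> R_plus (d_u (u_pow (- k) * R_plus (u_pow a))) =
     (if k \<in> {1..a - 1} then of_int (a - k) * u_pow (a - k - 1) else 0)"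
  "k \<le> -1 \<Longrightarrow> R_minus (d_u (u_pow (- k) * R_minus (u_pow a))) =
     (if k \<in> {a + 1..-1} then of_int (a - k) * u_pow (a - k - 1) else 0)"
proof -
  have *: "u_pow (- k) * u_pow a = u_pow (a - k)" by (simp flip: u_pow_add)
  note lin = tp_linear_ops(1)[THEN tp_linearD(3)] tp_linear_ops(3)[THEN tp_linearD(3)]
    tp_linear_ops(4)[THEN tp_linearD(3)] tp_linear_ops(3)[THEN tp_linearD(6)]
    tp_linear_ops(4)[THEN tp_linearD(6)]
  show "k \<ge> 1 \<Longrightarrow> R_plus (d_u (u_pow (- k) * R_plus (u_pow a))) =
     (if k \<in> {1..a - 1} then of_int (a - k) * u_pow (a - k - 1) else 0)"
    unfolding R_plus_u_pow by (auto simp: * lin R_plus_u_pow simp del: of_int_diff)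
  show "k \<le> -1 \<Longrightarrow> R_minus (d_u (u_pow (- k) * R_minus (u_pow a))) =
     (if k \<in> {a + 1..-1} then of_int (a - k) * u_pow (a - k - 1) else 0)"
    unfolding R_minus_u_pow by (auto simp: * lin R_minus_u_pow not_le dest!: zless_imp_add1_zle simp del: of_int_diff)
qed

lemma finite_rop_summand:
  "finite {k\<in>{1..}. R_plus (d_u (u_pow (- k) * R_plus P)) \<noteq> 0}"
  "finite {k\<in>{..-1}. R_minus (d_u (u_pow (- k) * R_minus P)) \<noteq> 0}"
proof -
  \<comment> \<open>Both signs at once: since the family \<open>F\<close> commutes with every
    \<open>v_var j\<close>, only powers of \<open>u\<close> have to be inspected.\<close>
  have "finite {k\<in>I. F k P \<noteq> 0}" if
    "\<And>k. tp_linear (F k)" "\<And>k j P. F k (v_var j * P) = v_var j * F k P"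
    "\<And>a. finite {k\<in>I. F k (u_pow a) \<noteq> 0}" for F :: "int \<Rightarrow> tpop" and I
  proof (induction P rule: tpoly_induct)
    case (u a)
    then show ?case by (rule that)
  next
    case (v j P)
    show ?case by (rule finite_subset[OF _ v(2)]) (auto simp: that(2))
  next
    case (add P Q)
    show ?case
      by (rule finite_subset[OF _ finite_UnI[OF add]]) (auto simp: tp_linearD(1)[OF that(1)])
  next
    case (scl c P)
    show ?case by (rule finite_subset[OF _ scl]) (auto simp: tp_linearD(2)[OF that(1)])
  qed
  note * = this
  show "finite {k\<in>{1..}. R_plus (d_u (u_pow (- k) * R_plus P)) \<noteq> 0}"
  proof (rule *[OF tp_linear_rop_summand(1) rop_summand_v_mult(1)])
    show "finite {k\<in>{1..}. R_plus (d_u (u_pow (- k) * R_plus (u_pow a))) \<noteq> 0}" for a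
      by (rule finite_subset[of _ "{1..a - 1}"]) (auto simp: rop_summand_u_pow split: if_splits)
  qed
  show "finite {k\<in>{..-1}. R_minus (d_u (u_pow (- k) * R_minus P)) \<noteq> 0}"
  proof (rule *[OF tp_linear_rop_summand(2) rop_summand_v_mult(2)])
    show "finite {k\<in>{..-1}. R_minus (d_u (u_pow (- k) * R_minus (u_pow a))) \<noteq> 0}" for a
      by (rule finite_subset[of _ "{a + 1..-1}"]) (auto simp: rop_summand_u_pow split: if_splits)
  qed
qed

lemma rop_finite:
  "finite {k\<in>{1..}. Q k * R_plus (d_u (u_pow (- k) * R_plus P)) \<noteq> 0}"
  "finite {k\<in>{..-1}. Q k * R_minus (d_u (u_pow (- k) * R_minus P)) \<noteq> 0}"
  by (rule finite_subset[OF _ finite_rop_summand(1)[of P]], force)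
    (rule finite_subset[OF _ finite_rop_summand(2)[of P]], force)

lemma tp_linear_rop: "tp_linear (rop_plus Q)" "tp_linear (rop_minus Q)"
  unfolding rop_plus_def rop_minus_def
  by (rule tp_linear_sum' tp_linear_intros(6) tp_linear_rop_summand rop_finite)+

lemma rop_v_mult:
  "rop_plus Q (v_var j * P) = v_var j * rop_plus Q P"
  "rop_minus Q (v_var j * P) = v_var j * rop_minus Q P"
  unfolding rop_plus_def rop_minus_def rop_summand_v_mult mult.left_commute[of _ "v_var j"]
  by (rule sum'_compose_linear tp_linear_intros(6) tp_linear_intros(1) rop_finite)+

lemma rop_u_pow:
  "rop_plus Q (u_pow a) = (\<Sum>k\<in>{1..a - 1}. of_int (a - k) * (Q k * u_pow (a - k - 1)))"
  "rop_minus Q (u_pow a) = (\<Sum>k\<in>{a + 1..-1}. of_int (a - k) * (Q k * u_pow (a - k - 1)))"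
proof -
  have "rop_plus Q (u_pow a) = (\<Sum>k\<in>{1..a - 1}. Q k * R_plus (d_u (u_pow (- k) * R_plus (u_pow a))))"
    unfolding rop_plus_def
    by (rule sum'_eq_sum) (auto simp: rop_summand_u_pow split: if_splits)
  also have "\<dots> = (\<Sum>k\<in>{1..a - 1}. of_int (a - k) * (Q k * u_pow (a - k - 1)))"
    by (intro sum.cong refl) (auto simp: rop_summand_u_pow)
  finally show "rop_plus Q (u_pow a) = (\<Sum>k\<in>{1..a - 1}. of_int (a - k) * (Q k * u_pow (a - k - 1)))" .
  have "rop_minus Q (u_pow a) = (\<Sum>k\<in>{a + 1..-1}. Q k * R_minus (d_u (u_pow (- k) * R_minus (u_pow a))))"
    unfolding rop_minus_def
    by (rule sum'_eq_sum) (auto simp: rop_summand_u_pow split: if_splits)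
  also have "\<dots> = (\<Sum>k\<in>{a + 1..-1}. of_int (a - k) * (Q k * u_pow (a - k - 1)))"
    by (intro sum.cong refl) (auto simp: rop_summand_u_pow)
  finally show "rop_minus Q (u_pow a) = (\<Sum>k\<in>{a + 1..-1}. of_int (a - k) * (Q k * u_pow (a - k - 1)))" .
qed

section \<open>The intertwining operator\<close>

lemma op_N_eq: "op_N P = vop (\<lambda>k. of_int \<bar>k\<bar> * v_var k) nonzero_ints P + u_pow 1 * d_u (R_plus P - R_minus P)"
  by (simp add: op_N_def vop_def)

lemma op_Y1_eq: "op_Y1 P = rop_plus (\<lambda>k. v_var k * u_pow 1) P - rop_minus (\<lambda>k. v_var k * u_pow 1) P"
  by (simp add: op_Y1_def rop_plus_def rop_minus_def)

lemma op_Y2_eq: "op_Y2 P = vop (\<lambda>k. \<Sum>j=1..k-1. of_int j * v_var j * v_var (k - j)) {2..} P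
    - vop (\<lambda>k. \<Sum>j=k+1..-1. of_int j * v_var j * v_var (k - j)) {..-2} P"
  by (simp add: op_Y2_def vop_def)

lemma op_Z1_eq: "op_Z1 P = vop (\<lambda>k. \<Sum>j=1..k-1. of_int (k - j) * v_var (k - 2 * j)) {2..} P
    - vop (\<lambda>k. \<Sum>j=k+1..-1. of_int (k - j) * v_var (k - 2 * j)) {..-2} P"
  by (simp add: op_Z1_def vop_def)

lemma op_Z2_eq: "op_Z2 P = rop_plus (\<lambda>k. u_pow (-k + 1)) P - rop_minus (\<lambda>k. u_pow (-k + 1)) P"
  by (simp add: op_Z2_def rop_plus_def rop_minus_def)

lemma op_K1_plus_eq: "op_K1_plus P = vop (\<lambda>k. of_int k * u_pow (-k + 1)) nonzero_ints (d_u P)"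
  by (simp add: op_K1_plus_def vop_def)

lemma op_K1_minus_eq: "op_K1_minus P = vop (\<lambda>k. of_int k * u_pow (k + 1)) nonzero_ints (d_u P)"
  by (simp add: op_K1_minus_def vop_def)

lemma op_K2_plus_eq: "op_K2_plus P = vop2 (\<lambda>j k. of_int (j * k) * v_var (k - j)) P"
  by (simp add: op_K2_plus_def vop2_def)

lemma op_K2_minus_eq: "op_K2_minus P = vop2 (\<lambda>j k. of_int (j * k) * v_var (k + j)) P"
  by (simp add: op_K2_minus_def vop2_def)

lemma op_J_eq: "op_J P = 2 * vop (\<lambda>k. of_int k * u_pow 1 * v_var k) nonzero_ints (d_u P)
    + vop2 (\<lambda>j k. of_int (j * k) * v_var j * v_var k) P
    + vop (\<lambda>k. of_int (k^2) * v_var k) nonzero_ints P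
    + u_pow 2 * d_u (d_u P) + u_pow 1 * d_u P"
proof -
  have "sum' (\<lambda>k. of_int k * u_pow 1 * v_var k * d_u (d_v k P)) nonzero_ints =
      vop (\<lambda>k. of_int k * u_pow 1 * v_var k) nonzero_ints (d_u P)"
    unfolding vop_def by (intro sum.cong') (auto simp: d_v_d_u)
  then show ?thesis by (simp add: op_J_def vop_def vop2_def)
qed

text \<open>The three operators \<open>D_op\<close> are instances of one family. Its parameters are the constants in
  the contraction identities \<open>\<Sum>X\<in>B. X A\<^sup>k X = - tr(A\<^sup>k) + \<alpha> A\<^sup>-\<^sup>k + \<gamma> A\<^sup>k\<close> and
  \<open>\<Sum>X\<in>B. tr(A\<^sup>k X) X = \<epsilon> A\<^sup>-\<^sup>k - \<delta> A\<^sup>k + \<gamma> tr(A\<^sup>k)\<close> of an orthonormal basis \<open>B\<close> of the Lie algebra.\<close>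

locale contraction_constants =
  fixes \<alpha> \<epsilon> \<delta> \<gamma> :: complex
begin

definition Dop :: tpop where
  "Dop P = L0 P + scl \<alpha> (L1_real P) + scl \<epsilon> (2 * op_K1_plus P + op_K2_plus P)
    - scl \<delta> (2 * op_K1_minus P + op_K2_minus P) + scl \<gamma> (op_J P)"

text \<open>\<open>Gop j P\<close> evaluates to the cross term \<open>2 \<Sum>X\<in>B. (X v\<^sub>j) (X P)\<close> of the product rule for \<open>\<Delta> (v\<^sub>j P)\<close>.\<close>

definition Gop :: "int \<Rightarrow> tpop" where
  "Gop j P = scl \<epsilon> (2 * (of_int j * u_pow (-j + 1) * d_u P)
        + vop (\<lambda>k. of_int (j * k) * v_var (k - j) + of_int (k * j) * v_var (j - k)) nonzero_ints P)
    - scl \<delta> (2 * (of_int j * u_pow (j + 1) * d_u P)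
        + vop (\<lambda>k. of_int (j * k) * v_var (k + j) + of_int (k * j) * v_var (j + k)) nonzero_ints P)
    + scl \<gamma> (2 * (of_int j * u_pow 1 * v_var j * d_u P)
        + vop (\<lambda>k. of_int (j * k) * v_var j * v_var k + of_int (k * j) * v_var k * v_var j) nonzero_ints P)"

text \<open>\<open>contr 0\<close> is the constant \<alpha> + \<gamma> - 1, by which the sum of the
  squares of the basis elements (the Casimir element) acts.\<close>

definition contr :: "int \<Rightarrow> tpoly" where
  "contr k = - v_var k + scl \<alpha> (u_pow (- k)) + scl \<gamma> (u_pow k)"

lemmas tp_linear_vop_nonzero = tp_linear_vop[where I=nonzero_ints, simplified]

lemma tp_linear_Dop: "tp_linear Dop"
  unfolding Dop_def[abs_def] L0_def L1_real_def op_N_eq op_Y1_eq op_Y2_eq op_Z1_eq op_Z2_eq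
    op_K1_plus_eq op_K1_minus_eq op_K2_plus_eq op_K2_minus_eq op_J_eq
  by (rule tp_linear_intros(3-6,8) tp_linear_ops tp_linear_vop2 tp_linear_rop
      tp_linear_compose[OF tp_linear_ops(1) tp_linear_intros(4)[OF tp_linear_ops(3,4)]]
      tp_linear_compose[OF tp_linear_ops(1) tp_linear_ops(1)]
      tp_linear_compose[OF tp_linear_vop_nonzero tp_linear_ops(1)] tp_linear_vop | simp; fail)+

lemma tp_linear_Gop: "tp_linear (Gop j)"
  unfolding Gop_def[abs_def]
  by (rule tp_linear_intros(3-6,8) tp_linear_ops tp_linear_vop | simp; fail)+

text \<open>The integers strictly between 0 and \<open>a\<close>; at least one of the two intervals
  is empty, so both signs of \<open>a\<close> share one formula.\<close>

definition tail :: "int \<Rightarrow> int set" where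
  "tail a = {1..a - 1} \<union> {a + 1..-1}"

lemma sum_tail: "sum f (tail a) = sum f {1..a - 1} + sum f {a + 1..-1}"
  unfolding tail_def by (rule sum.union_disjoint) auto

lemma tail_int: "tail (int n) = int ` {1..<n}" "tail (- int n) = (\<lambda>d. - int d) ` {1..<n}"
proof -
  show "tail (int n) = int ` {1..<n}"
  proof safe
    fix x assume "x \<in> tail (int n)"
    then have "x = int (nat x)" "nat x \<in> {1..<n}" by (auto simp: tail_def)
    then show "x \<in> int ` {1..<n}" by blast
  qed (auto simp: tail_def)
  show "tail (- int n) = (\<lambda>d. - int d) ` {1..<n}"
  proof safe
    fix x assume "x \<in> tail (- int n)"
    then have "x = - int (nat (- x))" "nat (- x) \<in> {1..<n}" by (auto simp: tail_def)
    then show "x \<in> (\<lambda>d. - int d) ` {1..<n}" by blast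
  qed (auto simp: tail_def)
qed

text \<open>A count of ordered pairs of positions among \<bar>a\<bar> factors: \<bar>a\<bar> on the
  diagonal and twice \<open>\<bar>a - d\<bar>\<close> for each distance \<bar>d\<bar>. It lets the
  \<gamma> terms in \<open>Dop_u_pow\<close> add up to the eigenvalue a^2 of
  \<open>op_J\<close>.\<close>

lemma sum_abs_tail: "\<bar>a\<bar> + 2 * (\<Sum>d\<in>tail a. \<bar>a - d\<bar>) = a\<^sup>2"
proof -
  have *: "int n + 2 * (\<Sum>d\<in>{1..<n}. int n - int d) = (int n)\<^sup>2" for n
  proof -
    have "(\<Sum>d\<in>{1..<n}. int n - int d) = (\<Sum>d\<in>{1..<n}. int d)"
      by (rule sum.reindex_bij_witness[of _ "\<lambda>d. n - d" "\<lambda>d. n - d"]) (auto simp: of_nat_diff)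
    also have "\<dots> = (\<Sum>d\<in>{0..<n}. int d)"
      by (rule sum.mono_neutral_left) auto
    moreover have "2 * (\<Sum>d\<in>{0..<n}. int d) = int n * (int n - 1)"
      by (induction n) (auto simp: algebra_simps)
    ultimately show ?thesis by (simp add: power2_eq_square algebra_simps)
  qed
  show ?thesis
  proof (cases a rule: int_cases2)
    case (nonneg n)
    have "(\<Sum>d\<in>tail a. \<bar>a - d\<bar>) = (\<Sum>d\<in>{1..<n}. int n - int d)"
      unfolding nonneg tail_int by (subst sum.reindex) auto
    then show ?thesis using *[of n] nonneg by simp
  next
    case (nonpos n)
    have "(\<Sum>d\<in>tail a. \<bar>a - d\<bar>) = (\<Sum>d\<in>{1..<n}. int n - int d)"
      unfolding nonpos tail_int by (subst sum.reindex) (auto simp: inj_on_def)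
    then show ?thesis using *[of n] nonpos by simp
  qed
qed

text \<open>On the negative side a - d is negative, and the minus sign in front of the
  \<open>R_minus\<close> part turns it into its absolute value.\<close>

lemma rop_diff_u_pow:
  "rop_plus Q (u_pow a) - rop_minus Q (u_pow a)
    = (\<Sum>d\<in>tail a. of_int \<bar>a - d\<bar> * (Q d * u_pow (a - d - 1)))"
proof -
  have "(\<Sum>d\<in>{1..a - 1}. of_int (a - d) * (Q d * u_pow (a - d - 1))) =
      (\<Sum>d\<in>{1..a - 1}. of_int \<bar>a - d\<bar> * (Q d * u_pow (a - d - 1)))"
    by (intro sum.cong) auto
  moreover have "- (\<Sum>d\<in>{a + 1..-1}. of_int (a - d) * (Q d * u_pow (a - d - 1))) =
      (\<Sum>d\<in>{a + 1..-1}. of_int \<bar>a - d\<bar> * (Q d * u_pow (a - d - 1)))"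
    unfolding sum_negf[symmetric] by (intro sum.cong) (auto simp: algebra_simps)
  ultimately show ?thesis unfolding rop_u_pow sum_tail by (simp only: diff_conv_add_uminus)
qed

lemma op_N_u_pow: "op_N (u_pow a) = of_int \<bar>a\<bar> * u_pow a"
proof -
  have "u_pow 1 * u_pow (a - 1) = u_pow a" by (simp flip: u_pow_add)
  then show ?thesis
    by (auto simp: op_N_eq R_plus_u_pow R_minus_u_pow d_u_linear mult.left_commute[of "u_pow 1"]
        tp_linear_ops(1)[THEN tp_linearD(4)])
qed

lemma op_Y1_u_pow: "op_Y1 (u_pow a) = (\<Sum>d\<in>tail a. of_int \<bar>a - d\<bar> * (v_var d * u_pow (a - d)))"
  unfolding op_Y1_eq rop_diff_u_pow by (intro sum.cong) (auto simp: mult.assoc simp flip: u_pow_add)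

lemma op_Z2_u_pow: "op_Z2 (u_pow a) = (\<Sum>d\<in>tail a. of_int \<bar>a - d\<bar> * u_pow (a - 2 * d))"
  unfolding op_Z2_eq rop_diff_u_pow
  by (intro sum.cong) (auto simp: algebra_simps simp flip: u_pow_add)

text \<open>Only u^2 d^2/du^2 + u d/du, the square of the Euler operator in \<open>u\<close>,
  survives on a power of \<open>u\<close>.\<close>

lemma op_J_u_pow: "op_J (u_pow a) = of_int (a\<^sup>2) * u_pow a"
proof -
  have "u_pow 1 * u_pow (a - 1) = u_pow a" "u_pow 2 * u_pow (a - 2) = u_pow a"
    by (simp_all flip: u_pow_add)
  moreover have "d_u (d_u (u_pow a)) = of_int a * (of_int (a - 1) * u_pow (a - 2))"
    by (simp add: d_u_linear)
  ultimately have "u_pow 2 * d_u (d_u (u_pow a)) = of_int a * (of_int (a - 1) * u_pow a)"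
    "u_pow 1 * d_u (u_pow a) = of_int a * u_pow a"
    by (simp_all only: d_u_u_pow mult.left_commute[of "u_pow _" "of_int _"])
  then show ?thesis
    unfolding op_J_eq d_u_u_pow tp_linearD(6)[OF tp_linear_vop_nonzero] vop_u_pow vop2_u_pow
    by (simp add: power2_eq_square algebra_simps)
qed

text \<open>The pair count for \<bar>a\<bar> insertion positions. The three summands of
  \<open>contr d\<close> come from \<open>op_Y1\<close>, \<open>op_Z2\<close> and
  \<open>op_J\<close>; those of \<open>contr 0\<close> from \<open>op_N\<close>, once in
  \<open>L0\<close> and once in \<open>L1_real\<close>, and from \<open>op_J\<close>.\<close>

lemma Dop_u_pow:
  "Dop (u_pow a) = of_int \<bar>a\<bar> * (u_pow a * contr 0) + 2 * (\<Sum>d\<in>tail a. of_int \<bar>a - d\<bar> * (u_pow (a - d) * contr d))"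
proof -
  have c: "u_pow (a - d) * contr d = - (v_var d * u_pow (a - d)) + scl \<alpha> (u_pow (a - 2 * d)) + scl \<gamma> (u_pow a)" for d
    by (simp add: contr_def algebra_simps flip: u_pow_add)
  have S1: "(\<Sum>d\<in>tail a. of_int \<bar>a - d\<bar> * (u_pow (a - d) * contr d)) =
     - op_Y1 (u_pow a) + scl \<alpha> (op_Z2 (u_pow a)) + scl \<gamma> (of_int (\<Sum>d\<in>tail a. \<bar>a - d\<bar>) * u_pow a)"
    unfolding op_Y1_u_pow op_Z2_u_pow c
    by (simp add: distrib_left right_diff_distrib sum.distrib sum_negf sum_subtractf scl_sum sum_distrib_right)
  have S2: "of_int \<bar>a\<bar> * (u_pow a * contr 0) =
      - op_N (u_pow a) + scl \<alpha> (op_N (u_pow a)) + scl \<gamma> (of_int \<bar>a\<bar> * u_pow a)"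
    by (simp add: contr_def op_N_u_pow algebra_simps)
  have S3: "op_J (u_pow a) = of_int \<bar>a\<bar> * u_pow a + 2 * (of_int (\<Sum>d\<in>tail a. \<bar>a - d\<bar>) * u_pow a)"
    unfolding op_J_u_pow sum_abs_tail[of a, symmetric] by (simp add: algebra_simps)
  show ?thesis
    unfolding Dop_def S1 S2 S3 L0_def L1_real_def op_Y2_eq op_Z1_eq vop_u_pow vop2_u_pow
      op_K1_plus_eq op_K1_minus_eq op_K2_plus_eq op_K2_minus_eq d_u_u_pow
      tp_linearD(6)[OF tp_linear_vop_nonzero] scl_def
    by (simp add: algebra_simps)
qed

text \<open>The bracket is the later \<open>contr2 j\<close>. The factor j comes from
  differentiating \<open>v_var j\<close>, the factor a from the power of \<open>u\<close>, whose
  insertion positions all contribute equally because the contraction commutes with the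
  matrix.\<close>

lemma Gop_u_pow:
  "Gop j (u_pow a) = of_int (2 * j * a) * (u_pow a * (scl \<epsilon> (u_pow (- j)) - scl \<delta> (u_pow j) + scl \<gamma> (v_var j)))"
proof -
  have "u_pow (- j + 1) * u_pow (a - 1) = u_pow a * u_pow (- j)"
    "u_pow (j + 1) * u_pow (a - 1) = u_pow a * u_pow j" "u_pow 1 * u_pow (a - 1) = u_pow a"
    by (simp_all add: algebra_simps flip: u_pow_add)
  then have "of_int j * u_pow (- j + 1) * d_u (u_pow a) = of_int j * of_int a * u_pow a * u_pow (- j)"
    "of_int j * u_pow (j + 1) * d_u (u_pow a) = of_int j * of_int a * u_pow a * u_pow j"
    "of_int j * u_pow 1 * v_var j * d_u (u_pow a) = of_int j * of_int a * u_pow a * v_var j"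
    unfolding d_u_u_pow by (simp_all only: mult.assoc mult.left_commute[of "u_pow _" "of_int _"] mult.left_commute[of "u_pow 1" "v_var _"] mult.left_commute[of "v_var _" "of_int _"])
      (simp add: mult.commute)
  then show ?thesis
    unfolding Gop_def vop_u_pow scl_def by (simp add: algebra_simps)
qed

text \<open>The cross term is of first order in \<open>P\<close> without a term of order 0, hence a
  derivation; its value on \<open>v_var k\<close> is symmetric in j and k.\<close>

lemma Gop_v_mult:
  assumes "k \<noteq> 0"
  shows "Gop j (v_var k * P) = v_var k * Gop j P
    + of_int (j * k) * ((scl \<epsilon> (v_var (k - j) + v_var (j - k)) - scl \<delta> (2 * v_var (j + k)) + scl \<gamma> (2 * v_var j * v_var k)) * P)"
proof -
  have "k \<in> nonzero_ints" "0 \<notin> nonzero_ints" using assms by auto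
  note v_mult = vop_v_mult[OF this(2) assms] if_P[OF this(1)]
  show ?thesis
    unfolding Gop_def v_mult d_u_v_mult scl_def by (simp add: algebra_simps)
qed

text \<open>The value of \<open>Dop\<close> on \<open>v_var k\<close>, with the weights as the
  operators deliver them; \<open>Dop_v\<close> brings it into the form used later.\<close>

definition Dv :: "int \<Rightarrow> tpoly" where
  "Dv k = - of_int \<bar>k\<bar> * v_var k - 2 * (\<Sum>d\<in>tail k. of_int \<bar>d\<bar> * (v_var d * v_var (k - d)))
    + scl \<alpha> (of_int \<bar>k\<bar> * v_var k + 2 * (\<Sum>d\<in>tail k. of_int \<bar>k - d\<bar> * v_var (k - 2 * d)))
    + scl \<gamma> (of_int (k\<^sup>2) * v_var k)"

lemma op_N_v_mult: "j \<noteq> 0 \<Longrightarrow> op_N (v_var j * P) = v_var j * op_N P + of_int \<bar>j\<bar> * v_var j * P"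
proof -
  have "R_plus (v_var j * P) - R_minus (v_var j * P) = v_var j * (R_plus P - R_minus P)"
    by (simp add: right_diff_distrib)
  then show "j \<noteq> 0 \<Longrightarrow> ?thesis"
    by (simp add: op_N_eq vop_v_mult distrib_left mult.left_commute)
qed

lemma op_Y2_v_mult:
  assumes "j \<noteq> 0"
  shows "op_Y2 (v_var j * P) = v_var j * op_Y2 P + (\<Sum>d\<in>tail j. of_int \<bar>d\<bar> * (v_var d * v_var (j - d))) * P"
proof -
  have "(\<Sum>d=1..j-1. of_int d * v_var d * v_var (j - d)) = (\<Sum>d=1..j-1. of_int \<bar>d\<bar> * (v_var d * v_var (j - d)))"
    by (intro sum.cong) auto
  moreover have "(\<Sum>d=j+1..-1. of_int d * v_var d * v_var (j - d)) = - (\<Sum>d=j+1..-1. of_int \<bar>d\<bar> * (v_var d * v_var (j - d)))"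
    unfolding sum_negf[symmetric] by (intro sum.cong) auto
  \<comment> \<open>For j = 1 and j = -1 the index lies outside both ranges of \<open>op_Y2\<close>,
    and \<open>tail j\<close> is empty.\<close>
  moreover have "j = -1 \<or> j = 1 \<or> j \<ge> 2 \<or> j \<le> -2" using assms by linarith
  ultimately show ?thesis
    unfolding op_Y2_eq sum_tail using assms by (auto simp: vop_v_mult right_diff_distrib)
qed

lemma op_Z1_v_mult:
  assumes "j \<noteq> 0"
  shows "op_Z1 (v_var j * P) = v_var j * op_Z1 P + (\<Sum>d\<in>tail j. of_int \<bar>j - d\<bar> * v_var (j - 2 * d)) * P"
proof -
  have "(\<Sum>d=1..j-1. of_int (j - d) * v_var (j - 2 * d)) = (\<Sum>d=1..j-1. of_int \<bar>j - d\<bar> * v_var (j - 2 * d))"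
    by (intro sum.cong) auto
  moreover have "(\<Sum>d=j+1..-1. of_int (j - d) * v_var (j - 2 * d)) = - (\<Sum>d=j+1..-1. of_int \<bar>j - d\<bar> * v_var (j - 2 * d))"
    unfolding sum_negf[symmetric] by (intro sum.cong) (auto simp: algebra_simps)
  moreover have "j = -1 \<or> j = 1 \<or> j \<ge> 2 \<or> j \<le> -2" using assms by linarith
  ultimately show ?thesis
    unfolding op_Z1_eq sum_tail using assms by (auto simp: vop_v_mult right_diff_distrib)
qed

lemma op_Y1_v_mult: "op_Y1 (v_var j * P) = v_var j * op_Y1 P"
  by (simp add: op_Y1_eq rop_v_mult right_diff_distrib)

lemma op_Z2_v_mult: "op_Z2 (v_var j * P) = v_var j * op_Z2 P"
  by (simp add: op_Z2_eq rop_v_mult right_diff_distrib)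

text \<open>The commutators with multiplication by \<open>v_var j\<close> are collected by order:
  order 0 forms \<open>Dv j\<close>, order 1 forms \<open>Gop j\<close>. The operators
  \<open>op_Y1\<close> and \<open>op_Z2\<close> contribute nothing.\<close>

lemma Dop_v_mult_aux:
  assumes "j \<noteq> 0"
  shows "Dop (v_var j * P) = v_var j * Dop P + Dv j * P + Gop j P"
proof -
  have K1: "op_K1_plus (v_var j * P) = v_var j * op_K1_plus P + of_int j * u_pow (-j + 1) * d_u P"
    "op_K1_minus (v_var j * P) = v_var j * op_K1_minus P + of_int j * u_pow (j + 1) * d_u P"
    using assms by (simp_all add: op_K1_plus_eq op_K1_minus_eq vop_v_mult)
  have K2: "op_K2_plus (v_var j * P) = v_var j * op_K2_plus P +
      vop (\<lambda>k. of_int (j * k) * v_var (k - j) + of_int (k * j) * v_var (j - k)) nonzero_ints P"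
    "op_K2_minus (v_var j * P) = v_var j * op_K2_minus P +
      vop (\<lambda>k. of_int (j * k) * v_var (k + j) + of_int (k * j) * v_var (j + k)) nonzero_ints P"
    unfolding op_K2_plus_eq op_K2_minus_eq by (rule vop2_v_mult[OF assms])+
  have J: "op_J (v_var j * P) = v_var j * op_J P + 2 * (of_int j * u_pow 1 * v_var j * d_u P)
     + vop (\<lambda>k. of_int (j * k) * v_var j * v_var k + of_int (k * j) * v_var k * v_var j) nonzero_ints P
     + of_int (j\<^sup>2) * v_var j * P"
    unfolding op_J_eq vop2_v_mult[OF assms] d_u_v_mult using assms
    by (simp add: vop_v_mult distrib_left mult.left_commute)
  show ?thesis
    unfolding Dop_def L0_def L1_real_def op_N_v_mult[OF assms] op_Y1_v_mult op_Y2_v_mult[OF assms]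
      op_Z1_v_mult[OF assms] op_Z2_v_mult K1 K2 J Gop_def Dv_def
    unfolding scl_def by (simp add: algebra_simps)
qed

lemma Dop_1 [simp]: "Dop 1 = 0"
  using Dop_u_pow[of 0] by (simp add: tail_def)

lemma Gop_1 [simp]: "Gop j 1 = 0"
  using Gop_u_pow[of j 0] by simp

text \<open>The case P = 1, where \<open>Dop\<close> and \<open>Gop\<close> vanish, identifies
  \<open>Dv j\<close> with \<open>Dop (v_var j)\<close>.\<close>

lemma Dop_v_mult:
  assumes "j \<noteq> 0"
  shows "Dop (v_var j * P) = v_var j * Dop P + Dop (v_var j) * P + Gop j P"
  using Dop_v_mult_aux[OF assms, of P] Dop_v_mult_aux[OF assms, of 1] by simp

text \<open>The reflection d to k - d fixes the product \<open>v_var d * v_var (k - d)\<close> and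
  turns the weight \<bar>d\<bar> of \<open>op_Y2\<close> into \<open>\<bar>k - d\<bar>\<close>. In
  this form the expression is, term by term, the normalised trace of
  \<open>Dop_u_pow\<close>.\<close>

lemma Dop_v:
  assumes "k \<noteq> 0"
  shows "Dop (v_var k) = of_int \<bar>k\<bar> * (- v_var k + scl (\<alpha> + \<gamma>) (v_var k))
    + 2 * (\<Sum>d\<in>tail k. of_int \<bar>k - d\<bar> * (- v_var d * v_var (k - d) + scl \<alpha> (v_var (k - 2 * d)) + scl \<gamma> (v_var k)))"
proof -
  have S1: "(\<Sum>d\<in>tail k. of_int \<bar>d\<bar> * (v_var d * v_var (k - d))) = (\<Sum>d\<in>tail k. of_int \<bar>k - d\<bar> * (v_var d * v_var (k - d)))"
    by (rule sum.reindex_bij_witness[of _ "\<lambda>d. k - d" "\<lambda>d. k - d"]) (auto simp: tail_def mult.commute)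
  have S2: "(\<Sum>d\<in>tail k. of_int \<bar>k - d\<bar> * (- v_var d * v_var (k - d) + scl \<alpha> (v_var (k - 2 * d)) + scl \<gamma> (v_var k)))
    = - (\<Sum>d\<in>tail k. of_int \<bar>k - d\<bar> * (v_var d * v_var (k - d))) +
      scl \<alpha> (\<Sum>d\<in>tail k. of_int \<bar>k - d\<bar> * v_var (k - 2 * d)) + scl \<gamma> (of_int (\<Sum>d\<in>tail k. \<bar>k - d\<bar>) * v_var k)"
    by (simp add: distrib_left right_diff_distrib sum_subtractf sum.distrib sum_negf scl_sum sum_distrib_right)
  have "Dop (v_var k) = Dv k" using Dop_v_mult_aux[OF assms, of 1] by simp
  then show ?thesis unfolding S2 unfolding Dv_def S1 sum_abs_tail[of k, symmetric] scl_def single_add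
    by (simp add: algebra_simps)
qed

end

section \<open>Trace degree and exponentials\<close>

definition tdeg :: "tmono \<Rightarrow> nat" where
  "tdeg x = nat \<bar>fst x\<bar> + (\<Sum>j\<in>keys (snd x). nat \<bar>int_of_nz j\<bar> * lookup (snd x) j)"

lemma tdeg_superset:
  "finite S \<Longrightarrow> keys (snd x) \<subseteq> S \<Longrightarrow> tdeg x = nat \<bar>fst x\<bar> + (\<Sum>j\<in>S. nat \<bar>int_of_nz j\<bar> * lookup (snd x) j)"
  unfolding tdeg_def by (auto simp: in_keys_iff intro!: sum.mono_neutral_left)

text \<open>Only subadditive, since positive and negative exponents of \<open>u\<close> may
  cancel.\<close>

lemma tdeg_add: "tdeg (x + y) \<le> tdeg x + tdeg y"
proof -
  let ?S = "keys (snd x) \<union> keys (snd y)"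
  have "keys (snd (x + y)) \<subseteq> ?S" by (simp add: keys_add)
  then show ?thesis
    by (simp add: tdeg_superset[of ?S] lookup_add distrib_left sum.distrib nat_le_iff)
qed

lemma tdeg_u [simp]: "tdeg (a, 0) = nat \<bar>a\<bar>"
  by (simp add: tdeg_def)

lemma tdeg_v: "k \<noteq> 0 \<Longrightarrow> tdeg (a, single (nz k) 1 + m) = nat \<bar>k\<bar> + tdeg (a, m)"
proof -
  assume k: "k \<noteq> 0"
  let ?S = "insert (nz k) (keys m)"
  have "keys (single (nz k) 1 + m) \<subseteq> ?S" using keys_add[of "single (nz k) 1" m] by auto
  moreover have "(\<Sum>j\<in>?S. nat \<bar>int_of_nz j\<bar> * lookup (single (nz k) 1) j) = nat \<bar>k\<bar>"
    using k by (simp add: lookup_single when_def if_distrib cong: if_cong)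
  ultimately show ?thesis
    by (simp add: tdeg_superset[of ?S] lookup_add distrib_left sum.distrib subset_insertI
        del: sum.insert)
qed

text \<open>Every \<open>v_var k\<close> with k nonzero has degree at least 1, so a degree bound
  limits both which variables occur and their exponents.\<close>

lemma finite_tdeg_le: "finite {x. tdeg x \<le> d}"
proof -
  \<comment> \<open>\<open>nz 0\<close> is an unspecified index; only a finite superset of the
    possible variables is wanted.\<close>
  let ?K = "nz ` {-int d..int d}"
  let ?F = "{f. \<forall>j. (j \<in> ?K \<longrightarrow> f j \<in> {..d}) \<and> (j \<notin> ?K \<longrightarrow> f j = (0::nat))}"
  let ?h = "\<lambda>(a::int, m::nzint \<Rightarrow>\<^sub>0 nat). (a, lookup m)"
  have "?h ` {x. tdeg x \<le> d} \<subseteq> {-int d..int d} \<times> ?F"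
  proof safe
    fix a m assume d: "tdeg (a, m) \<le> d"
    then have "nat \<bar>a\<bar> \<le> d" by (simp add: tdeg_def)
    then show "a \<in> {-int d..int d}" by auto
    have *: "nat \<bar>int_of_nz j\<bar> * lookup m j \<le> d" if "j \<in> keys m" for j
      using member_le_sum[OF that, of "\<lambda>j. nat \<bar>int_of_nz j\<bar> * lookup m j"] d by (simp add: tdeg_def)
    show "lookup m j \<le> d" for j
    proof (cases "j \<in> keys m")
      case True
      have "1 * lookup m j \<le> nat \<bar>int_of_nz j\<bar> * lookup m j"
        using int_of_nz_neq_0[of j] by (intro mult_le_mono1) linarith
      then show ?thesis using *[OF True] by linarith
    qed (simp add: in_keys_iff)
    show "lookup m j = 0" if "j \<notin> ?K" for j
    proof (rule ccontr)
      assume j: "lookup m j \<noteq> 0"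
      then have "nat \<bar>int_of_nz j\<bar> * 1 \<le> nat \<bar>int_of_nz j\<bar> * lookup m j"
        by (intro mult_le_mono2) simp
      also have "\<dots> \<le> d" using * j by (simp add: in_keys_iff)
      finally have "int_of_nz j \<in> {-int d..int d}" by auto
      then show False using that nz_int_of_nz by (metis imageI)
    qed
  qed
  moreover have "finite ?F" by (rule finite_set_of_finite_funs) auto
  ultimately have "finite (?h ` {x. tdeg x \<le> d})"
    by (meson finite_SigmaI finite_atLeastAtMost_int finite_subset)
  moreover have "inj_on ?h {x. tdeg x \<le> d}"
    by (auto simp: inj_on_def intro: poly_mapping_eqI)
  ultimately show ?thesis by (rule finite_imageD)
qed

definition deg_le :: "nat \<Rightarrow> tpoly set" where
  "deg_le d = {P. \<forall>m\<in>keys P. tdeg m \<le> d}"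

lemma deg_le_mono: "P \<in> deg_le d \<Longrightarrow> d \<le> e \<Longrightarrow> P \<in> deg_le e"
  by (auto simp: deg_le_def)

lemma deg_le_0: "0 \<in> deg_le d"
  by (simp add: deg_le_def)

lemma deg_le_add: "P \<in> deg_le d \<Longrightarrow> Q \<in> deg_le d \<Longrightarrow> P + Q \<in> deg_le d"
  using keys_add by (fastforce simp: deg_le_def)

lemma deg_le_scl: "P \<in> deg_le d \<Longrightarrow> scl c P \<in> deg_le d"
  by (auto simp: deg_le_def in_keys_iff)

lemma deg_le_uminus: "P \<in> deg_le d \<Longrightarrow> - P \<in> deg_le d"
  by (auto simp: deg_le_def in_keys_iff)

lemma deg_le_diff: "P \<in> deg_le d \<Longrightarrow> Q \<in> deg_le d \<Longrightarrow> P - Q \<in> deg_le d"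
  using deg_le_add[of P d "- Q"] deg_le_uminus by simp

lemma deg_le_sum: "(\<And>i. i \<in> I \<Longrightarrow> f i \<in> deg_le d) \<Longrightarrow> sum f I \<in> deg_le d"
  by (induction I rule: infinite_finite_induct) (auto intro: deg_le_add deg_le_0)

lemma deg_le_of_int_mult: "P \<in> deg_le d \<Longrightarrow> of_int k * P \<in> deg_le d"
  by (simp add: of_int_mult_eq_scl deg_le_scl)

lemma deg_le_numeral_mult: "P \<in> deg_le d \<Longrightarrow> numeral k * P \<in> deg_le d"
  by (simp add: numeral_mult_eq_scl deg_le_scl)

lemma deg_le_mult: "P \<in> deg_le d \<Longrightarrow> Q \<in> deg_le e \<Longrightarrow> d + e \<le> c \<Longrightarrow> P * Q \<in> deg_le c"
proof -
  assume P: "P \<in> deg_le d" and Q: "Q \<in> deg_le e" and "d + e \<le> c"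
  have "tdeg m \<le> c" if m: "m \<in> keys (P * Q)" for m
  proof -
    obtain x y where "m = x + y" "x \<in> keys P" "y \<in> keys Q"
      using keys_mult[of P Q] m by blast
    then show ?thesis using P Q \<open>d + e \<le> c\<close> tdeg_add[of x y] by (fastforce simp: deg_le_def)
  qed
  then show ?thesis by (simp add: deg_le_def)
qed

lemma deg_le_u_pow: "nat \<bar>a\<bar> \<le> d \<Longrightarrow> u_pow a \<in> deg_le d"
  by (auto simp: u_pow_def deg_le_def)

lemma deg_le_v_var: "nat \<bar>k\<bar> \<le> d \<Longrightarrow> v_var k \<in> deg_le d"
  using tdeg_v[of k 0 0] by (auto simp: v_var_def deg_le_def zero_prod_def)

lemmas deg_le_intros = deg_le_add deg_le_diff deg_le_uminus deg_le_scl deg_le_sum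
  deg_le_of_int_mult deg_le_numeral_mult

lemma tp_linear_deg_le:
  assumes "tp_linear T" "\<And>m. T (monomial m) \<in> deg_le (tdeg m + c)" "P \<in> deg_le d"
  shows "T P \<in> deg_le (d + c)"
proof -
  have "T P = T (\<Sum>m\<in>keys P. scl (lookup P m) (monomial m))"
    using tpoly_eq_sum[of "keys P" P] by simp
  also have "\<dots> = (\<Sum>m\<in>keys P. scl (lookup P m) (T (monomial m)))"
    by (simp add: tp_linear_sum[OF assms(1)] tp_linearD(2)[OF assms(1)])
  also have "\<dots> \<in> deg_le (d + c)"
  proof (rule deg_le_sum, rule deg_le_scl)
    fix m assume "m \<in> keys P"
    then have "tdeg m \<le> d" using assms(3) by (simp add: deg_le_def)
    then show "T (monomial m) \<in> deg_le (d + c)" using deg_le_mono[OF assms(2)] by simp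
  qed
  finally show ?thesis .
qed

context contraction_constants
begin

text \<open>Each part of the cross term shifts an index by at most \<bar>j\<bar> or adds a factor
  \<open>v_var j\<close>.\<close>

lemma Gop_deg_mono: "Gop j (monomial m) \<in> deg_le (tdeg m + nat \<bar>j\<bar>)"
proof (induction m rule: tmono_induct)
  case (u a)
  have "u_pow a * u_pow (- j) \<in> deg_le (nat \<bar>a\<bar> + nat \<bar>j\<bar>)" "u_pow a * u_pow j \<in> deg_le (nat \<bar>a\<bar> + nat \<bar>j\<bar>)"
    "u_pow a * v_var j \<in> deg_le (nat \<bar>a\<bar> + nat \<bar>j\<bar>)"
    by (auto intro!: deg_le_mult[OF deg_le_u_pow[OF order_refl] deg_le_u_pow[OF order_refl]]
        deg_le_mult[OF deg_le_u_pow[OF order_refl] deg_le_v_var[OF order_refl]])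
  then have "Gop j (u_pow a) \<in> deg_le (nat \<bar>a\<bar> + nat \<bar>j\<bar>)"
    unfolding Gop_u_pow distrib_left right_diff_distrib scl_mult by (intro deg_le_intros)
  then show ?case by (simp add: u_pow_def)
next
  case (v a m k)
  let ?d = "tdeg (a, m)"
  have m: "monomial (a, m) \<in> deg_le ?d" by (simp add: deg_le_def)
  have "v_var (k - j) \<in> deg_le (nat \<bar>k\<bar> + nat \<bar>j\<bar>)" "v_var (j - k) \<in> deg_le (nat \<bar>k\<bar> + nat \<bar>j\<bar>)"
    "v_var (j + k) \<in> deg_le (nat \<bar>k\<bar> + nat \<bar>j\<bar>)" "v_var j * v_var k \<in> deg_le (nat \<bar>k\<bar> + nat \<bar>j\<bar>)"
    by (auto intro!: deg_le_v_var deg_le_mult[OF deg_le_v_var[OF order_refl] deg_le_v_var[OF order_refl]])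
  then have "(scl \<epsilon> (v_var (k - j) + v_var (j - k)) - scl \<delta> (2 * v_var (j + k)) + scl \<gamma> (2 * (v_var j * v_var k)))
      * monomial (a, m) \<in> deg_le (nat \<bar>k\<bar> + ?d + nat \<bar>j\<bar>)"
    by (intro deg_le_mult[OF _ m, of _ "nat \<bar>k\<bar> + nat \<bar>j\<bar>"] deg_le_intros) auto
  moreover have "v_var k * Gop j (monomial (a, m)) \<in> deg_le (nat \<bar>k\<bar> + ?d + nat \<bar>j\<bar>)"
    by (rule deg_le_mult[OF deg_le_v_var v(2)]) auto
  ultimately have "Gop j (v_var k * monomial (a, m)) \<in> deg_le (nat \<bar>k\<bar> + ?d + nat \<bar>j\<bar>)"
    unfolding Gop_v_mult[OF v(1)] mult.assoc[of 2] by (intro deg_le_intros)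
  then show ?case by (simp add: v_var_mult_mono tdeg_v v(1))
qed

lemma abs_tail: "d \<in> tail a \<Longrightarrow> \<bar>a - d\<bar> + \<bar>d\<bar> = \<bar>a\<bar>"
  by (auto simp: tail_def)

text \<open>On the tail \<open>\<bar>a - d\<bar> + \<bar>d\<bar> = \<bar>a\<bar>\<close>, and the
  index k - 2d stays within \<bar>k\<bar>; hence no contraction raises the degree.\<close>

lemma Dop_deg_mono: "Dop (monomial m) \<in> deg_le (tdeg m)"
proof (induction m rule: tmono_induct)
  case (u a)
  have c: "contr d \<in> deg_le (nat \<bar>d\<bar>)" for d
    unfolding contr_def by (intro deg_le_intros deg_le_u_pow deg_le_v_var) auto
  have "u_pow a * contr 0 \<in> deg_le (nat \<bar>a\<bar>)"
    by (rule deg_le_mult[OF deg_le_u_pow c]) auto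
  moreover have "u_pow (a - d) * contr d \<in> deg_le (nat \<bar>a\<bar>)" if "d \<in> tail a" for d
    by (rule deg_le_mult[OF deg_le_u_pow[OF order_refl] c]) (use abs_tail[OF that] in linarith)
  ultimately have "Dop (u_pow a) \<in> deg_le (nat \<bar>a\<bar>)"
    unfolding Dop_u_pow by (intro deg_le_intros) auto
  then show ?case by (simp add: u_pow_def)
next
  case (v a m k)
  let ?d = "tdeg (a, m)"
  have m: "monomial (a, m) \<in> deg_le ?d" by (simp add: deg_le_def)
  have "- v_var d * v_var (k - d) \<in> deg_le (nat \<bar>k\<bar>)" "v_var (k - 2 * d) \<in> deg_le (nat \<bar>k\<bar>)" if "d \<in> tail k" for d
    by (rule deg_le_mult[OF deg_le_uminus[OF deg_le_v_var[OF order_refl]] deg_le_v_var[OF order_refl]]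
        deg_le_v_var; use that in \<open>auto simp: tail_def\<close>)+
  then have "Dop (v_var k) \<in> deg_le (nat \<bar>k\<bar>)"
    unfolding Dop_v[OF v(1)] by (intro deg_le_intros) (simp_all add: deg_le_v_var)
  then have "Dop (v_var k) * monomial (a, m) \<in> deg_le (nat \<bar>k\<bar> + ?d)"
    by (rule deg_le_mult[OF _ m]) simp
  moreover have "v_var k * Dop (monomial (a, m)) \<in> deg_le (nat \<bar>k\<bar> + ?d)"
    by (rule deg_le_mult[OF deg_le_v_var v(2)]) auto
  moreover have "Gop k (monomial (a, m)) \<in> deg_le (nat \<bar>k\<bar> + ?d)"
    using Gop_deg_mono[of k "(a, m)"] by (simp add: add.commute)
  ultimately have "Dop (v_var k * monomial (a, m)) \<in> deg_le (nat \<bar>k\<bar> + ?d)"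
    unfolding Dop_v_mult[OF v(1)] by (intro deg_le_intros)
  then show ?case by (simp add: v_var_mult_mono tdeg_v v(1))
qed

lemma Dop_deg_le: "P \<in> deg_le d \<Longrightarrow> Dop P \<in> deg_le d"
  using tp_linear_deg_le[OF tp_linear_Dop, of 0] Dop_deg_mono by simp

end

lemma ex_deg_le: "\<exists>d. P \<in> deg_le d"
proof -
  have "P \<in> deg_le (\<Sum>m\<in>keys P. tdeg m)"
    by (auto simp: deg_le_def intro!: member_le_sum)
  then show ?thesis ..
qed

section \<open>Exponential series of degree preserving operators\<close>

lemma deg_le_funpow: "(\<And>P. P \<in> deg_le d \<Longrightarrow> T P \<in> deg_le d) \<Longrightarrow> P \<in> deg_le d \<Longrightarrow> (T ^^ n) P \<in> deg_le d"
  by (induction n) auto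

lemma summable_exp_series:
  assumes "tp_linear T" and deg: "\<And>P. P \<in> deg_le d \<Longrightarrow> T P \<in> deg_le d" and "P \<in> deg_le d"
  shows "summable (\<lambda>n. c ^ n / fact n * lookup ((T ^^ n) P) m)"
proof -
  define S where "S = {m. tdeg m \<le> d}"
  have S: "finite S" by (simp add: S_def finite_tdeg_le)
  define nrm where "nrm Q = (\<Sum>m\<in>S. cmod (lookup Q m))" for Q :: tpoly
  \<comment> \<open>A crude bound for the operator norm belonging to the l1 norm on coefficients:
    the sum over all columns in place of the largest one. Against the factorial it suffices.\<close>
  define K where "K = (\<Sum>m\<in>S. nrm (T (monomial m)))"
  have K0: "K \<ge> 0" by (simp add: K_def nrm_def sum_nonneg)
  have le: "cmod (lookup Q m) \<le> nrm Q" if "Q \<in> deg_le d" for Q m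
  proof (cases "m \<in> S")
    case True
    then show ?thesis unfolding nrm_def using S by (intro member_le_sum) auto
  next
    case False
    then have "lookup Q m = 0" using that by (auto simp: S_def deg_le_def in_keys_iff)
    then show ?thesis by (simp add: nrm_def sum_nonneg)
  qed
  have step: "nrm (T Q) \<le> K * nrm Q" if "Q \<in> deg_le d" for Q
  proof -
    have "Q = (\<Sum>m\<in>S. scl (lookup Q m) (monomial m))"
      by (rule tpoly_eq_sum[OF S]) (use that in \<open>auto simp: S_def deg_le_def\<close>)
    then have "T Q = T (\<Sum>m\<in>S. scl (lookup Q m) (monomial m))" by simp
    also have "\<dots> = (\<Sum>m\<in>S. scl (lookup Q m) (T (monomial m)))"
      by (simp add: tp_linear_sum[OF assms(1)] tp_linearD(2)[OF assms(1)])
    finally have TQ: "lookup (T Q) x = (\<Sum>m\<in>S. lookup Q m * lookup (T (monomial m)) x)" for x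
      by (simp add: lookup_sum)
    have "nrm (T Q) \<le> (\<Sum>x\<in>S. \<Sum>m\<in>S. cmod (lookup Q m) * cmod (lookup (T (monomial m)) x))"
      unfolding nrm_def TQ by (intro sum_mono order_trans[OF norm_sum]) (simp add: norm_mult)
    also have "\<dots> = (\<Sum>m\<in>S. cmod (lookup Q m) * nrm (T (monomial m)))"
      unfolding nrm_def sum_distrib_left by (rule sum.swap)
    also have "\<dots> \<le> (\<Sum>m\<in>S. nrm Q * nrm (T (monomial m)))"
      by (intro sum_mono mult_right_mono le that) (simp add: nrm_def sum_nonneg)
    finally show ?thesis by (simp add: K_def sum_distrib_left mult.commute)
  qed
  have pow: "nrm ((T ^^ n) P) \<le> K ^ n * nrm P" for n
  proof (induction n)
    case (Suc n)
    have "nrm ((T ^^ Suc n) P) \<le> K * nrm ((T ^^ n) P)"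
      using step deg_le_funpow[where T=T, OF deg assms(3)] by simp
    also have "\<dots> \<le> K * (K ^ n * nrm P)" using Suc K0 by (rule mult_left_mono)
    finally show ?case by (simp add: mult.assoc)
  qed simp
  show ?thesis
  proof (rule summable_comparison_test')
    show "summable (\<lambda>n. nrm P * (inverse (fact n) * (cmod c * K) ^ n))"
      by (intro summable_mult summable_exp)
    show "norm (c ^ n / fact n * lookup ((T ^^ n) P) m) \<le> nrm P * (inverse (fact n) * (cmod c * K) ^ n)" for n
    proof -
      have "cmod (lookup ((T ^^ n) P) m) \<le> K ^ n * nrm P"
        using le[OF deg_le_funpow[where T=T, OF deg assms(3)]] pow order_trans by blast
      then have "cmod c ^ n / fact n * cmod (lookup ((T ^^ n) P) m) \<le> cmod c ^ n / fact n * (K ^ n * nrm P)"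
        by (intro mult_left_mono) auto
      then show ?thesis by (simp add: norm_mult norm_divide norm_power power_mult_distrib field_simps)
    qed
  qed
qed

lemma
  assumes "tp_linear T" and deg: "\<And>P. P \<in> deg_le d \<Longrightarrow> T P \<in> deg_le d" and "P \<in> deg_le d"
  shows tp_exp_sums: "(\<lambda>n. c ^ n / fact n * lookup ((T ^^ n) P) m) sums lookup (tp_exp c T P) m"
    and tp_exp_deg_le: "tp_exp c T P \<in> deg_le d"
proof -
  have z: "lookup ((T ^^ n) P) m = 0" if "\<not> tdeg m \<le> d" for n m
    using deg_le_funpow[where T=T, OF deg assms(3), where n=n] that by (auto simp: deg_le_def in_keys_iff)
  have "{m. suminf (\<lambda>n. c ^ n / fact n * lookup ((T ^^ n) P) m) \<noteq> 0} \<subseteq> {m. tdeg m \<le> d}"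
    using z by fastforce
  then have "finite {m. suminf (\<lambda>n. c ^ n / fact n * lookup ((T ^^ n) P) m) \<noteq> 0}"
    using finite_tdeg_le finite_subset by blast
  \<comment> \<open>\<open>Abs_poly_mapping\<close> is meaningful only on functions of finite
    support, which the degree bound supplies.\<close>
  then have l: "lookup (tp_exp c T P) m = suminf (\<lambda>n. c ^ n / fact n * lookup ((T ^^ n) P) m)" for m
    by (simp add: tp_exp_def)
  show "(\<lambda>n. c ^ n / fact n * lookup ((T ^^ n) P) m) sums lookup (tp_exp c T P) m"
    unfolding l by (rule summable_sums summable_exp_series[OF assms])+
  show "tp_exp c T P \<in> deg_le d"
  proof -
    have "lookup (tp_exp c T P) m = 0" if "\<not> tdeg m \<le> d" for m
      unfolding l z[OF that] by simp
    then show ?thesis by (auto simp: deg_le_def in_keys_iff)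
  qed
qed

section \<open>Pseudodifferential order\<close>

text \<open>\<open>op_lincomb\<close> sums over all natural numbers. A countable family is
  enumerated by \<open>to_nat\<close>, and the remaining indices get the coefficient 0 and the
  operator \<open>id\<close>.\<close>

lemma op_lincomb_I:
  fixes W :: "'i::countable \<Rightarrow> tpop"
  assumes W: "\<And>i. i \<in> I \<Longrightarrow> W i \<in> S" and "id \<in> S"
    and fin: "\<And>P. finite {i\<in>I. W i P \<noteq> 0}" and T: "\<And>P. T P = sum' (\<lambda>i. W i P) I"
  shows "op_lincomb S T"
proof -
  let ?J = "to_nat ` I"
  define c :: "nat \<Rightarrow> complex" where "c n = (if n \<in> ?J then 1 else 0)" for n
  define V where "V n = (if n \<in> ?J then W (from_nat n) else id)" for n
  have S: "{n. scl (c n) (V n P) \<noteq> 0} = to_nat ` {i\<in>I. W i P \<noteq> 0}" for P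
    by (auto simp: c_def V_def split: if_splits)
  have "T P = sum' (\<lambda>n. scl (c n) (V n P)) UNIV" for P
    unfolding T by (rule sum'_reindex[symmetric, where h=to_nat]) (auto simp: c_def V_def)
  moreover have "V n \<in> S" for n using W \<open>id \<in> S\<close> by (auto simp: V_def)
  ultimately show ?thesis
    unfolding op_lincomb_def using fin by (intro exI[of _ c] exI[of _ V]) (auto simp: S)
qed

lemma op_lincomb_single: "T \<in> S \<Longrightarrow> id \<in> S \<Longrightarrow> op_lincomb S T"
  by (rule op_lincomb_I[where I="{()}" and W="\<lambda>_. T"]) auto

lemma op_lincomb_scl:
  assumes "op_lincomb S T"
  shows "op_lincomb S (\<lambda>P. scl a (T P))"
proof -
  from assms obtain c :: "nat \<Rightarrow> complex" and W where *: "\<And>i. W i \<in> S" "\<And>P. finite {i. scl (c i) (W i P) \<noteq> 0}"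
    "\<And>P. T P = sum' (\<lambda>i. scl (c i) (W i P)) UNIV"
    unfolding op_lincomb_def by blast
  have "finite {i. scl (a * c i) (W i P) \<noteq> 0}" for P
  proof (rule finite_subset[OF _ *(2)[of P]])
    show "{i. scl (a * c i) (W i P) \<noteq> 0} \<subseteq> {i. scl (c i) (W i P) \<noteq> 0}"
    proof safe
      fix i assume "scl (a * c i) (W i P) \<noteq> 0" "scl (c i) (W i P) = 0"
      then show False using scl_scl[of a "c i" "W i P"] by simp
    qed
  qed
  moreover have "scl a (T P) = sum' (\<lambda>i. scl (a * c i) (W i P)) UNIV" for P
    using sum'_compose_linear[of "scl a" UNIV "\<lambda>i. scl (c i) (W i P)", OF tp_linear_intros(8)[OF tp_linear_intros(1)]]
      *(2,3)[of P] by simp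
  ultimately show ?thesis
    unfolding op_lincomb_def using *(1) by (intro exI[of _ "\<lambda>i. a * c i"] exI[of _ W]) auto
qed

lemma op_lincomb_add:
  assumes "op_lincomb S T" "op_lincomb S T'"
  shows "op_lincomb S (\<lambda>P. T P + T' P)"
proof -
  from assms(1) obtain c :: "nat \<Rightarrow> complex" and W where *: "\<And>i. W i \<in> S" "\<And>P. finite {i. scl (c i) (W i P) \<noteq> 0}"
    "\<And>P. T P = sum' (\<lambda>i. scl (c i) (W i P)) UNIV"
    unfolding op_lincomb_def by blast
  from assms(2) obtain c' :: "nat \<Rightarrow> complex" and W' where **: "\<And>i. W' i \<in> S" "\<And>P. finite {i. scl (c' i) (W' i P) \<noteq> 0}"
    "\<And>P. T' P = sum' (\<lambda>i. scl (c' i) (W' i P)) UNIV"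
    unfolding op_lincomb_def by blast
  \<comment> \<open>The two families are interleaved on the even and the odd indices.\<close>
  define d where "d n = (if even n then c (n div 2) else c' (n div 2))" for n :: nat
  define V where "V n = (if even n then W (n div 2) else W' (n div 2))" for n :: nat
  have V: "V n \<in> S" for n using * ** by (simp add: V_def)
  let ?f = "\<lambda>P n. scl (d n) (V n P)"
  let ?E = "\<lambda>P n. if even n then ?f P n else 0" and ?O = "\<lambda>P n. if odd n then ?f P n else 0"
  have E: "{n. ?E P n \<noteq> 0} = (\<lambda>i. 2 * i) ` {i. scl (c i) (W i P) \<noteq> 0}" for P
    by (auto simp: d_def V_def image_iff elim!: evenE)
  have O: "{n. ?O P n \<noteq> 0} = (\<lambda>i. 2 * i + 1) ` {i. scl (c' i) (W' i P) \<noteq> 0}" for P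
    by (auto simp: d_def V_def image_iff elim!: oddE)
  have fE: "finite {n\<in>UNIV. ?E P n \<noteq> 0}" and fO: "finite {n\<in>UNIV. ?O P n \<noteq> 0}" for P
    using E[of P] O[of P] *(2) **(2) by auto
  have "T P = sum' (?E P) UNIV" for P
    unfolding * by (rule sum'_reindex[symmetric, where h="\<lambda>i. 2 * i"])
      (auto simp: inj_on_def d_def V_def elim!: evenE)
  moreover have "T' P = sum' (?O P) UNIV" for P
    unfolding ** by (rule sum'_reindex[symmetric, where h="\<lambda>i. 2 * i + 1"])
      (auto simp: inj_on_def d_def V_def elim!: oddE)
  moreover have "?f P = (\<lambda>n. ?E P n + ?O P n)" for P by auto
  ultimately have "T P + T' P = sum' (?f P) UNIV" for P
    using sum.distrib'[OF fE fO, of P P] by presburger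
  moreover have "finite {n. ?f P n \<noteq> 0}" for P
    by (rule finite_subset[OF _ finite_UnI[OF fE fO], of _ P P]) auto
  ultimately show ?thesis
    unfolding op_lincomb_def using V by (intro exI[of _ d] exI[of _ V]) auto
qed

lemma op_lincomb_uminus: "op_lincomb S T \<Longrightarrow> op_lincomb S (\<lambda>P. - T P)"
  using op_lincomb_scl[of S T "-1"] by (simp add: scl_uminus_left)

lemma op_lincomb_diff: "op_lincomb S T \<Longrightarrow> op_lincomb S T' \<Longrightarrow> op_lincomb S (\<lambda>P. T P - T' P)"
  using op_lincomb_add[OF _ op_lincomb_uminus, of S T T'] by simp

lemma op_lincomb_numeral_mult: "op_lincomb S T \<Longrightarrow> op_lincomb S (\<lambda>P. numeral n * T P)"
  by (simp add: numeral_mult_eq_scl op_lincomb_scl)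

lemma op_lincomb_zero: "id \<in> S \<Longrightarrow> op_lincomb S (\<lambda>P. 0)"
  using op_lincomb_scl[OF op_lincomb_single[of id S], of 0] by simp

section \<open>Orders of the individual operators\<close>

abbreviation comps :: "tpop set \<Rightarrow> nat \<Rightarrow> tpop set" where
  "comps E n \<equiv> {T. \<exists>r\<le>n. op_comp E r T}"

lemma id_comps: "id \<in> comps E n"
  using op_comp_id by blast

lemma op_comp_intros:
  "op_comp E 0 (\<lambda>P. P)"
  "op_comp E r T \<Longrightarrow> op_comp E r (\<lambda>P. Q * T P)"
  "S \<in> E \<Longrightarrow> op_comp E r T \<Longrightarrow> op_comp E r (\<lambda>P. S (T P))"
  "op_comp E r T \<Longrightarrow> op_comp E (Suc r) (\<lambda>P. d_u (T P))"
  "k \<noteq> 0 \<Longrightarrow> op_comp E r T \<Longrightarrow> op_comp E (Suc r) (\<lambda>P. d_v k (T P))"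
  using op_comp_id[of E] op_comp_mult[of E r T Q] op_comp_extra[of S E r T] op_comp_d_u[of E r T] op_comp_d_v[of k E r T]
  by (simp_all add: id_def comp_def)

lemma op_lincomb_comps: "op_comp E r T \<Longrightarrow> r \<le> n \<Longrightarrow> op_lincomb (comps E n) T"
  by (rule op_lincomb_single[OF _ id_comps]) auto

lemma op_lincomb_vop:
  assumes "0 \<notin> I" "n \<ge> 1"
  shows "op_lincomb (comps E n) (vop Q I)"
proof (rule op_lincomb_I[where I=I and W="\<lambda>k P. Q k * d_v k P"])
  fix k assume "k \<in> I"
  then have "k \<noteq> 0" using assms by metis
  then have "op_comp E (Suc 0) (\<lambda>P. Q k * d_v k P)"
    by (rule op_comp_intros(2)[OF op_comp_intros(5)[OF _ op_comp_intros(1)]])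
  then show "(\<lambda>P. Q k * d_v k P) \<in> comps E n" using assms(2) by (auto simp: One_nat_def)
qed (use assms in \<open>auto simp: vop_def intro!: vop_finite op_comp_id\<close>)

lemma op_lincomb_vop_d_u:
  assumes "n \<ge> 2"
  shows "op_lincomb (comps E n) (\<lambda>P. vop Q nonzero_ints (d_u P))"
proof (rule op_lincomb_I[where I=nonzero_ints and W="\<lambda>k P. Q k * d_v k (d_u P)"])
  fix k :: int assume "k \<in> nonzero_ints"
  then have "k \<noteq> 0" by auto
  then have "op_comp E (Suc (Suc 0)) (\<lambda>P. Q k * d_v k (d_u P))"
    by (rule op_comp_intros(2)[OF op_comp_intros(5)[OF _ op_comp_intros(4)[OF op_comp_intros(1)]]])
  then show "(\<lambda>P. Q k * d_v k (d_u P)) \<in> comps E n" using assms by (auto simp: numeral_2_eq_2)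
next
  show "finite {k\<in>nonzero_ints. Q k * d_v k (d_u P) \<noteq> 0}" for P by (rule vop_finite) auto
qed (auto simp: vop_def intro!: op_comp_id)

lemma op_lincomb_vop2:
  assumes "n \<ge> 2"
  shows "op_lincomb (comps E n) (vop2 Q)"
proof (rule op_lincomb_I[where I="{(j, k). \<bar>j\<bar> \<ge> 1 \<and> \<bar>k\<bar> \<ge> 1}"
      and W="\<lambda>x P. case x of (j, k) \<Rightarrow> Q j k * d_v j (d_v k P)"])
  fix x :: "int \<times> int" assume x: "x \<in> {(j, k). \<bar>j\<bar> \<ge> 1 \<and> \<bar>k\<bar> \<ge> 1}"
  obtain j k where jk: "x = (j, k)" by (cases x)
  with x have "j \<noteq> 0" "k \<noteq> 0" by auto
  then have "op_comp E (Suc (Suc 0)) (\<lambda>P. Q j k * d_v j (d_v k P))"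
    by (intro op_comp_intros(2)[OF op_comp_intros(5)[OF _ op_comp_intros(5)[OF _ op_comp_intros(1)]]])
  then show "(\<lambda>P. case x of (j, k) \<Rightarrow> Q j k * d_v j (d_v k P)) \<in> comps E n"
    using assms by (auto simp: jk numeral_2_eq_2)
next
  show "finite {x \<in> {(j, k). \<bar>j\<bar> \<ge> 1 \<and> \<bar>k\<bar> \<ge> 1}. (case x of (j, k) \<Rightarrow> Q j k * d_v j (d_v k P)) \<noteq> 0}" for P
    by (rule vop2_finite)
qed (auto simp: vop2_def intro!: op_comp_id)

lemma op_lincomb_rop:
  assumes "R_plus \<in> E" "R_minus \<in> E" "n \<ge> 1"
  shows "op_lincomb (comps E n) (rop_plus Q)" "op_lincomb (comps E n) (rop_minus Q)"
proof -
  have "op_comp E (Suc 0) (\<lambda>P. Q k * R_plus (d_u (u_pow (- k) * R_plus P)))"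
    "op_comp E (Suc 0) (\<lambda>P. Q k * R_minus (d_u (u_pow (- k) * R_minus P)))" for k
    by (rule op_comp_intros(2)[OF op_comp_intros(3)[OF assms(1) op_comp_intros(4)[OF op_comp_intros(2)[OF op_comp_intros(3)[OF assms(1) op_comp_intros(1)]]]]]
        op_comp_intros(2)[OF op_comp_intros(3)[OF assms(2) op_comp_intros(4)[OF op_comp_intros(2)[OF op_comp_intros(3)[OF assms(2) op_comp_intros(1)]]]]])+
  then have "(\<lambda>P. Q k * R_plus (d_u (u_pow (- k) * R_plus P))) \<in> comps E n"
    "(\<lambda>P. Q k * R_minus (d_u (u_pow (- k) * R_minus P))) \<in> comps E n" for k
    using assms(3) by (auto simp: One_nat_def)
  note W = this
  show "op_lincomb (comps E n) (rop_plus Q)"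
    by (rule op_lincomb_I[where I="{1..}" and W="\<lambda>k P. Q k * R_plus (d_u (u_pow (- k) * R_plus P))",
          OF W(1) id_comps rop_finite(1) rop_plus_def])
  show "op_lincomb (comps E n) (rop_minus Q)"
    by (rule op_lincomb_I[where I="{..-1}" and W="\<lambda>k P. Q k * R_minus (d_u (u_pow (- k) * R_minus P))",
          OF W(2) id_comps rop_finite(2) rop_minus_def])
qed

lemma op_lincomb_first_order:
  fixes E
  defines "E \<equiv> {R_plus, R_minus}"
  shows "op_lincomb (comps E 1) op_N" "op_lincomb (comps E 1) op_Y1" "op_lincomb (comps E 1) op_Y2"
    "op_lincomb (comps E 1) op_Z1" "op_lincomb (comps E 1) op_Z2"
proof -
  have E: "R_plus \<in> E" "R_minus \<in> E" by (simp_all add: E_def)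
  have "op_comp E (Suc 0) (\<lambda>P. u_pow 1 * d_u (R_plus P))" "op_comp E (Suc 0) (\<lambda>P. u_pow 1 * d_u (R_minus P))"
    by (rule op_comp_intros(2)[OF op_comp_intros(4)[OF op_comp_intros(3)[OF E(1) op_comp_intros(1)]]]
        op_comp_intros(2)[OF op_comp_intros(4)[OF op_comp_intros(3)[OF E(2) op_comp_intros(1)]]])+
  then have "op_lincomb (comps E 1) (\<lambda>P. u_pow 1 * d_u (R_plus P))" "op_lincomb (comps E 1) (\<lambda>P. u_pow 1 * d_u (R_minus P))"
    by (auto intro: op_lincomb_comps simp: One_nat_def)
  from op_lincomb_diff[OF this]
  show "op_lincomb (comps E 1) op_N"
    unfolding op_N_eq[abs_def] tp_linearD(5)[OF tp_linear_ops(1)] right_diff_distrib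
    by (intro op_lincomb_add op_lincomb_vop) auto
  show "op_lincomb (comps E 1) op_Y1" "op_lincomb (comps E 1) op_Z2"
    unfolding op_Y1_eq[abs_def] op_Z2_eq[abs_def] by (intro op_lincomb_diff op_lincomb_rop E order_refl)+
  show "op_lincomb (comps E 1) op_Y2" "op_lincomb (comps E 1) op_Z1"
    unfolding op_Y2_eq[abs_def] op_Z1_eq[abs_def] by (intro op_lincomb_diff op_lincomb_vop; simp)+
qed

lemma op_lincomb_second_order:
  "op_lincomb (comps E 2) op_K1_plus" "op_lincomb (comps E 2) op_K1_minus"
  "op_lincomb (comps E 2) op_K2_plus" "op_lincomb (comps E 2) op_K2_minus"
  "op_lincomb (comps E 2) op_J"
proof -
  show "op_lincomb (comps E 2) op_K1_plus" "op_lincomb (comps E 2) op_K1_minus"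
    "op_lincomb (comps E 2) op_K2_plus" "op_lincomb (comps E 2) op_K2_minus"
    unfolding op_K1_plus_eq[abs_def] op_K1_minus_eq[abs_def] op_K2_plus_eq[abs_def] op_K2_minus_eq[abs_def]
    by (rule op_lincomb_vop_d_u op_lincomb_vop2 order_refl)+
  have "op_comp E (Suc (Suc 0)) (\<lambda>P. u_pow 2 * d_u (d_u P))" "op_comp E (Suc 0) (\<lambda>P. u_pow 1 * d_u P)"
    by (rule op_comp_intros(2)[OF op_comp_intros(4)[OF op_comp_intros(4)[OF op_comp_intros(1)]]]
        op_comp_intros(2)[OF op_comp_intros(4)[OF op_comp_intros(1)]])+
  then have "op_lincomb (comps E 2) (\<lambda>P. u_pow 2 * d_u (d_u P))" "op_lincomb (comps E 2) (\<lambda>P. u_pow 1 * d_u P)"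
    by (auto intro: op_lincomb_comps simp: numeral_2_eq_2)
  then show "op_lincomb (comps E 2) op_J"
    unfolding op_J_eq[abs_def]
    by (intro op_lincomb_add op_lincomb_numeral_mult op_lincomb_vop_d_u op_lincomb_vop2 op_lincomb_vop) auto
qed

lemma first_order_L0: "first_order_pseudodiff_op L0"
  unfolding first_order_pseudodiff_op_def L0_def[abs_def]
  by (intro op_lincomb_diff op_lincomb_uminus op_lincomb_numeral_mult op_lincomb_first_order)

lemma first_order_L1: "first_order_pseudodiff_op (L1 b)"
proof -
  have "op_lincomb (comps {R_plus, R_minus} 1) L1_real"
    unfolding L1_real_def[abs_def]
    by (intro op_lincomb_add op_lincomb_numeral_mult op_lincomb_first_order)
  moreover have "L1 Beta1 = L1_real" "L1 Beta2 = (\<lambda>P. 0)" "L1 Beta4 = (\<lambda>P. scl (-1/2) (L1_real P))"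
    by (simp_all add: fun_eq_iff)
  ultimately show ?thesis
    unfolding first_order_pseudodiff_op_def
    by (cases b) (simp_all only: op_lincomb_zero[OF id_comps] op_lincomb_scl)
qed

lemma second_order_L2: "second_order_diff_op (L2 b)"
proof -
  have *: "op_lincomb (comps {} 2) L2_real"
    unfolding L2_real_def[abs_def] op_K1_def op_K2_def
    by (intro op_lincomb_add op_lincomb_diff op_lincomb_numeral_mult op_lincomb_second_order)
  have "op_lincomb (comps {} 2) (\<lambda>P. - (2 * op_K1_minus P) - op_K2_minus P + op_J P)"
    by (intro op_lincomb_add op_lincomb_diff op_lincomb_uminus op_lincomb_numeral_mult op_lincomb_second_order)
  moreover have "L2 Beta1 = L2_real" "L2 Beta2 = (\<lambda>P. - (2 * op_K1_minus P) - op_K2_minus P + op_J P)"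
    "L2 Beta4 = (\<lambda>P. scl (1/4) (L2_real P))"
    by (simp_all add: fun_eq_iff)
  ultimately show ?thesis
    unfolding second_order_diff_op_def using *
    by (cases b) (simp_all only: op_lincomb_scl)
qed

section \<open>Matrix powers and evaluation of trace polynomials\<close>

lemma bounded_bilinear_matrix_mult:
  "bounded_bilinear ((**) :: complex^'m^'m \<Rightarrow> complex^'m^'m \<Rightarrow> complex^'m^'m)"
  unfolding bilinear_conv_bounded_bilinear[symmetric] bilinear_def
  by (auto intro!: linearI simp: matrix_matrix_mult_def vec_eq_iff algebra_simps sum.distrib scaleR_sum_right)

interpretation matrix_mult: bounded_bilinear "(**) :: complex^'m^'m \<Rightarrow> complex^'m^'m \<Rightarrow> complex^'m^'m"
  by (rule bounded_bilinear_matrix_mult)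

lemma mscale_nth [simp]: "mscale c A $ i $ j = c * A $ i $ j"
  by (simp add: mscale_def map_matrix_def)

lemma mscale_matrix_mult:
  "mscale c A ** B = mscale c (A ** B)" "A ** mscale c B = mscale c (A ** B)"
  by (simp_all add: vec_eq_iff matrix_matrix_mult_def sum_distrib_left mult_ac)

lemma mscale_add: "mscale c (A + B) = mscale c A + mscale c B"
  and mscale_diff: "mscale c (A - B) = mscale c A - mscale c B"
  and mscale_uminus: "mscale c (- A) = - mscale c A"
  and mscale_0 [simp]: "mscale c 0 = 0" "mscale 0 A = 0"
  and mscale_1 [simp]: "mscale 1 A = A"
  and mscale_mscale [simp]: "mscale c (mscale d A) = mscale (c * d) A"
  and mscale_add_left: "mscale (c + d) A = mscale c A + mscale d A"
  and mscale_diff_left: "mscale (c - d) A = mscale c A - mscale d A"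
  and mscale_uminus_left: "mscale (- c) A = - mscale c A"
  by (simp_all add: vec_eq_iff algebra_simps)

lemma mscale_sum: "mscale c (sum f I) = (\<Sum>i\<in>I. mscale c (f i))"
  by (induction I rule: infinite_finite_induct) (auto simp: mscale_add)

lemma mscale_sum_left: "mscale (sum f I) A = (\<Sum>i\<in>I. mscale (f i) A)"
  by (induction I rule: infinite_finite_induct) (auto simp: mscale_add_left)

lemma mat_eq_mscale: "mat c = mscale c (mat 1)"
  by (simp add: vec_eq_iff mat_def)

lemma mat_mult: "mat c ** A = mscale c A" "A ** mat c = mscale c (A :: complex^'m^'m)"
  by (simp_all add: mat_eq_mscale[of c] mscale_matrix_mult)

lemma bounded_linear_mscale: "bounded_linear (mscale c :: complex^'m^'m \<Rightarrow> _)"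
  unfolding linear_conv_bounded_linear[symmetric]
  by (auto intro!: linearI simp: vec_eq_iff algebra_simps)

lemma bounded_linear_mscale_left: "bounded_linear (\<lambda>c. mscale c (A :: complex^'m^'m))"
  unfolding linear_conv_bounded_linear[symmetric]
  by (auto intro!: linearI simp: vec_eq_iff algebra_simps)

lemma trace_mscale: "trace (mscale c A) = c * trace A"
  by (simp add: trace_def sum_distrib_left)

lemma bounded_linear_ntr: "bounded_linear (ntr :: complex^'m^'m \<Rightarrow> complex)"
  unfolding linear_conv_bounded_linear[symmetric]
  by (auto intro!: linearI simp: ntr_def trace_def sum.distrib divide_inverse distrib_right
      simp flip: scaleR_sum_right)

lemma ntr_mscale: "ntr (mscale c A) = c * ntr A"
  by (simp add: ntr_def trace_mscale)

lemma ntr_mat_1 [simp]: "ntr (mat 1) = 1"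
  by (simp add: ntr_def trace_I)

lemma ntr_mult_commute: "ntr (A ** B) = ntr (B ** (A :: complex^'m^'m))"
  unfolding ntr_def trace_mul_sym[of A B] ..

lemma ntr_add: "ntr (A + B) = ntr A + ntr B"
  and ntr_diff: "ntr (A - B) = ntr A - ntr B"
  and ntr_uminus: "ntr (- A) = - ntr A"
  and ntr_sum: "ntr (sum f I) = (\<Sum>i\<in>I. ntr (f i))"
proof -
  note L = bounded_linear.linear[OF bounded_linear_ntr]
  show "ntr (A + B) = ntr A + ntr B" "ntr (A - B) = ntr A - ntr B" "ntr (- A) = - ntr A"
    "ntr (sum f I) = (\<Sum>i\<in>I. ntr (f i))"
    by (rule linear_add[OF L] linear_diff[OF L] linear_neg[OF L] linear_sum[OF L])+
qed

lemma matrix_inv: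
  assumes "invertible (A :: complex^'m^'m)"
  shows "A ** matrix_inv A = mat 1" "matrix_inv A ** A = mat 1"
proof -
  have "A ** matrix_inv A = mat 1 \<and> matrix_inv A ** A = mat 1"
    unfolding matrix_inv_def by (rule someI_ex) (use assms in \<open>simp add: invertible_def\<close>)
  then show "A ** matrix_inv A = mat 1" "matrix_inv A ** A = mat 1" by auto
qed

lemma matrix_inv_unique: "A ** B = mat 1 \<Longrightarrow> matrix_inv A = (B :: complex^'m^'m)"
proof -
  assume "A ** B = mat 1"
  moreover from this have "B ** A = mat 1" by (simp add: matrix_left_right_inverse)
  ultimately have "invertible A" by (auto simp: invertible_def)
  have "matrix_inv A = matrix_inv A ** (A ** B)" using \<open>A ** B = mat 1\<close> by simp
  also have "\<dots> = B" unfolding matrix_mul_assoc matrix_inv(2)[OF \<open>invertible A\<close>] by simp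
  finally show ?thesis .
qed

lemma mpow_0 [simp]: "mpow A 0 = mat 1"
  by (simp add: mpow_def)

lemma mpow_Suc: "mpow A (Suc n) = A ** mpow A n"
  by (simp add: mpow_def)

lemma mpowi_0 [simp]: "mpowi A 0 = mat 1"
  by (simp add: mpowi_def)

lemma mpowi_1 [simp]: "mpowi A 1 = A"
  by (simp add: mpowi_def mpow_def One_nat_def)

lemma mpowi_m1: "mpowi A (- 1) = matrix_inv A"
  by (simp add: mpowi_def mpow_def One_nat_def)

lemma mpowi_plus1:
  assumes "invertible (A :: complex^'m^'m)"
  shows "mpowi A (k + 1) = A ** mpowi A k"
proof (cases "k \<ge> 0")
  case True
  then have "nat (k + 1) = Suc (nat k)" by simp
  then show ?thesis using True by (simp add: mpowi_def mpow_Suc)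
next
  case False
  define n where "n = nat (- (k + 1))"
  have n: "nat (- k) = Suc n" using False by (simp add: n_def)
  have "A ** mpowi A k = (A ** matrix_inv A) ** mpow (matrix_inv A) n"
    using False by (simp add: mpowi_def n mpow_Suc matrix_mul_assoc)
  also have "\<dots> = mpow (matrix_inv A) n" using assms by (simp add: matrix_inv)
  also have "\<dots> = mpowi A (k + 1)" using False by (cases "k = -1") (auto simp: mpowi_def n_def)
  finally show ?thesis ..
qed

lemma mpowi_add:
  assumes "invertible (A :: complex^'m^'m)"
  shows "mpowi A (j + k) = mpowi A j ** mpowi A k"
proof (induction j rule: int_induct[of _ 0])
  case (step1 j)
  have "mpowi A (j + 1 + k) = A ** mpowi A (j + k)"
    using mpowi_plus1[OF assms, of "j + k"] by (simp add: add_ac)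
  then show ?case using step1 by (simp add: mpowi_plus1[OF assms] matrix_mul_assoc)
next
  case (step2 j)
  have "A ** mpowi A (j - 1 + k) = mpowi A (j + k)" "A ** mpowi A (j - 1) = mpowi A j"
    using mpowi_plus1[OF assms, of "j - 1 + k"] mpowi_plus1[OF assms, of "j - 1"] by (simp_all add: add_ac)
  then have "A ** mpowi A (j - 1 + k) = A ** (mpowi A (j - 1) ** mpowi A k)"
    using step2 by (simp add: matrix_mul_assoc)
  then have "matrix_inv A ** (A ** mpowi A (j - 1 + k)) = matrix_inv A ** (A ** (mpowi A (j - 1) ** mpowi A k))"
    by simp
  then show ?case unfolding matrix_mul_assoc matrix_inv(2)[OF assms] by simp
qed simp

section \<open>Evaluation as an algebra homomorphism\<close>

definition meval :: "tmono \<Rightarrow> complex^'m^'m \<Rightarrow> complex^'m^'m" where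
  "meval x A = mscale (\<Prod>j\<in>keys (snd x). ntr (mpowi A (int_of_nz j)) ^ lookup (snd x) j) (mpowi A (fst x))"

lemma tp_eval_superset:
  assumes "finite S" "keys P \<subseteq> S"
  shows "tp_eval P A = (\<Sum>x\<in>S. mscale (lookup P x) (meval x A))"
proof -
  have "tp_eval P A = (\<Sum>x\<in>keys P. mscale (lookup P x) (meval x A))"
    unfolding tp_eval_def meval_def by (intro sum.cong) auto
  also have "\<dots> = (\<Sum>x\<in>S. mscale (lookup P x) (meval x A))"
    using assms by (intro sum.mono_neutral_left) (auto simp: in_keys_iff)
  finally show ?thesis .
qed

lemma tp_eval_mono: "tp_eval (monomial x) A = meval x A"
  by (subst tp_eval_superset[of "{x}"]) auto

lemma tp_eval_add: "tp_eval (P + Q) A = tp_eval P A + tp_eval Q A"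
  using keys_add[of P Q]
  by (simp add: tp_eval_superset[of "keys P \<union> keys Q"] lookup_add mscale_add_left sum.distrib)

lemma tp_eval_scl: "tp_eval (scl c P) A = mscale c (tp_eval P A)"
proof -
  have "keys (scl c P) \<subseteq> keys P" by (auto simp: in_keys_iff)
  then show ?thesis by (simp add: tp_eval_superset[of "keys P"] mscale_sum)
qed

lemma tp_eval_0 [simp]: "tp_eval 0 A = 0"
  using tp_eval_scl[of 0 0 A] by simp

lemma tp_eval_uminus: "tp_eval (- P) A = - tp_eval P A"
  using tp_eval_scl[of "-1" P A] by (simp add: scl_uminus_left mscale_uminus_left)

lemma tp_eval_diff: "tp_eval (P - Q) A = tp_eval P A - tp_eval Q A"
  using tp_eval_add[of P "- Q" A] by (simp add: tp_eval_uminus)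

lemma tp_eval_sum: "tp_eval (sum f I) A = (\<Sum>i\<in>I. tp_eval (f i) A)"
  by (induction I rule: infinite_finite_induct) (auto simp: tp_eval_add)

lemma tp_eval_of_int_mult: "tp_eval (of_int k * P) A = mscale (of_int k) (tp_eval P A)"
  by (simp add: of_int_mult_eq_scl tp_eval_scl)

lemma tp_eval_numeral_mult: "tp_eval (numeral k * P) A = mscale (numeral k) (tp_eval P A)"
  by (simp add: numeral_mult_eq_scl tp_eval_scl)

lemmas tp_eval_linear = tp_eval_add tp_eval_scl tp_eval_uminus tp_eval_diff tp_eval_sum
  tp_eval_of_int_mult tp_eval_numeral_mult

lemma meval_add:
  assumes "invertible A"
  shows "meval (x + y) A = meval x A ** meval y A"
proof -
  let ?S = "keys (snd x) \<union> keys (snd y)"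
  let ?t = "\<lambda>j. ntr (mpowi A (int_of_nz j))"
  have *: "(\<Prod>j\<in>keys m. ?t j ^ lookup m j) = (\<Prod>j\<in>?S. ?t j ^ lookup m j)" if "keys m \<subseteq> ?S" for m
    using that by (intro prod.mono_neutral_left) (auto simp: in_keys_iff)
  have "(\<Prod>j\<in>keys (snd (x + y)). ?t j ^ lookup (snd (x + y)) j) =
     (\<Prod>j\<in>keys (snd x). ?t j ^ lookup (snd x) j) * (\<Prod>j\<in>keys (snd y). ?t j ^ lookup (snd y) j)"
  proof -
    have "keys (snd (x + y)) \<subseteq> ?S" by (simp add: keys_add)
    from *[OF this] *[of "snd x"] *[of "snd y"] show ?thesis
      by (simp add: lookup_add power_add prod.distrib)
  qed
  then show ?thesis
    by (simp add: meval_def mpowi_add[OF assms] mscale_matrix_mult mult.commute)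
qed

text \<open>Invertibility makes \<open>mpowi A\<close> a homomorphism on the integers; all factors
  are then scalars times powers of the one matrix \<open>A\<close>, which commute.\<close>

lemma tp_eval_mult:
  assumes "invertible A"
  shows "tp_eval (P * Q) A = tp_eval P A ** tp_eval Q A"
proof (induction P rule: tpoly_mono_induct)
  case (monomial x)
  show ?case
  proof (induction Q rule: tpoly_mono_induct)
    case (monomial y)
    then show ?case by (simp add: mult_single tp_eval_mono meval_add[OF assms])
  qed (simp_all add: distrib_left tp_eval_add tp_eval_scl matrix_mult.add_right mscale_matrix_mult)
qed (simp_all add: distrib_right tp_eval_add tp_eval_scl matrix_mult.add_left mscale_matrix_mult)

lemma tp_eval_u_pow: "tp_eval (u_pow k) A = mpowi A k"
  by (simp add: u_pow_def tp_eval_mono meval_def)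

lemma tp_eval_1 [simp]: "tp_eval 1 A = mat 1"
  using tp_eval_u_pow[of 0 A] by simp

lemma tp_eval_v_var: "tp_eval (v_var k) A = mat (ntr (mpowi A k))"
  by (cases "k = 0") (simp_all add: v_var_mono tp_eval_mono meval_def mat_eq_mscale[of "ntr _"])

lemma tp_eval_v_mult: "invertible A \<Longrightarrow> tp_eval (v_var k * P) A = mscale (ntr (mpowi A k)) (tp_eval P A)"
  by (simp add: tp_eval_mult tp_eval_v_var mat_mult)

section \<open>The matrix exponential\<close>

text \<open>A matrix is the finite sum of its entries under linear embeddings of the complex
  numbers, so entrywise differentiability suffices.\<close>

lemma has_vector_derivative_matrixI:
  fixes f :: "real \<Rightarrow> complex^'m^'m"
  assumes "\<And>i j. ((\<lambda>t. f t $ i $ j) has_vector_derivative D $ i $ j) (at x)"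
  shows "(f has_vector_derivative D) (at x)"
proof -
  define L :: "'m \<Rightarrow> 'm \<Rightarrow> complex \<Rightarrow> complex^'m^'m"
    where "L i j c = (\<chi> p q. if p = i \<and> q = j then c else 0)" for i j c
  have "bounded_linear (L i j)" for i j
    unfolding linear_conv_bounded_linear[symmetric]
    by (auto intro!: linearI simp: L_def vec_eq_iff)
  then have "((\<lambda>t. \<Sum>i\<in>UNIV. \<Sum>j\<in>UNIV. L i j (f t $ i $ j)) has_vector_derivative
      (\<Sum>i\<in>UNIV. \<Sum>j\<in>UNIV. L i j (D $ i $ j))) (at x)"
    by (intro has_vector_derivative_sum bounded_linear.has_vector_derivative[OF _ assms])
  moreover have "(\<Sum>i\<in>UNIV. \<Sum>j\<in>UNIV. L i j (M $ i $ j)) = M" for M :: "complex^'m^'m"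
  proof -
    have "(\<Sum>i\<in>UNIV. \<Sum>j\<in>UNIV. if p = i \<and> q = j then M $ i $ j else 0) = M $ p $ q" for p q
      by (subst sum.cong[OF refl, of _ _ "\<lambda>i. if p = i then M $ i $ q else 0"]) (auto simp: sum.delta)
    then show ?thesis by (simp add: vec_eq_iff L_def)
  qed
  ultimately show ?thesis by simp
qed

lemma sums_matrixI:
  fixes f :: "nat \<Rightarrow> complex^'m^'m"
  assumes "\<And>i j. (\<lambda>n. f n $ i $ j) sums (S $ i $ j)"
  shows "f sums S"
  unfolding sums_def
proof (rule vec_tendstoI, rule vec_tendstoI)
  fix i j
  show "(\<lambda>n. (\<Sum>k<n. f k) $ i $ j) \<longlonglongrightarrow> S $ i $ j"
    using assms[of i j] by (simp add: sums_def sum_component)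
qed

lemma mpow_entry_bound: "\<exists>K\<ge>0. \<forall>n i j. cmod (mpow X n $ i $ j) \<le> K ^ n"
proof (intro exI conjI allI)
  \<comment> \<open>The sum over all entries dominates every row sum, so the bound multiplies along
    powers.\<close>
  define K where "K = (\<Sum>i\<in>UNIV. \<Sum>k\<in>UNIV. cmod (X $ i $ k))"
  show K: "K \<ge> 0" by (simp add: K_def sum_nonneg)
  show "cmod (mpow X n $ i $ j) \<le> K ^ n" for n i j
  proof (induction n arbitrary: i)
    case (Suc n)
    have "cmod (mpow X (Suc n) $ i $ j) \<le> (\<Sum>k\<in>UNIV. cmod (X $ i $ k) * cmod (mpow X n $ k $ j))"
      by (simp add: mpow_Suc matrix_matrix_mult_def sum_norm_le norm_mult)
    also have "\<dots> \<le> (\<Sum>k\<in>UNIV. cmod (X $ i $ k) * K ^ n)"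
      by (intro sum_mono mult_left_mono Suc) auto
    also have "\<dots> = (\<Sum>k\<in>UNIV. cmod (X $ i $ k)) * K ^ n" by (simp add: sum_distrib_right)
    also have "\<dots> \<le> K * K ^ n"
      unfolding K_def
      by (intro mult_right_mono member_le_sum[of i UNIV "\<lambda>i. \<Sum>k\<in>UNIV. cmod (X $ i $ k)"])
        (auto intro!: sum_nonneg zero_le_power)
    finally show ?case by simp
  qed (simp add: mat_def)
qed

text \<open>Coefficients of one entry of exp(tX) as a scalar power series in t, to which termwise
  differentiation applies.\<close>

definition mexp_coeff :: "complex^'m^'m \<Rightarrow> 'm \<Rightarrow> 'm \<Rightarrow> nat \<Rightarrow> complex" where
  "mexp_coeff X i j n = mpow X n $ i $ j / fact n"

lemma summable_mexp_coeff: "summable (\<lambda>n. mexp_coeff X i j n * z ^ n)"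
proof -
  obtain K where K: "K \<ge> 0" "cmod (mpow X n $ i $ j) \<le> K ^ n" for n i j
    using mpow_entry_bound[of X] by auto
  show ?thesis
  proof (rule summable_comparison_test')
    show "summable (\<lambda>n. inverse (fact n) * (K * cmod z) ^ n)" by (rule summable_exp)
    show "norm (mexp_coeff X i j n * z ^ n) \<le> inverse (fact n) * (K * cmod z) ^ n" for n
      using mult_right_mono[OF K(2)[of n i j], of "cmod z ^ n / fact n"]
      by (simp add: mexp_coeff_def norm_mult norm_divide norm_power power_mult_distrib field_simps)
  qed
qed

lemma mpow_scaleR: "mpow (t *\<^sub>R X) n = t ^ n *\<^sub>R mpow (X :: complex^'m^'m) n"
  by (induction n) (simp_all add: mpow_Suc matrix_mult.scaleR_left matrix_mult.scaleR_right)

lemma mexp_sums: "(\<lambda>n. (1 / fact n) *\<^sub>R mpow (t *\<^sub>R X) n) sums mexp (t *\<^sub>R X)"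
  and mexp_entry: "mexp (t *\<^sub>R X) $ i $ j = suminf (\<lambda>n. mexp_coeff X i j n * of_real t ^ n)"
proof -
  define E where "E = (\<chi> i j. suminf (\<lambda>n. mexp_coeff X i j n * of_real t ^ n))"
  have E: "(\<lambda>n. (1 / fact n) *\<^sub>R mpow (t *\<^sub>R X) n) sums E"
  proof (rule sums_matrixI)
    fix i j
    have "((1 / fact n) *\<^sub>R mpow (t *\<^sub>R X) n) $ i $ j = mexp_coeff X i j n * of_real t ^ n" for n
      by (simp add: mpow_scaleR mexp_coeff_def scaleR_conv_of_real[where 'a=complex] field_simps)
    then show "(\<lambda>n. ((1 / fact n) *\<^sub>R mpow (t *\<^sub>R X) n) $ i $ j) sums (E $ i $ j)"
      by (simp add: E_def summable_sums summable_mexp_coeff)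
  qed
  then have "mexp (t *\<^sub>R X) = E" unfolding mexp_def by (rule sums_unique[symmetric])
  with E show "(\<lambda>n. (1 / fact n) *\<^sub>R mpow (t *\<^sub>R X) n) sums mexp (t *\<^sub>R X)"
    and "mexp (t *\<^sub>R X) $ i $ j = suminf (\<lambda>n. mexp_coeff X i j n * of_real t ^ n)"
    by (simp_all add: E_def)
qed

lemma mexp_0 [simp]: "mexp 0 = (mat 1 :: complex^'m^'m)"
proof -
  have "mexp_coeff 0 i j 0 = mat 1 $ i $ j" for i j :: 'm
    by (simp add: mexp_coeff_def)
  then show ?thesis
    using mexp_entry[of 0 "0 :: complex^'m^'m"] by (simp add: vec_eq_iff powser_zero)
qed

lemma mexp_has_vector_derivative:
  "((\<lambda>t. mexp (t *\<^sub>R X)) has_vector_derivative X ** mexp (t *\<^sub>R X)) (at t)"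
proof (rule has_vector_derivative_matrixI)
  fix i j
  \<comment> \<open>\<open>diffs\<close> shifts the series by one place; the additional factor of
    the power is split off as a matrix product with \<open>X\<close>.\<close>
  have d: "diffs (mexp_coeff X i j) n = (\<Sum>k\<in>UNIV. X $ i $ k * mexp_coeff X k j n)" for n
  proof -
    have "diffs (mexp_coeff X i j) n = mpow X (Suc n) $ i $ j / fact n"
      by (simp add: diffs_def mexp_coeff_def del: of_nat_Suc)
    then show ?thesis
      by (simp add: mexp_coeff_def mpow_Suc matrix_matrix_mult_def sum_divide_distrib)
  qed
  have "((\<lambda>z. suminf (\<lambda>n. mexp_coeff X i j n * z ^ n)) has_field_derivative
      suminf (\<lambda>n. diffs (mexp_coeff X i j) n * of_real t ^ n)) (at (of_real t))"
    by (rule termdiffs_strong_converges_everywhere[OF summable_mexp_coeff])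
  also have "suminf (\<lambda>n. diffs (mexp_coeff X i j) n * of_real t ^ n) =
      suminf (\<lambda>n. \<Sum>k\<in>UNIV. X $ i $ k * (mexp_coeff X k j n * of_real t ^ n))"
    unfolding d sum_distrib_right by (simp add: mult.assoc)
  also have "\<dots> = (\<Sum>k\<in>UNIV. suminf (\<lambda>n. X $ i $ k * (mexp_coeff X k j n * of_real t ^ n)))"
    by (rule suminf_sum) (intro summable_mult summable_mexp_coeff)
  also have "\<dots> = (\<Sum>k\<in>UNIV. X $ i $ k * mexp (t *\<^sub>R X) $ k $ j)"
    by (simp add: mexp_entry suminf_mult summable_mexp_coeff)
  also have "\<dots> = (X ** mexp (t *\<^sub>R X)) $ i $ j"
    by (simp add: matrix_matrix_mult_def)
  finally show "((\<lambda>t. mexp (t *\<^sub>R X) $ i $ j) has_vector_derivative (X ** mexp (t *\<^sub>R X)) $ i $ j) (at t)"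
    unfolding mexp_entry by (rule has_vector_derivative_real_field)
qed

text \<open>The relation passes to powers and so to the series. It serves twice:
  \<open>M = X\<close> gives commutation with the exponential, and \<open>M\<close> a bilinear form
  gives its invariance under the flow.\<close>

lemma mexp_intertwine:
  fixes M :: "complex^'m^'m"
  assumes "Y ** M = M ** Z"
  shows "mexp Y ** M = M ** mexp Z"
proof -
  have "mpow Y n ** M = M ** mpow Z n" for n
  proof (induction n)
    case (Suc n)
    have "mpow Y (Suc n) ** M = Y ** (mpow Y n ** M)" by (simp add: mpow_Suc matrix_mul_assoc)
    also have "\<dots> = (Y ** M) ** mpow Z n" by (simp add: Suc matrix_mul_assoc)
    finally show ?case by (simp add: assms mpow_Suc matrix_mul_assoc)
  qed simp
  then have "((1 / fact n) *\<^sub>R mpow Y n) ** M = M ** ((1 / fact n) *\<^sub>R mpow Z n)" for n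
    by (simp add: matrix_mult.scaleR_left matrix_mult.scaleR_right)
  moreover have "(\<lambda>n. ((1 / fact n) *\<^sub>R mpow Y n) ** M) sums (mexp Y ** M)"
    "(\<lambda>n. M ** ((1 / fact n) *\<^sub>R mpow Z n)) sums (M ** mexp Z)"
    using mexp_sums[of 1 Y] mexp_sums[of 1 Z]
    by (auto intro: bounded_linear.sums[OF matrix_mult.bounded_linear_left]
        bounded_linear.sums[OF matrix_mult.bounded_linear_right])
  ultimately show ?thesis using sums_unique2 by force
qed

lemma mexp_commute: "mexp (t *\<^sub>R X) ** X = X ** mexp (t *\<^sub>R X)"
  by (rule mexp_intertwine) (simp add: matrix_mult.scaleR_left matrix_mult.scaleR_right)

lemma constant_if_vector_derivative_0:
  fixes f :: "real \<Rightarrow> 'a::real_normed_vector"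
  assumes "\<And>t. (f has_vector_derivative 0) (at t)"
  shows "f s = f t"
proof -
  have "\<exists>c. \<forall>x\<in>UNIV. f x = c"
    by (rule has_vector_derivative_zero_constant[of UNIV f]) (auto simp: assms)
  then show ?thesis by auto
qed

text \<open>The left side has derivative 0 in s, because \<open>X\<close> commutes with its
  exponentials; s = 0 gives the value.\<close>

lemma mexp_add: "mexp ((s + t) *\<^sub>R X) ** mexp ((- s) *\<^sub>R X) = mexp (t *\<^sub>R X)"
proof -
  let ?F = "\<lambda>s. mexp ((s + t) *\<^sub>R X) ** mexp (s *\<^sub>R (- X))"
  have "(?F has_vector_derivative 0) (at s)" for s
  proof -
    have "((\<lambda>s. mexp ((s + t) *\<^sub>R X)) has_vector_derivative X ** mexp ((s + t) *\<^sub>R X)) (at s)"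
      using vector_diff_chain_at[of "\<lambda>s. s + t" 1 s "\<lambda>t. mexp (t *\<^sub>R X)", OF _ mexp_has_vector_derivative]
      using has_vector_derivative_add_const[of "\<lambda>s. s" t 1 "at s"] by (simp add: comp_def)
    from matrix_mult.has_vector_derivative[OF this mexp_has_vector_derivative]
    have "(?F has_vector_derivative
        (mexp ((s + t) *\<^sub>R X) ** (- X ** mexp (s *\<^sub>R (- X))) + (X ** mexp ((s + t) *\<^sub>R X)) ** mexp (s *\<^sub>R (- X)))) (at s)" .
    also have "mexp ((s + t) *\<^sub>R X) ** (- X ** mexp (s *\<^sub>R (- X))) = - (X ** mexp ((s + t) *\<^sub>R X)) ** mexp (s *\<^sub>R (- X))"
      by (simp add: matrix_mult.minus_left matrix_mult.minus_right matrix_mul_assoc mexp_commute)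
    finally show ?thesis by (simp add: matrix_mult.minus_left)
  qed
  from constant_if_vector_derivative_0[of ?F s 0, OF this] show ?thesis by simp
qed

lemma mexp_inverse: "mexp (t *\<^sub>R X) ** mexp ((- t) *\<^sub>R X) = mat 1"
  using mexp_add[of t 0 X] by simp

section \<open>Derivatives along one-parameter subgroups\<close>

lemma invertible_mexp: "invertible (mexp (t *\<^sub>R X))"
  using mexp_inverse[of t X] mexp_inverse[of "- t" X] unfolding invertible_def by auto

lemma invertible_mult_mexp: "invertible A \<Longrightarrow> invertible (A ** mexp (t *\<^sub>R X))"
  by (rule invertible_mult[OF _ invertible_mexp])

text \<open>The base points are all invertible matrices rather than a group: this set is stable
  under the flow of every \<open>X\<close>, so \<open>f'\<close> can be differentiated again, and
  \<open>matrix_inv\<close> is a true inverse on it.\<close>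

definition flow_deriv ::
    "complex^'m^'m \<Rightarrow> (complex^'m^'m \<Rightarrow> complex^'m^'m) \<Rightarrow> (complex^'m^'m \<Rightarrow> complex^'m^'m) \<Rightarrow> bool" where
  "flow_deriv X f f' \<longleftrightarrow> (\<forall>A. invertible A \<longrightarrow>
     ((\<lambda>t. f (A ** mexp (t *\<^sub>R X))) has_vector_derivative f' A) (at 0))"

lemma flow_deriv_const: "flow_deriv X (\<lambda>A. C) (\<lambda>A. 0)"
  by (simp add: flow_deriv_def)

lemma flow_deriv_add:
  "flow_deriv X f f' \<Longrightarrow> flow_deriv X g g' \<Longrightarrow> flow_deriv X (\<lambda>A. f A + g A) (\<lambda>A. f' A + g' A)"
  by (auto simp: flow_deriv_def intro: has_vector_derivative_add)

lemma flow_deriv_uminus: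
  "flow_deriv X f f' \<Longrightarrow> flow_deriv X (\<lambda>A. - f A) (\<lambda>A. - f' A)"
  by (auto simp: flow_deriv_def intro: has_vector_derivative_minus)

lemma flow_deriv_bounded_linear:
  "bounded_linear L \<Longrightarrow> flow_deriv X f f' \<Longrightarrow> flow_deriv X (\<lambda>A. L (f A)) (\<lambda>A. L (f' A))"
  by (auto simp: flow_deriv_def intro: bounded_linear.has_vector_derivative)

lemma flow_deriv_mult:
  assumes "flow_deriv X f f'" "flow_deriv X g g'"
  shows "flow_deriv X (\<lambda>A. f A ** g A) (\<lambda>A. f' A ** g A + f A ** g' A)"
  unfolding flow_deriv_def
proof safe
  fix A :: "complex^'a^'a" assume "invertible A"
  with assms have "((\<lambda>t. f (A ** mexp (t *\<^sub>R X))) has_vector_derivative f' A) (at 0)"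
    "((\<lambda>t. g (A ** mexp (t *\<^sub>R X))) has_vector_derivative g' A) (at 0)"
    by (auto simp: flow_deriv_def)
  from matrix_mult.has_vector_derivative[OF this]
  show "((\<lambda>t. f (A ** mexp (t *\<^sub>R X)) ** g (A ** mexp (t *\<^sub>R X))) has_vector_derivative
      f' A ** g A + f A ** g' A) (at 0)"
    by (simp add: add.commute)
qed

lemma flow_deriv_id: "flow_deriv X (\<lambda>A. A) (\<lambda>A. A ** X)"
  unfolding flow_deriv_def
proof safe
  fix A :: "complex^'a^'a"
  show "((\<lambda>t. A ** mexp (t *\<^sub>R X)) has_vector_derivative A ** X) (at 0)"
    using bounded_linear.has_vector_derivative[OF matrix_mult.bounded_linear_right mexp_has_vector_derivative[of X 0], of A]
    by simp
qed

text \<open>The inverse of A exp(tX) is exp(-tX) times the inverse of A, so \<open>X\<close> enters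
  on the left, unlike in \<open>flow_deriv_id\<close>.\<close>

lemma flow_deriv_matrix_inv: "flow_deriv X matrix_inv (\<lambda>A. - (X ** matrix_inv A))"
  unfolding flow_deriv_def
proof safe
  fix A :: "complex^'a^'a" assume A: "invertible A"
  have "matrix_inv (A ** mexp (t *\<^sub>R X)) = mexp (t *\<^sub>R (- X)) ** matrix_inv A" for t
  proof (rule matrix_inv_unique)
    have "A ** mexp (t *\<^sub>R X) ** (mexp (t *\<^sub>R - X) ** matrix_inv A) =
        A ** (mexp (t *\<^sub>R X) ** mexp ((- t) *\<^sub>R X)) ** matrix_inv A"
      by (simp add: matrix_mul_assoc)
    then show "A ** mexp (t *\<^sub>R X) ** (mexp (t *\<^sub>R - X) ** matrix_inv A) = mat 1"
      unfolding mexp_inverse using matrix_inv[OF A] by simp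
  qed
  then show "((\<lambda>t. matrix_inv (A ** mexp (t *\<^sub>R X))) has_vector_derivative - (X ** matrix_inv A)) (at 0)"
    using bounded_linear.has_vector_derivative[OF matrix_mult.bounded_linear_left mexp_has_vector_derivative[of "- X" 0], of "matrix_inv A"]
    by (simp add: matrix_mult.minus_left)
qed

lemma flow_deriv_cong:
  assumes "flow_deriv X f f'" "\<And>A. invertible A \<Longrightarrow> g A = f A"
  shows "flow_deriv X g f'"
  using assms by (simp add: flow_deriv_def invertible_mult_mexp)

lemma lie_deriv_eq: "flow_deriv X f f' \<Longrightarrow> invertible A \<Longrightarrow> lie_deriv X f A = f' A"
  by (auto simp: flow_deriv_def lie_deriv_def intro: vector_derivative_at)

lemma laplacian_eq:
  assumes "\<And>X. X \<in> B \<Longrightarrow> flow_deriv X f (f1 X)" "\<And>X. X \<in> B \<Longrightarrow> flow_deriv X (f1 X) (f2 X)" "invertible A"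
  shows "laplacian B f A = (\<Sum>X\<in>B. f2 X A)"
  unfolding laplacian_def
proof (rule sum.cong)
  fix X assume X: "X \<in> B"
  \<comment> \<open>\<open>lie_deriv X f\<close> is known to agree with \<open>f1 X\<close> at
    invertible matrices only, which suffices as the flow does not leave them.\<close>
  have "flow_deriv X (lie_deriv X f) (f2 X)"
    using assms(2)[OF X] lie_deriv_eq[OF assms(1)[OF X]] by (rule flow_deriv_cong)
  then show "lie_deriv X (lie_deriv X f) A = f2 X A" using assms(3) by (rule lie_deriv_eq)
qed simp

lemma bounded_linear_mat_ntr: "bounded_linear (\<lambda>A :: complex^'m^'m. mat (ntr A) :: complex^'m^'m)"
  unfolding mat_eq_mscale[of "ntr _"]
  by (rule bounded_linear_compose[OF bounded_linear_mscale_left bounded_linear_ntr])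

lemma mscale_2: "mscale 2 A = A + A"
  by (simp add: vec_eq_iff)

section \<open>The intertwining identity\<close>

context contraction_constants
begin

definition contr2 :: "int \<Rightarrow> tpoly" where
  "contr2 k = scl \<epsilon> (u_pow (- k)) - scl \<delta> (u_pow k) + scl \<gamma> (v_var k)"

text \<open>One more position raises the multiplicity of each distance by one: the new pairs join
  position n + 1 to a position l, at distance n - l + 1, and leave l factors outside. The sign s
  treats positive and negative powers together.\<close>

lemma Dop_u_pow_Suc:
  assumes "s = 1 \<or> s = -1"
  shows "Dop (u_pow (s * int (Suc n))) = u_pow s * Dop (u_pow (s * int n))
    + 2 * (\<Sum>l\<in>{1..n}. u_pow (s * int l) * contr (s * (int n - int l + 1)))
    + u_pow (s * int (Suc n)) * contr 0"
proof -
  have *: "Dop (u_pow (s * int n)) = of_nat n * (u_pow (s * int n) * contr 0)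
     + 2 * (\<Sum>d\<in>{1..<n}. (of_nat n - of_nat d) * (u_pow (s * (int n - int d)) * contr (s * int d)))" for n
  proof -
    have "(\<Sum>d\<in>tail (s * int n). of_int \<bar>s * int n - d\<bar> * (u_pow (s * int n - d) * contr d)) =
      (\<Sum>d\<in>{1..<n}. (of_nat n - of_nat d) * (u_pow (s * (int n - int d)) * contr (s * int d)))"
      using assms
    proof
      assume s: "s = 1"
      show ?thesis unfolding s mult_1 tail_int by (subst sum.reindex) (auto intro!: sum.cong)
    next
      assume s: "s = -1"
      show ?thesis unfolding s mult_minus1 tail_int by (subst sum.reindex) (auto intro!: sum.cong simp: inj_on_def)
    qed
    moreover have "of_int \<bar>s * int n\<bar> = (of_nat n :: tpoly)" using assms by auto
    ultimately show ?thesis unfolding Dop_u_pow by simp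
  qed
  have us: "u_pow (s * (int (Suc n) - d)) = u_pow s * u_pow (s * (int n - d))" for d
    by (simp add: algebra_simps flip: u_pow_add)
  have "(\<Sum>d\<in>{1..<Suc n}. (of_nat (Suc n) - of_nat d) * (u_pow (s * (int (Suc n) - int d)) * contr (s * int d)))
     = (\<Sum>d\<in>{1..<Suc n}. (of_nat n - of_nat d) * (u_pow (s * (int (Suc n) - int d)) * contr (s * int d)))
      + (\<Sum>d\<in>{1..<Suc n}. u_pow (s * (int (Suc n) - int d)) * contr (s * int d))"
    unfolding sum.distrib[symmetric] by (intro sum.cong) (auto simp: algebra_simps)
  \<comment> \<open>The added index d = n has weight 0.\<close>
  also have "(\<Sum>d\<in>{1..<Suc n}. (of_nat n - of_nat d) * (u_pow (s * (int (Suc n) - int d)) * contr (s * int d))) =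
      (\<Sum>d\<in>{1..<n}. (of_nat n - of_nat d) * (u_pow (s * (int (Suc n) - int d)) * contr (s * int d)))"
    by (cases "n = 0") (auto simp: sum.atLeastLessThan_Suc)
  also have "\<dots> = u_pow s * (\<Sum>d\<in>{1..<n}. (of_nat n - of_nat d) * (u_pow (s * (int n - int d)) * contr (s * int d)))"
    unfolding sum_distrib_left by (intro sum.cong refl) (simp only: us mult.assoc mult.left_commute[of "u_pow s"])
  also have "(\<Sum>d\<in>{1..<Suc n}. u_pow (s * (int (Suc n) - int d)) * contr (s * int d)) =
      (\<Sum>l\<in>{1..n}. u_pow (s * int l) * contr (s * (int n - int l + 1)))"
    by (rule sum.reindex_bij_witness[of _ "\<lambda>d. Suc n - d" "\<lambda>d. Suc n - d"]) (auto simp: of_nat_diff algebra_simps)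
  finally have S: "(\<Sum>d\<in>{1..<Suc n}. (of_nat (Suc n) - of_nat d) * (u_pow (s * (int (Suc n) - int d)) * contr (s * int d))) =
    u_pow s * (\<Sum>d\<in>{1..<n}. (of_nat n - of_nat d) * (u_pow (s * (int n - int d)) * contr (s * int d)))
    + (\<Sum>l\<in>{1..n}. u_pow (s * int l) * contr (s * (int n - int l + 1)))" .
  have u: "u_pow (s * int (Suc n)) = u_pow s * u_pow (s * int n)"
    by (simp add: algebra_simps flip: u_pow_add)
  show ?thesis unfolding *[of "Suc n"] S unfolding *[of n] unfolding u by (simp add: algebra_simps)
qed

end

text \<open>Everything that the intertwining identity uses about the group and the basis.\<close>

locale contraction_basis = contraction_constants +
  fixes B G :: "(complex^'m^'m) set"
  assumes inv: "A \<in> G \<Longrightarrow> invertible A"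
    and contr_eval: "A \<in> G \<Longrightarrow> (\<Sum>X\<in>B. X ** mpowi A k ** X) = tp_eval (contr k) A"
    and contr2_eval: "A \<in> G \<Longrightarrow> (\<Sum>X\<in>B. mscale (ntr (mpowi A k ** X)) X) = tp_eval (contr2 k) A"
begin

text \<open>Derivatives are required at every invertible matrix, contractions only on
  \<open>G\<close>. In the trace clause all insertion positions of \<open>X\<close> agree by
  cyclicity, whence the factor \<open>a\<close>; in the next clause they agree because the
  contracted matrix commutes with powers of \<open>A\<close>.\<close>

definition power_derivs ::
    "int \<Rightarrow> (complex^'m^'m \<Rightarrow> complex^'m^'m \<Rightarrow> complex^'m^'m) \<Rightarrow> (complex^'m^'m \<Rightarrow> complex^'m^'m \<Rightarrow> complex^'m^'m) \<Rightarrow> bool" where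
  "power_derivs a f1 f2 \<longleftrightarrow>
     (\<forall>X. flow_deriv X (\<lambda>A. mpowi A a) (f1 X) \<and> flow_deriv X (f1 X) (f2 X)) \<and>
     (\<forall>X A i. invertible A \<longrightarrow> ntr (f1 X A ** mpowi A i) = of_int a * ntr (mpowi A (a + i) ** X)) \<and>
     (\<forall>A\<in>G. \<forall>j. (\<Sum>X\<in>B. mscale (ntr (mpowi A j ** X)) (f1 X A)) = tp_eval (of_int a * (u_pow a * contr2 j)) A) \<and>
     (\<forall>A\<in>G. (\<Sum>X\<in>B. f2 X A) = tp_eval (Dop (u_pow a)) A)"

lemma sum_mult_left:
  fixes f :: "complex^'m^'m \<Rightarrow> complex^'m^'m"
  shows "(\<Sum>X\<in>B. C ** f X) = (C :: complex^'m^'m) ** (\<Sum>X\<in>B. f X)"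
  by (rule matrix_mult.sum_right[symmetric])

lemma sum_mult_right:
  fixes f :: "complex^'m^'m \<Rightarrow> complex^'m^'m"
  shows "(\<Sum>X\<in>B. f X ** C) = (\<Sum>X\<in>B. f X) ** (C :: complex^'m^'m)"
  by (rule matrix_mult.sum_left[symmetric])

text \<open>The last conjunct strengthens the induction. The second derivative of the next power
  needs the cross sum with i = 1, and the step for the cross sum itself moves the new factor
  \<open>A\<close> into the exponent, from i to 1 + i; hence i is arbitrary.\<close>

lemma ex_power_derivs_nonneg:
  "\<exists>f1 f2. power_derivs (int n) f1 f2 \<and>
     (\<forall>A\<in>G. \<forall>i. (\<Sum>X\<in>B. f1 X A ** mpowi A i ** X) = tp_eval (\<Sum>l\<in>{1..n}. u_pow (int l) * contr (int n - int l + i)) A)"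
proof (induction n)
  case 0
  show ?case
    by (rule exI[of _ "\<lambda>X A. 0"], rule exI[of _ "\<lambda>X A. 0"])
      (simp add: power_derivs_def flow_deriv_const ntr_def trace_def)
next
  case (Suc n)
  then obtain f1 f2 where pd: "power_derivs (int n) f1 f2" and
    h: "\<And>A i. A \<in> G \<Longrightarrow> (\<Sum>X\<in>B. f1 X A ** mpowi A i ** X) = tp_eval (\<Sum>l\<in>{1..n}. u_pow (int l) * contr (int n - int l + i)) A"
    by blast
  have d1: "flow_deriv X (\<lambda>A. mpowi A (int n)) (f1 X)" and d2: "flow_deriv X (f1 X) (f2 X)"
    and t: "\<And>A i. invertible A \<Longrightarrow> ntr (f1 X A ** mpowi A i) = of_int (int n) * ntr (mpowi A (int n + i) ** X)"
    and c: "\<And>A j. A \<in> G \<Longrightarrow> (\<Sum>X\<in>B. mscale (ntr (mpowi A j ** X)) (f1 X A)) = tp_eval (of_int (int n) * (u_pow (int n) * contr2 j)) A"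
    and l: "\<And>A. A \<in> G \<Longrightarrow> (\<Sum>X\<in>B. f2 X A) = tp_eval (Dop (u_pow (int n))) A" for X
    using pd by (auto simp: power_derivs_def)
  \<comment> \<open>The product rule with the new factor on the right, whose derivative is
    \<open>A ** X\<close>.\<close>
  define g1 where "g1 X A = f1 X A ** A + mpowi A (int n) ** (A ** X)" for X A
  define g2 where "g2 X A = (f2 X A ** A + f1 X A ** (A ** X)) +
      (f1 X A ** (A ** X) + mpowi A (int n) ** ((A ** X) ** X))" for X A
  have Suc_pow: "mpowi A (int (Suc n)) = mpowi A (int n) ** A" if "invertible A" for A :: "complex^'m^'m"
    using mpowi_add[OF that, of "int n" 1] by (simp add: add.commute)
  have "flow_deriv X (\<lambda>A. mpowi A (int (Suc n))) (g1 X)" for X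
    unfolding g1_def by (rule flow_deriv_cong[OF flow_deriv_mult[OF d1 flow_deriv_id] Suc_pow])
  moreover have "flow_deriv X (g1 X) (g2 X)" for X
  proof -
    have "flow_deriv X (\<lambda>A. A ** X) (\<lambda>A. (A ** X) ** X)"
      using flow_deriv_mult[OF flow_deriv_id flow_deriv_const, of X X] by simp
    then show ?thesis
      unfolding g1_def g2_def by (intro flow_deriv_add flow_deriv_mult d1 d2 flow_deriv_id)
  qed
  moreover have "ntr (g1 X A ** mpowi A i) = of_int (int (Suc n)) * ntr (mpowi A (int (Suc n) + i) ** X)"
    if A: "invertible A" for X A i
  proof -
    have "g1 X A ** mpowi A i = f1 X A ** mpowi A (1 + i) + (mpowi A (1 + int n) ** X) ** mpowi A i"
      using Suc_pow[OF A] by (simp add: g1_def matrix_mult.add_left mpowi_add[OF A, of 1 i] matrix_mul_assoc)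
    then show ?thesis
      by (simp add: ntr_add t[OF A] ntr_mult_commute[of "mpowi A (1 + int n) ** X"] matrix_mul_assoc
          algebra_simps flip: mpowi_add[OF A])
  qed
  moreover have "(\<Sum>X\<in>B. mscale (ntr (mpowi A j ** X)) (g1 X A)) = tp_eval (of_int (int (Suc n)) * (u_pow (int (Suc n)) * contr2 j)) A"
    if A: "A \<in> G" for A j
  proof -
    note iA = inv[OF A]
    have "(\<Sum>X\<in>B. mscale (ntr (mpowi A j ** X)) (g1 X A)) =
       (\<Sum>X\<in>B. mscale (ntr (mpowi A j ** X)) (f1 X A)) ** A + (mpowi A (int n) ** A) ** (\<Sum>X\<in>B. mscale (ntr (mpowi A j ** X)) X)"
      by (simp add: g1_def mscale_add sum.distrib matrix_mul_assoc mscale_matrix_mult flip: sum_mult_left sum_mult_right)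
    also have "\<dots> = tp_eval ((of_int (int n) * (u_pow (int n) * contr2 j)) * u_pow 1 + (u_pow (int n) * u_pow 1) * contr2 j) A"
      unfolding c[OF A] contr2_eval[OF A] by (simp only: tp_eval_add tp_eval_mult[OF iA] tp_eval_u_pow mpowi_1)
    also have "(of_int (int n) * (u_pow (int n) * contr2 j)) * u_pow 1 + (u_pow (int n) * u_pow 1) * contr2 j =
        of_int (int (Suc n)) * (u_pow (int (Suc n)) * contr2 j)"
    proof -
      have "u_pow (int (Suc n)) = u_pow (int n) * u_pow 1" by (simp add: algebra_simps flip: u_pow_add)
      then show ?thesis by (simp add: algebra_simps)
    qed
    finally show ?thesis .
  qed
  moreover have "(\<Sum>X\<in>B. g2 X A) = tp_eval (Dop (u_pow (int (Suc n)))) A" if A: "A \<in> G" for A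
  proof -
    note iA = inv[OF A]
    have "(\<Sum>X\<in>B. g2 X A) = (\<Sum>X\<in>B. f2 X A) ** A + mscale 2 (\<Sum>X\<in>B. f1 X A ** mpowi A 1 ** X)
        + (mpowi A (int n) ** A) ** (\<Sum>X\<in>B. X ** mpowi A 0 ** X)"
      by (simp only: g2_def sum.distrib matrix_mul_assoc mscale_2 mpowi_1 mpowi_0 matrix_mul_rid add_ac flip: sum_mult_left sum_mult_right)
    also have "\<dots> = tp_eval (Dop (u_pow (int n)) * u_pow 1 + 2 * (\<Sum>l\<in>{1..n}. u_pow (int l) * contr (int n - int l + 1))
        + (u_pow (int n) * u_pow 1) * contr 0) A"
      unfolding l[OF A] h[OF A] contr_eval[OF A]
      by (simp only: tp_eval_add tp_eval_numeral_mult, simp only: tp_eval_mult[OF iA] tp_eval_u_pow mpowi_1)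
    also have "Dop (u_pow (int n)) * u_pow 1 + 2 * (\<Sum>l\<in>{1..n}. u_pow (int l) * contr (int n - int l + 1))
        + (u_pow (int n) * u_pow 1) * contr 0 = Dop (u_pow (int (Suc n)))"
    proof -
      have "u_pow (int (Suc n)) = u_pow (int n) * u_pow 1" by (simp add: algebra_simps flip: u_pow_add)
      then show ?thesis using Dop_u_pow_Suc[of 1 n] by (simp add: mult.commute)
    qed
    finally show ?thesis .
  qed
  moreover have "(\<Sum>X\<in>B. g1 X A ** mpowi A i ** X) = tp_eval (\<Sum>l\<in>{1..Suc n}. u_pow (int l) * contr (int (Suc n) - int l + i)) A"
    if A: "A \<in> G" for A i
  proof -
    note iA = inv[OF A]
    have "(\<Sum>X\<in>B. g1 X A ** mpowi A i ** X) = (\<Sum>X\<in>B. f1 X A ** mpowi A (1 + i) ** X)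
        + (mpowi A (int n) ** A) ** (\<Sum>X\<in>B. X ** mpowi A i ** X)"
      by (simp add: g1_def matrix_mult.add_left sum.distrib mpowi_add[OF iA] matrix_mul_assoc flip: sum_mult_left)
    also have "\<dots> = tp_eval ((\<Sum>l\<in>{1..n}. u_pow (int l) * contr (int n - int l + (1 + i)))
        + (u_pow (int n) * u_pow 1) * contr i) A"
      unfolding h[OF A] contr_eval[OF A]
      by (simp only: tp_eval_add tp_eval_mult[OF iA] tp_eval_u_pow mpowi_1)
    also have "(\<Sum>l\<in>{1..n}. u_pow (int l) * contr (int n - int l + (1 + i))) + (u_pow (int n) * u_pow 1) * contr i =
        (\<Sum>l\<in>{1..Suc n}. u_pow (int l) * contr (int (Suc n) - int l + i))"
      by (simp add: algebra_simps flip: u_pow_add)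
    finally show ?thesis .
  qed
  ultimately show ?case unfolding power_derivs_def by blast
qed

text \<open>Mirror image of the nonnegative case. Differentiating the inverse puts \<open>X\<close>
  in front with a minus sign, so the new factor \<open>matrix_inv A\<close> goes to the left, and
  the cross sum has \<open>X\<close> before \<open>f1 X A\<close> and a negative value. In the
  second derivative the signs cancel.\<close>

lemma ex_power_derivs_neg:
  "\<exists>f1 f2. power_derivs (- int n) f1 f2 \<and>
     (\<forall>A\<in>G. \<forall>i. (\<Sum>X\<in>B. X ** mpowi A (- i) ** f1 X A) = tp_eval (- (\<Sum>l\<in>{1..n}. u_pow (- int l) * contr (- (int n - int l + i)))) A)"
proof (induction n)
  case 0
  show ?case
    by (rule exI[of _ "\<lambda>X A. 0"], rule exI[of _ "\<lambda>X A. 0"])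
      (simp add: power_derivs_def flow_deriv_const ntr_def trace_def)
next
  case (Suc n)
  then obtain f1 f2 where pd: "power_derivs (- int n) f1 f2" and
    h: "\<And>A i. A \<in> G \<Longrightarrow> (\<Sum>X\<in>B. X ** mpowi A (- i) ** f1 X A) = tp_eval (- (\<Sum>l\<in>{1..n}. u_pow (- int l) * contr (- (int n - int l + i)))) A"
    by blast
  have d1: "flow_deriv X (\<lambda>A. mpowi A (- int n)) (f1 X)" and d2: "flow_deriv X (f1 X) (f2 X)"
    and t: "\<And>A i. invertible A \<Longrightarrow> ntr (f1 X A ** mpowi A i) = of_int (- int n) * ntr (mpowi A (- int n + i) ** X)"
    and c: "\<And>A j. A \<in> G \<Longrightarrow> (\<Sum>X\<in>B. mscale (ntr (mpowi A j ** X)) (f1 X A)) = tp_eval (of_int (- int n) * (u_pow (- int n) * contr2 j)) A"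
    and l: "\<And>A. A \<in> G \<Longrightarrow> (\<Sum>X\<in>B. f2 X A) = tp_eval (Dop (u_pow (- int n))) A" for X
    using pd by (auto simp: power_derivs_def)
  define g1 where "g1 X A = - (X ** matrix_inv A) ** mpowi A (- int n) + matrix_inv A ** f1 X A" for X A
  define g2 where "g2 X A = (X ** (X ** matrix_inv A) ** mpowi A (- int n) + - (X ** matrix_inv A) ** f1 X A) +
      (- (X ** matrix_inv A) ** f1 X A + matrix_inv A ** f2 X A)" for X A
  have Suc_pow: "mpowi A (- int (Suc n)) = matrix_inv A ** mpowi A (- int n)" if "invertible A" for A :: "complex^'m^'m"
    using mpowi_add[OF that, of "-1" "- int n"] by (simp add: mpowi_m1 add.commute)
  have "flow_deriv X (\<lambda>A. mpowi A (- int (Suc n))) (g1 X)" for X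
    unfolding g1_def by (rule flow_deriv_cong[OF flow_deriv_mult[OF flow_deriv_matrix_inv d1] Suc_pow])
  moreover have "flow_deriv X (g1 X) (g2 X)" for X
  proof -
    have "flow_deriv X (\<lambda>A. - (X ** matrix_inv A)) (\<lambda>A. X ** (X ** matrix_inv A))"
      using flow_deriv_uminus[OF flow_deriv_mult[OF flow_deriv_const flow_deriv_matrix_inv, of X X]]
      by (simp add: matrix_mult.minus_right)
    then show ?thesis
      unfolding g1_def g2_def by (intro flow_deriv_add flow_deriv_mult d1 d2 flow_deriv_matrix_inv)
  qed
  moreover have "ntr (g1 X A ** mpowi A i) = of_int (- int (Suc n)) * ntr (mpowi A (- int (Suc n) + i) ** X)"
    if A: "invertible A" for X A i
  proof -
    have "g1 X A ** mpowi A i = - (X ** mpowi A (- int (Suc n) + i)) + mpowi A (- 1) ** (f1 X A ** mpowi A i)"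
      unfolding mpowi_add[OF A] Suc_pow[OF A] mpowi_m1
      by (simp add: g1_def matrix_mult.diff_left matrix_mult.minus_left matrix_mul_assoc)
    moreover have "ntr (mpowi A (- 1) ** (f1 X A ** mpowi A i)) = ntr (f1 X A ** mpowi A (i + - 1))"
      by (subst ntr_mult_commute) (simp only: mpowi_add[OF A, of i "-1"] matrix_mul_assoc)
    ultimately have "ntr (g1 X A ** mpowi A i) = - ntr (X ** mpowi A (- int (Suc n) + i)) + ntr (f1 X A ** mpowi A (i + - 1))"
      by (simp only: ntr_add ntr_uminus)
    moreover have "- int n + (i + - 1) = - int (Suc n) + i" by simp
    ultimately show ?thesis
      unfolding t[OF A] ntr_mult_commute[of X] by (simp add: algebra_simps)
  qed
  moreover have "(\<Sum>X\<in>B. mscale (ntr (mpowi A j ** X)) (g1 X A)) = tp_eval (of_int (- int (Suc n)) * (u_pow (- int (Suc n)) * contr2 j)) A"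
    if A: "A \<in> G" for A j
  proof -
    note iA = inv[OF A]
    have "(\<Sum>X\<in>B. mscale (ntr (mpowi A j ** X)) (g1 X A)) =
       - ((\<Sum>X\<in>B. mscale (ntr (mpowi A j ** X)) X) ** (mpowi A (- 1) ** mpowi A (- int n))) + mpowi A (- 1) ** (\<Sum>X\<in>B. mscale (ntr (mpowi A j ** X)) (f1 X A))"
      by (simp add: g1_def mscale_diff mscale_uminus sum_subtractf sum_negf matrix_mul_assoc mscale_matrix_mult matrix_mult.minus_left mpowi_m1
          flip: sum_mult_left sum_mult_right)
    also have "\<dots> = tp_eval (- (contr2 j * (u_pow (- 1) * u_pow (- int n))) + u_pow (- 1) * (of_int (- int n) * (u_pow (- int n) * contr2 j))) A"
      unfolding c[OF A] contr2_eval[OF A] by (simp only: tp_eval_add tp_eval_uminus tp_eval_mult[OF iA] tp_eval_u_pow)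
    also have "- (contr2 j * (u_pow (- 1) * u_pow (- int n))) + u_pow (- 1) * (of_int (- int n) * (u_pow (- int n) * contr2 j)) =
        of_int (- int (Suc n)) * (u_pow (- int (Suc n)) * contr2 j)"
    proof -
      have "u_pow (- int (Suc n)) = u_pow (- 1) * u_pow (- int n)" by (simp add: algebra_simps flip: u_pow_add)
      then show ?thesis by (simp add: algebra_simps)
    qed
    finally show ?thesis .
  qed
  moreover have "(\<Sum>X\<in>B. g2 X A) = tp_eval (Dop (u_pow (- int (Suc n)))) A" if A: "A \<in> G" for A
  proof -
    note iA = inv[OF A]
    have "(\<Sum>X\<in>B. g2 X A) = (\<Sum>X\<in>B. X ** mpowi A 0 ** X) ** (mpowi A (- 1) ** mpowi A (- int n))
       + - mscale 2 (\<Sum>X\<in>B. X ** mpowi A (- 1) ** f1 X A) + mpowi A (- 1) ** (\<Sum>X\<in>B. f2 X A)"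
      by (simp only: g2_def sum.distrib sum_negf matrix_mul_assoc mscale_2 mpowi_m1 mpowi_0 matrix_mul_rid
          matrix_mult.minus_left minus_add_distrib add_ac flip: sum_mult_left sum_mult_right)
    also have "\<dots> = tp_eval (contr 0 * (u_pow (- 1) * u_pow (- int n))
        + - (2 * (- (\<Sum>l\<in>{1..n}. u_pow (- int l) * contr (- (int n - int l + 1))))) + u_pow (- 1) * Dop (u_pow (- int n))) A"
      unfolding l[OF A] h[OF A] contr_eval[OF A]
      by (simp only: tp_eval_add tp_eval_uminus tp_eval_numeral_mult, simp only: tp_eval_mult[OF iA] tp_eval_u_pow)
    also have "contr 0 * (u_pow (- 1) * u_pow (- int n))
        + - (2 * (- (\<Sum>l\<in>{1..n}. u_pow (- int l) * contr (- (int n - int l + 1))))) + u_pow (- 1) * Dop (u_pow (- int n)) = Dop (u_pow (- int (Suc n)))"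
    proof -
      have "u_pow (- int (Suc n)) = u_pow (- 1) * u_pow (- int n)" by (simp add: algebra_simps flip: u_pow_add)
      then show ?thesis using Dop_u_pow_Suc[of "-1" n] by (simp add: mult.commute)
    qed
    finally show ?thesis .
  qed
  moreover have "(\<Sum>X\<in>B. X ** mpowi A (- i) ** g1 X A) = tp_eval (- (\<Sum>l\<in>{1..Suc n}. u_pow (- int l) * contr (- (int (Suc n) - int l + i)))) A"
    if A: "A \<in> G" for A i
  proof -
    note iA = inv[OF A]
    have "mpowi A (- i) ** matrix_inv A = mpowi A (- (1 + i))"
      using mpowi_add[OF iA, of "- i" "- 1"] by (simp add: mpowi_m1 algebra_simps)
    then have "X ** mpowi A (- i) ** g1 X A = - (X ** mpowi A (- i) ** X ** (mpowi A (- 1) ** mpowi A (- int n))) + X ** mpowi A (- (1 + i)) ** f1 X A" for X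
      by (simp only: g1_def matrix_mult.add_right matrix_mult.minus_right matrix_mult.minus_left matrix_mul_assoc mpowi_m1)
        (simp flip: matrix_mul_assoc)
    then have "(\<Sum>X\<in>B. X ** mpowi A (- i) ** g1 X A) = - ((\<Sum>X\<in>B. X ** mpowi A (- i) ** X) ** (mpowi A (- 1) ** mpowi A (- int n)))
        + (\<Sum>X\<in>B. X ** mpowi A (- (1 + i)) ** f1 X A)"
      by (simp only: sum.distrib sum_negf sum_mult_right)
    also have "\<dots> = tp_eval (- (contr (- i) * (u_pow (- 1) * u_pow (- int n))) + - (\<Sum>l\<in>{1..n}. u_pow (- int l) * contr (- (int n - int l + (1 + i))))) A"
      unfolding h[OF A] contr_eval[OF A]
      by (simp only: tp_eval_add tp_eval_uminus tp_eval_mult[OF iA] tp_eval_u_pow)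
    also have "- (contr (- i) * (u_pow (- 1) * u_pow (- int n))) + - (\<Sum>l\<in>{1..n}. u_pow (- int l) * contr (- (int n - int l + (1 + i)))) =
        - (\<Sum>l\<in>{1..Suc n}. u_pow (- int l) * contr (- (int (Suc n) - int l + i)))"
      by (simp add: algebra_simps flip: u_pow_add)
    finally show ?thesis .
  qed
  ultimately show ?case unfolding power_derivs_def by blast
qed

lemma ex_power_derivs: "\<exists>f1 f2. power_derivs a f1 f2"
  using ex_power_derivs_nonneg ex_power_derivs_neg by (cases a rule: int_cases2) blast+

end

text \<open>At a point of \<open>G\<close> the Laplacian reads a function only along flows inside
  \<open>G\<close>. Iterates may therefore be replaced by trace polynomials that agree with them on
  \<open>G\<close> alone.\<close>

lemma laplacian_cong:
  assumes "\<And>A X t. A \<in> G \<Longrightarrow> X \<in> B \<Longrightarrow> A ** mexp (t *\<^sub>R X) \<in> G" "\<And>A. A \<in> G \<Longrightarrow> f A = g A" "A \<in> G"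
  shows "laplacian B f A = laplacian B g A"
proof -
  have "lie_deriv X f A = lie_deriv X g A" if "X \<in> B" "A \<in> G" "\<And>A. A \<in> G \<Longrightarrow> f A = g A" for X A f g
    using assms(1) that by (simp add: lie_deriv_def)
  then show ?thesis unfolding laplacian_def using assms(2,3) by (intro sum.cong refl) blast
qed

context contraction_basis
begin

text \<open>The middle clause identifies the cross term: the derivative of
  \<open>ntr (mpowi A j)\<close> along \<open>X\<close> is j times
  \<open>ntr (mpowi A j ** X)\<close>, and the product rule doubles it.\<close>

definition tp_derivs ::
    "tpoly \<Rightarrow> (complex^'m^'m \<Rightarrow> complex^'m^'m \<Rightarrow> complex^'m^'m) \<Rightarrow> (complex^'m^'m \<Rightarrow> complex^'m^'m \<Rightarrow> complex^'m^'m) \<Rightarrow> bool" where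
  "tp_derivs P f1 f2 \<longleftrightarrow>
     (\<forall>X. flow_deriv X (tp_eval P) (f1 X) \<and> flow_deriv X (f1 X) (f2 X)) \<and>
     (\<forall>A\<in>G. \<forall>j. mscale (of_int (2 * j)) (\<Sum>X\<in>B. mscale (ntr (mpowi A j ** X)) (f1 X A)) = tp_eval (Gop j P) A) \<and>
     (\<forall>A\<in>G. (\<Sum>X\<in>B. f2 X A) = tp_eval (Dop P) A)"

lemma tp_derivs_add:
  assumes "tp_derivs P f1 f2" "tp_derivs Q g1 g2"
  shows "tp_derivs (P + Q) (\<lambda>X A. f1 X A + g1 X A) (\<lambda>X A. f2 X A + g2 X A)"
proof -
  have "flow_deriv X (tp_eval (P + Q)) (\<lambda>A. f1 X A + g1 X A)" for X
    using assms by (intro flow_deriv_cong[OF flow_deriv_add[of X "tp_eval P" _ "tp_eval Q"]]) (auto simp: tp_derivs_def tp_eval_add)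
  moreover have "flow_deriv X (\<lambda>A. f1 X A + g1 X A) (\<lambda>A. f2 X A + g2 X A)" for X
    using assms by (intro flow_deriv_add) (auto simp: tp_derivs_def)
  ultimately show ?thesis
    using assms unfolding tp_derivs_def
    by (simp add: tp_linearD(1)[OF tp_linear_Dop] tp_linearD(1)[OF tp_linear_Gop] tp_eval_add mscale_add sum.distrib)
qed

lemma tp_derivs_scl:
  assumes "tp_derivs P f1 f2"
  shows "tp_derivs (scl c P) (\<lambda>X A. mscale c (f1 X A)) (\<lambda>X A. mscale c (f2 X A))"
proof -
  have "flow_deriv X (tp_eval (scl c P)) (\<lambda>A. mscale c (f1 X A))" for X
    using assms by (intro flow_deriv_cong[OF flow_deriv_bounded_linear[OF bounded_linear_mscale, of X "tp_eval P"]])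
      (auto simp: tp_derivs_def tp_eval_scl)
  moreover have "flow_deriv X (\<lambda>A. mscale c (f1 X A)) (\<lambda>A. mscale c (f2 X A))" for X
    using assms by (intro flow_deriv_bounded_linear[OF bounded_linear_mscale]) (auto simp: tp_derivs_def)
  moreover have "mscale (of_int (2 * j)) (\<Sum>X\<in>B. mscale (ntr (mpowi A j ** X)) (mscale c (f1 X A))) = tp_eval (Gop j (scl c P)) A"
    if "A \<in> G" for A j
  proof -
    have "mscale (of_int (2 * j)) (\<Sum>X\<in>B. mscale (ntr (mpowi A j ** X)) (mscale c (f1 X A))) =
      mscale c (mscale (of_int (2 * j)) (\<Sum>X\<in>B. mscale (ntr (mpowi A j ** X)) (f1 X A)))"
      by (simp add: mscale_sum mult_ac)
    also have "mscale (of_int (2 * j)) (\<Sum>X\<in>B. mscale (ntr (mpowi A j ** X)) (f1 X A)) = tp_eval (Gop j P) A"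
      using assms that unfolding tp_derivs_def by blast
    finally show ?thesis by (simp add: tp_linearD(2)[OF tp_linear_Gop] tp_eval_scl)
  qed
  ultimately show ?thesis
    using assms unfolding tp_derivs_def
    by (simp add: tp_linearD(2)[OF tp_linear_Dop] tp_eval_scl flip: mscale_sum)
qed

lemma tp_derivs_u_pow:
  assumes "power_derivs a f1 f2"
  shows "tp_derivs (u_pow a) f1 f2"
proof -
  have "mscale (of_int (2 * j)) (tp_eval (of_int a * (u_pow a * contr2 j)) A) = tp_eval (Gop j (u_pow a)) A" for A :: "complex^'m^'m" and j
  proof -
    have "Gop j (u_pow a) = of_int (2 * j) * (of_int a * (u_pow a * contr2 j))"
      by (simp add: Gop_u_pow contr2_def mult_ac)
    then show ?thesis by (simp only: tp_eval_of_int_mult)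
  qed
  then show ?thesis
    using assms unfolding tp_derivs_def power_derivs_def by (simp add: tp_eval_u_pow[abs_def])
qed

text \<open>v_k is the normalised trace of u^k and the trace commutes with derivatives, so
  \<open>Dop\<close> has to respect this passage. The two closed forms agree term by term.\<close>

lemma ntr_Dop_u_pow:
  assumes "k \<noteq> 0" "invertible (A :: complex^'m^'m)"
  shows "mat (ntr (tp_eval (Dop (u_pow k)) A)) = tp_eval (Dop (v_var k)) A"
proof -
  define v where "v j = ntr (mpowi A j)" for j
  have c: "ntr (tp_eval (u_pow (k - d) * contr d) A) = - v d * v (k - d) + \<alpha> * v (k - 2 * d) + \<gamma> * v k" for d
  proof -
    have "u_pow (k - d) * contr d = - (v_var d * u_pow (k - d)) + scl \<alpha> (u_pow (k - 2 * d)) + scl \<gamma> (u_pow k)"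
      by (simp add: contr_def algebra_simps flip: u_pow_add)
    then show ?thesis
      by (simp add: tp_eval_linear tp_eval_v_mult[OF assms(2)] tp_eval_u_pow ntr_add ntr_diff ntr_mscale v_def)
  qed
  let ?N = "of_int \<bar>k\<bar> * (- v k + (\<alpha> + \<gamma>) * v k)
    + 2 * (\<Sum>d\<in>tail k. of_int \<bar>k - d\<bar> * (- v d * v (k - d) + \<alpha> * v (k - 2 * d) + \<gamma> * v k))"
  have "ntr (tp_eval (Dop (u_pow k)) A) = ?N"
  proof -
    have c0: "ntr (tp_eval (u_pow k * contr 0) A) = - v k + (\<alpha> + \<gamma>) * v k"
      using c[of 0] by (simp add: v_def algebra_simps)
    show ?thesis unfolding Dop_u_pow
      by (simp only: tp_eval_linear ntr_add ntr_mscale ntr_sum c c0)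
  qed
  moreover have "tp_eval (Dop (v_var k)) A = mscale ?N (mat 1)"
  proof -
    have t: "tp_eval (- v_var d * v_var (k - d) + scl \<alpha> (v_var (k - 2 * d)) + scl \<gamma> (v_var k)) A
      = mscale (- v d * v (k - d) + \<alpha> * v (k - 2 * d) + \<gamma> * v k) (mat 1)" for d
      by (simp add: tp_eval_linear tp_eval_v_mult[OF assms(2)] tp_eval_v_var mat_eq_mscale[of "ntr _"] v_def
          mscale_add_left mscale_diff_left mscale_uminus_left)
    have t0: "tp_eval (- v_var k + scl (\<alpha> + \<gamma>) (v_var k)) A = mscale (- v k + (\<alpha> + \<gamma>) * v k) (mat 1)"
      by (simp add: tp_eval_linear tp_eval_v_var mat_eq_mscale[of "ntr _"] v_def
          mscale_add_left mscale_diff_left mscale_uminus_left)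
    show ?thesis unfolding Dop_v[OF assms(1)] tp_eval_add[of "of_int _ * _"] tp_eval_numeral_mult tp_eval_sum
        tp_eval_of_int_mult t t0
      by (simp only: mscale_mscale mscale_add_left[of "of_int \<bar>k\<bar> * _"] mscale_sum_left mscale_sum sum_distrib_left)
  qed
  ultimately show ?thesis by (simp only: mat_eq_mscale[of ?N])
qed

text \<open>The second contraction identity for j is multiplied by the k-th power and the trace is
  taken.\<close>

lemma sum_ntr_ntr:
  assumes "A \<in> G"
  shows "(\<Sum>X\<in>B. ntr (mpowi A j ** X) * ntr (mpowi A k ** X)) =
    \<epsilon> * ntr (mpowi A (k - j)) - \<delta> * ntr (mpowi A (k + j)) + \<gamma> * (ntr (mpowi A j) * ntr (mpowi A k))"
proof -
  note iA = inv[OF assms]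
  have "(\<Sum>X\<in>B. ntr (mpowi A j ** X) * ntr (mpowi A k ** X)) = ntr (mpowi A k ** (\<Sum>X\<in>B. mscale (ntr (mpowi A j ** X)) X))"
    by (simp add: ntr_sum mscale_matrix_mult ntr_mscale flip: sum_mult_left)
  also have "\<dots> = ntr (tp_eval (u_pow k * contr2 j) A)"
    unfolding contr2_eval[OF assms] by (simp add: tp_eval_mult[OF iA] tp_eval_u_pow)
  also have "u_pow k * contr2 j = scl \<epsilon> (u_pow (k - j)) - scl \<delta> (u_pow (k + j)) + scl \<gamma> (v_var j * u_pow k)"
    by (simp add: contr2_def algebra_simps flip: u_pow_add)
  also have "ntr (tp_eval \<dots> A) = \<epsilon> * ntr (mpowi A (k - j)) - \<delta> * ntr (mpowi A (k + j)) + \<gamma> * (ntr (mpowi A j) * ntr (mpowi A k))"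
    by (simp add: tp_eval_linear tp_eval_v_mult[OF iA] tp_eval_u_pow ntr_add ntr_diff ntr_mscale)
  finally show ?thesis .
qed

text \<open>The value of v_k is kept as a scalar matrix so that the product rule for matrices
  applies; its derivatives are the normalised traces of those of the k-th power.\<close>

lemma tp_derivs_v_mult:
  assumes k: "k \<noteq> 0" and p: "power_derivs k p1 p2" and d: "tp_derivs P f1 f2"
  shows "tp_derivs (v_var k * P)
    (\<lambda>X A. mat (ntr (p1 X A)) ** tp_eval P A + mat (ntr (mpowi A k)) ** f1 X A)
    (\<lambda>X A. (mat (ntr (p2 X A)) ** tp_eval P A + mat (ntr (p1 X A)) ** f1 X A)
      + (mat (ntr (p1 X A)) ** f1 X A + mat (ntr (mpowi A k)) ** f2 X A))"
    (is "tp_derivs _ ?g1 ?g2")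
proof -
  have p1: "flow_deriv X (\<lambda>A. mpowi A k) (p1 X)" and p2: "flow_deriv X (p1 X) (p2 X)"
    and f1: "flow_deriv X (tp_eval P) (f1 X)" and f2: "flow_deriv X (f1 X) (f2 X)" for X
    using p d by (auto simp: power_derivs_def tp_derivs_def)
  note L = flow_deriv_bounded_linear[OF bounded_linear_mat_ntr]
  have "flow_deriv X (tp_eval (v_var k * P)) (?g1 X)" for X
    by (rule flow_deriv_cong[OF flow_deriv_mult[OF L[OF p1] f1]]) (simp add: tp_eval_v_mult mat_mult)
  moreover have "flow_deriv X (?g1 X) (?g2 X)" for X
    by (intro flow_deriv_add flow_deriv_mult L p1 p2 f1 f2)
  moreover have "mscale (of_int (2 * j)) (\<Sum>X\<in>B. mscale (ntr (mpowi A j ** X)) (?g1 X A)) = tp_eval (Gop j (v_var k * P)) A"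
    and "(\<Sum>X\<in>B. ?g2 X A) = tp_eval (Dop (v_var k * P)) A" if A: "A \<in> G" for A j
  proof -
    note iA = inv[OF A]
    define v where "v j = ntr (mpowi A j)" for j
    have q: "ntr (p1 X A) = of_int k * ntr (mpowi A k ** X)" for X
    proof -
      have "ntr (p1 X A ** mpowi A 0) = of_int k * ntr (mpowi A (k + 0) ** X)"
        using p iA unfolding power_derivs_def by blast
      then show ?thesis by simp
    qed
    have G: "mscale (of_int (2 * j)) (\<Sum>X\<in>B. mscale (ntr (mpowi A j ** X)) (f1 X A)) = tp_eval (Gop j P) A" for j
      using d A unfolding tp_derivs_def by blast
    have "mscale (of_int (2 * j)) (\<Sum>X\<in>B. mscale (ntr (mpowi A j ** X)) (?g1 X A)) =
      mscale (of_int (j * k) * (2 * (\<Sum>X\<in>B. ntr (mpowi A j ** X) * ntr (mpowi A k ** X)))) (tp_eval P A)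
      + mscale (v k) (mscale (of_int (2 * j)) (\<Sum>X\<in>B. mscale (ntr (mpowi A j ** X)) (f1 X A)))"
      by (simp add: mat_mult q v_def mscale_add sum.distrib mscale_sum mscale_sum_left sum_distrib_left mult_ac)
    also have "2 * (\<Sum>X\<in>B. ntr (mpowi A j ** X) * ntr (mpowi A k ** X)) =
       \<epsilon> * (v (k - j) + v (j - k)) - \<delta> * (2 * v (j + k)) + \<gamma> * (2 * v j * v k)"
    proof -
      \<comment> \<open>\<open>sum_ntr_ntr\<close> is not visibly symmetric in j and k. One copy in
        each order is added to match the symmetrised bracket in \<open>Gop_v_mult\<close>.\<close>
      have swap: "(\<Sum>X\<in>B. ntr (mpowi A j ** X) * ntr (mpowi A k ** X)) = (\<Sum>X\<in>B. ntr (mpowi A k ** X) * ntr (mpowi A j ** X))"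
        by (simp only: mult.commute)
      show ?thesis
        unfolding mult_2 using arg_cong2[OF sum_ntr_ntr[OF A, of j k] trans[OF swap sum_ntr_ntr[OF A, of k j]], of "(+)"]
        by (simp only: v_def) (simp add: algebra_simps)
    qed
    finally have g: "mscale (of_int (2 * j)) (\<Sum>X\<in>B. mscale (ntr (mpowi A j ** X)) (?g1 X A)) =
      mscale (of_int (j * k) * (\<epsilon> * (v (k - j) + v (j - k)) - \<delta> * (2 * v (j + k)) + \<gamma> * (2 * v j * v k))) (tp_eval P A)
      + mscale (v k) (mscale (of_int (2 * j)) (\<Sum>X\<in>B. mscale (ntr (mpowi A j ** X)) (f1 X A)))" .
    have "tp_eval 2 A = mscale 2 (mat 1)"
      using tp_eval_numeral_mult[of "num.Bit0 num.One" 1 A] by simp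
    then have "tp_eval (scl \<epsilon> (v_var (k - j) + v_var (j - k)) - scl \<delta> (2 * v_var (j + k)) + scl \<gamma> (2 * v_var j * v_var k)) A
      = mat (\<epsilon> * (v (k - j) + v (j - k)) - \<delta> * (2 * v (j + k)) + \<gamma> * (2 * v j * v k))"
      unfolding mult.assoc[of 2 "v_var j"] mat_eq_mscale[of "_ + _"]
      by (simp add: tp_eval_linear tp_eval_v_mult[OF iA] tp_eval_v_var mat_eq_mscale[of "ntr _"] v_def
          mscale_add mscale_add_left mscale_diff_left mult_ac distrib_left)
    then show "mscale (of_int (2 * j)) (\<Sum>X\<in>B. mscale (ntr (mpowi A j ** X)) (?g1 X A)) = tp_eval (Gop j (v_var k * P)) A"
      unfolding Gop_v_mult[OF k] g G tp_eval_add[of "v_var k * _"] tp_eval_v_mult[OF iA] tp_eval_of_int_mult tp_eval_mult[OF iA, of _ P]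
      by (simp only: mat_mult mscale_mscale v_def add.commute)
    have "(\<Sum>X\<in>B. ?g2 X A) = mat (ntr (\<Sum>X\<in>B. p2 X A)) ** tp_eval P A
      + mscale (of_int (2 * k)) (\<Sum>X\<in>B. mscale (ntr (mpowi A k ** X)) (f1 X A)) + mscale (v k) (\<Sum>X\<in>B. f2 X A)"
      by (simp add: mat_mult q v_def ntr_sum sum.distrib mscale_sum mscale_sum_left mult.assoc
          mscale_2[of "mscale _ _", simplified] mscale_add_left[of "of_int k * _" "of_int k * _"])
    also have "\<dots> = mat (ntr (tp_eval (Dop (u_pow k)) A)) ** tp_eval P A + tp_eval (Gop k P) A + mscale (v k) (tp_eval (Dop P) A)"
      using p d A unfolding G by (simp add: power_derivs_def tp_derivs_def)
    finally show "(\<Sum>X\<in>B. ?g2 X A) = tp_eval (Dop (v_var k * P)) A"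
      unfolding Dop_v_mult[OF k] ntr_Dop_u_pow[OF k iA]
      by (simp add: tp_eval_add tp_eval_mult[OF iA] tp_eval_v_var mat_mult v_def)
  qed
  ultimately show ?thesis unfolding tp_derivs_def by blast
qed

lemma ex_tp_derivs: "\<exists>f1 f2. tp_derivs P f1 f2"
proof (induction P rule: tpoly_induct)
  case (u a)
  then show ?case using ex_power_derivs tp_derivs_u_pow by blast
next
  case (v k P)
  then show ?case using ex_power_derivs[of k] tp_derivs_v_mult by blast
next
  case (add P Q)
  then show ?case using tp_derivs_add by blast
next
  case (scl c P)
  then show ?case using tp_derivs_scl by blast
qed

lemma laplacian_tp_eval:
  assumes "A \<in> G"
  shows "laplacian B (tp_eval P) A = tp_eval (Dop P) A"
proof -
  obtain f1 f2 where d: "tp_derivs P f1 f2" using ex_tp_derivs by blast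
  then have "laplacian B (tp_eval P) A = (\<Sum>X\<in>B. f2 X A)"
    by (intro laplacian_eq inv[OF assms]) (auto simp: tp_derivs_def)
  then show ?thesis using d assms by (simp add: tp_derivs_def)
qed

lemma fun_exp_tp_eval:
  assumes flow: "\<And>A X t. A \<in> G \<Longrightarrow> X \<in> B \<Longrightarrow> A ** mexp (t *\<^sub>R X) \<in> G" and A: "A \<in> G"
  shows "fun_exp c (laplacian B) (tp_eval P) A = tp_eval (tp_exp c Dop P) A"
proof -
  have iter: "(laplacian B ^^ n) (tp_eval P) A = tp_eval ((Dop ^^ n) P) A" if "A \<in> G" for n A
    using that
  proof (induction n arbitrary: A)
    case (Suc n)
    \<comment> \<open>The induction hypothesis holds on \<open>G\<close> only; closure of
      \<open>G\<close> under the flow lets the outer Laplacian use it.\<close>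
    have "(laplacian B ^^ Suc n) (tp_eval P) A = laplacian B (tp_eval ((Dop ^^ n) P)) A"
      using laplacian_cong[of G B "(laplacian B ^^ n) (tp_eval P)", OF flow Suc.IH Suc.prems] by simp
    then show ?case using laplacian_tp_eval[OF Suc.prems] by simp
  qed simp
  obtain d where d: "P \<in> deg_le d" using ex_deg_le by blast
  define S where "S = {x. tdeg x \<le> d}"
  have S: "finite S" by (simp add: S_def finite_tdeg_le)
  have ev: "tp_eval Q A = (\<Sum>x\<in>S. mscale (lookup Q x) (meval x A))" if "Q \<in> deg_le d" for Q
    by (rule tp_eval_superset[OF S]) (use that in \<open>auto simp: S_def deg_le_def\<close>)
  \<comment> \<open>All terms of the series are combinations of the finitely many monomials in
    \<open>S\<close>, so convergence of coefficients passes to the evaluated matrices.\<close>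
  have "(\<lambda>n. \<Sum>x\<in>S. mscale (c ^ n / fact n * lookup ((Dop ^^ n) P) x) (meval x A)) sums
      (\<Sum>x\<in>S. mscale (lookup (tp_exp c Dop P) x) (meval x A))"
    by (intro sums_sum bounded_linear.sums[OF bounded_linear_mscale_left]
        tp_exp_sums[OF tp_linear_Dop Dop_deg_le d])
  also have "(\<lambda>n. \<Sum>x\<in>S. mscale (c ^ n / fact n * lookup ((Dop ^^ n) P) x) (meval x A)) =
      (\<lambda>n. mscale (c ^ n / fact n) ((laplacian B ^^ n) (tp_eval P) A))"
  proof -
    have "(Dop ^^ n) P \<in> deg_le d" for n by (rule deg_le_funpow[OF Dop_deg_le d])
    then show ?thesis unfolding iter[OF A] by (simp add: ev mscale_sum)
  qed
  also have "(\<Sum>x\<in>S. mscale (lookup (tp_exp c Dop P) x) (meval x A)) = tp_eval (tp_exp c Dop P) A"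
    by (rule ev[symmetric]) (rule tp_exp_deg_le[OF tp_linear_Dop Dop_deg_le d])
  finally show ?thesis
    unfolding fun_exp_def by (rule sums_unique[symmetric])
qed

end

section \<open>Lie algebras of the classical groups\<close>

definition mconj :: "complex^'m^'m \<Rightarrow> complex^'m^'m" where
  "mconj A = map_matrix cnj A"

lemma mconj_nth [simp]: "mconj A $ i $ j = cnj (A $ i $ j)"
  by (simp add: mconj_def map_matrix_def)

lemma transpose_nth [simp]: "transpose A $ i $ j = A $ j $ i"
  by (simp add: transpose_def)

lemma madj_nth [simp]: "madj A $ i $ j = cnj (A $ j $ i)"
  by (simp add: madj_def map_matrix_def transpose_def)

lemma madj_eq: "madj A = mconj (transpose A)"
  by (simp add: vec_eq_iff)

lemma mconj_mult: "mconj (A ** B) = mconj A ** mconj B"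
  by (simp add: vec_eq_iff matrix_matrix_mult_def)

lemma madj_mult: "madj (A ** B) = madj B ** madj A"
  by (simp add: madj_eq matrix_transpose_mul mconj_mult)

lemma mconj_mat_1 [simp]: "mconj (mat 1) = mat 1"
  by (simp add: vec_eq_iff mat_def)

lemma madj_madj [simp]: "madj (madj A) = A"
  by (simp add: vec_eq_iff)

lemma bounded_linear_mconj: "bounded_linear mconj"
  and bounded_linear_transpose: "bounded_linear (transpose :: complex^'m^'m \<Rightarrow> _)"
  and bounded_linear_madj: "bounded_linear madj"
  unfolding linear_conv_bounded_linear[symmetric]
  by (auto intro!: linearI simp: vec_eq_iff)

lemma mpow_commute: "mpow A n ** A = A ** mpow (A :: complex^'m^'m) n"
  by (induction n) (simp_all add: mpow_Suc flip: matrix_mul_assoc)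

lemma mpow_mconj: "mconj (mpow A n) = mpow (mconj A) n"
  by (induction n) (simp_all add: mpow_Suc mconj_mult)

lemma mpow_transpose: "transpose (mpow A n) = mpow (transpose (A :: complex^'m^'m)) n"
  by (induction n) (simp_all add: mpow_Suc matrix_transpose_mul mpow_commute)

lemma mpow_madj: "madj (mpow A n) = mpow (madj A) n"
  by (simp add: madj_eq mpow_mconj mpow_transpose)

lemma mexp_map:
  assumes "bounded_linear L" "\<And>n. L (mpow X n) = mpow (L X) n"
  shows "L (mexp X) = mexp (L X)"
proof -
  have "(\<lambda>n. L ((1 / fact n) *\<^sub>R mpow X n)) sums L (mexp X)"
    using bounded_linear.sums[OF assms(1)] mexp_sums[of 1 X] by simp
  then have "(\<lambda>n. (1 / fact n) *\<^sub>R mpow (L X) n) sums L (mexp X)"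
    by (simp add: linear_scale[OF bounded_linear.linear[OF assms(1)]] assms(2))
  then show ?thesis using mexp_sums[of 1 "L X"] sums_unique2 by force
qed

lemma mexp_mconj: "mconj (mexp (t *\<^sub>R X)) = mexp (t *\<^sub>R mconj X)"
  and mexp_transpose: "transpose (mexp (t *\<^sub>R X)) = mexp (t *\<^sub>R transpose X)"
  and mexp_madj: "madj (mexp (t *\<^sub>R X)) = mexp (t *\<^sub>R madj X)"
  using mexp_map[OF bounded_linear_mconj mpow_mconj, of "t *\<^sub>R X"]
    mexp_map[OF bounded_linear_transpose mpow_transpose, of "t *\<^sub>R X"]
    mexp_map[OF bounded_linear_madj mpow_madj, of "t *\<^sub>R X"]
  by (simp_all add: linear_scale[OF bounded_linear.linear[OF bounded_linear_mconj]]
      linear_scale[OF bounded_linear.linear[OF bounded_linear_transpose]]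
      linear_scale[OF bounded_linear.linear[OF bounded_linear_madj]])

lemma mexp_inject: "(\<And>t. mexp (t *\<^sub>R X) = mexp (t *\<^sub>R Y)) \<Longrightarrow> X = Y"
  using mexp_has_vector_derivative[of X 0] mexp_has_vector_derivative[of Y 0]
  by (auto dest: vector_derivative_unique_at)

text \<open>With \<open>M\<close> one of \<open>mat 1\<close> and \<open>Omega\<close>, and
  \<open>Y\<close> the transpose or the adjoint of \<open>X\<close>, this turns the quadratic
  equations of the groups into their infinitesimal form. One direction differentiates at 0, the
  other is \<open>mexp_intertwine\<close>.\<close>

lemma mexp_preserves_form_iff:
  fixes M :: "complex^'m^'m"
  shows "(\<forall>t. mexp (t *\<^sub>R Y) ** M ** mexp (t *\<^sub>R X) = M) \<longleftrightarrow> Y ** M + M ** X = 0"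
proof
  assume *: "\<forall>t. mexp (t *\<^sub>R Y) ** M ** mexp (t *\<^sub>R X) = M"
  have "((\<lambda>t. mexp (t *\<^sub>R Y) ** M) has_vector_derivative (Y ** mexp (0 *\<^sub>R Y)) ** M) (at 0)"
    by (rule bounded_linear.has_vector_derivative[OF matrix_mult.bounded_linear_left mexp_has_vector_derivative])
  from matrix_mult.has_vector_derivative[OF this mexp_has_vector_derivative[of X 0]]
  have "((\<lambda>t. M) has_vector_derivative (M ** X + Y ** M)) (at 0)" using * by simp
  then show "Y ** M + M ** X = 0"
    using vector_derivative_unique_at[OF _ has_vector_derivative_const] by (metis add.commute)
next
  assume "Y ** M + M ** X = 0"
  then have "Y ** M = M ** (- X)" by (simp add: matrix_mult.minus_right eq_neg_iff_add_eq_0)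
  then have "(t *\<^sub>R Y) ** M = M ** ((- t) *\<^sub>R X)" for t
    by (simp add: matrix_mult.scaleR_left matrix_mult.scaleR_right matrix_mult.minus_right)
  then have "mexp (t *\<^sub>R Y) ** M ** mexp (t *\<^sub>R X) = M ** (mexp ((- t) *\<^sub>R X) ** mexp ((- (- t)) *\<^sub>R X))" for t
    by (simp add: mexp_intertwine matrix_mul_assoc)
  then show "\<forall>t. mexp (t *\<^sub>R Y) ** M ** mexp (t *\<^sub>R X) = M"
    unfolding mexp_inverse by simp
qed

text \<open>In the Leibniz expansion the product rule takes one factor out of each product. A
  permutation other than the identity moves at least two points, so a zero entry of
  \<open>mat 1\<close> remains in all of its terms.\<close>

lemma det_mexp_deriv_0:
  "((\<lambda>t. det (mexp (t *\<^sub>R X))) has_vector_derivative trace X) (at 0)"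
proof -
  let ?E = "\<lambda>t. mexp (t *\<^sub>R X)"
  let ?D = "\<lambda>p. \<Sum>i\<in>UNIV. X $ i $ p i * (\<Prod>j\<in>UNIV - {i}. mat 1 $ j $ p j)"
  have e: "((\<lambda>t. ?E t $ i $ j) has_vector_derivative X $ i $ j) (at 0)" for i j
    using bounded_linear.has_vector_derivative[OF bounded_linear_vec_nth
        bounded_linear.has_vector_derivative[OF bounded_linear_vec_nth mexp_has_vector_derivative[of X 0]]]
    by simp
  have pr: "((\<lambda>t. \<Prod>i\<in>UNIV. ?E t $ i $ p i) has_vector_derivative ?D p) (at 0)" for p
  proof -
    have "((\<lambda>t. \<Prod>i\<in>UNIV. ?E t $ i $ p i) has_derivative
        (\<lambda>y. \<Sum>i\<in>UNIV. (y *\<^sub>R X $ i $ p i) * (\<Prod>j\<in>UNIV - {i}. ?E 0 $ j $ p j))) (at 0)"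
      by (rule has_derivative_prod) (use e in \<open>simp add: has_vector_derivative_def\<close>)
    then show ?thesis by (simp add: has_vector_derivative_def scaleR_sum_right)
  qed
  have "((\<lambda>t. det (?E t)) has_vector_derivative (\<Sum>p\<in>{p. p permutes UNIV}. of_int (sign p) * ?D p)) (at 0)"
    unfolding det_def
    by (intro has_vector_derivative_sum bounded_linear.has_vector_derivative[OF bounded_linear_mult_right] pr)
  also have "(\<Sum>p\<in>{p. p permutes UNIV}. of_int (sign p) * ?D p) = (\<Sum>p\<in>{id}. of_int (sign p) * ?D p)"
  proof (rule sum.mono_neutral_right)
    show "\<forall>p\<in>{p. p permutes UNIV} - {id}. of_int (sign p) * ?D p = 0"
    proof
      fix p :: "'a \<Rightarrow> 'a" assume p: "p \<in> {p. p permutes UNIV} - {id}"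
      have "\<exists>j. j \<noteq> i \<and> p j \<noteq> j" for i
      proof (cases "p i = i")
        case True
        then show ?thesis using p by (metis DiffE eq_id_iff insertCI)
      next
        case False
        have "inj p" using p by (auto dest: permutes_inj)
        then have "p (p i) \<noteq> p i" using False by (auto dest: injD)
        then show ?thesis using False by blast
      qed
      note moved = this
      have z: "(\<Prod>j\<in>UNIV - {i}. mat 1 $ j $ p j) = (0 :: complex)" for i
      proof -
        obtain j where "j \<noteq> i" "p j \<noteq> j" using moved by blast
        then show ?thesis by (intro prod_zero bexI[of _ j]) (auto simp: mat_def)
      qed
      show "of_int (sign p) * ?D p = 0" by (simp only: z mult_zero_right sum.neutral_const)
    qed
  qed (auto simp: permutes_id)
  also have "\<dots> = trace X"
    by (simp add: trace_def mat_def)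
  finally show ?thesis .
qed

text \<open>Only the derivative at t = 0 is at hand; multiplicativity of \<open>det\<close> and the
  one-parameter group law transport it to every t.\<close>

lemma det_mexp_eq_1_iff: "(\<forall>t. det (mexp (t *\<^sub>R X)) = 1) \<longleftrightarrow> trace X = 0"
proof
  assume "\<forall>t. det (mexp (t *\<^sub>R X)) = 1"
  then have "((\<lambda>t::real. 1) has_vector_derivative trace X) (at 0)" using det_mexp_deriv_0[of X] by simp
  then show "trace X = 0" using vector_derivative_unique_at[OF _ has_vector_derivative_const] by metis
next
  assume tr: "trace X = 0"
  have add: "mexp ((s + t) *\<^sub>R X) = mexp (t *\<^sub>R X) ** mexp (s *\<^sub>R X)" for s t
  proof -
    have "mexp ((s + t) *\<^sub>R X) = mexp ((s + t) *\<^sub>R X) ** (mexp ((- s) *\<^sub>R X) ** mexp ((- (- s)) *\<^sub>R X))"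
      unfolding mexp_inverse by simp
    also have "\<dots> = mexp (t *\<^sub>R X) ** mexp (s *\<^sub>R X)"
      unfolding matrix_mul_assoc mexp_add by simp
    finally show ?thesis .
  qed
  have "((\<lambda>t. det (mexp (t *\<^sub>R X))) has_vector_derivative 0) (at t)" for t
  proof -
    have "((\<lambda>s. det (mexp (t *\<^sub>R X)) * det (mexp (s *\<^sub>R X))) has_vector_derivative 0) (at 0)"
      using bounded_linear.has_vector_derivative[OF bounded_linear_mult_right det_mexp_deriv_0[of X]] tr by simp
    then have "((\<lambda>s. det (mexp ((s + t) *\<^sub>R X))) has_vector_derivative 0) (at 0)"
      by (simp only: add det_mul)
    then have "(((\<lambda>s. det (mexp ((s + t) *\<^sub>R X))) \<circ> (\<lambda>s. s - t)) has_vector_derivative 1 *\<^sub>R 0) (at t)"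
      by (intro vector_diff_chain_at) (auto intro!: derivative_eq_intros)
    then show ?thesis by (simp add: comp_def)
  qed
  then show "\<forall>t. det (mexp (t *\<^sub>R X)) = 1"
    using constant_if_vector_derivative_0[of "\<lambda>t. det (mexp (t *\<^sub>R X))" _ 0] by simp
qed

text \<open>Realness becomes invariance under conjugation, an equation between complex matrices like
  those defining the other groups.\<close>

lemma SO_iff: "A \<in> SO \<longleftrightarrow> mconj A = A \<and> transpose A ** A = mat 1 \<and> det A = 1"
proof -
  let ?R = "map_matrix complex_of_real :: real^'a^'a \<Rightarrow> complex^'a^'a"
  have R [simp]: "?R M $ i $ j = of_real (M $ i $ j)" for M i j
    by (simp add: map_matrix_def)
  have d: "det (?R M) = of_real (det M)" for M by (simp add: det_def)
  have m: "?R M ** ?R N = ?R (M ** N)" for M N by (simp add: vec_eq_iff matrix_matrix_mult_def)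
  have t: "transpose (?R M) = ?R (transpose M)" for M by (simp add: vec_eq_iff transpose_def)
  have o: "?R (mat 1) = mat 1" by (simp add: vec_eq_iff mat_def)
  have inj: "?R M = ?R N \<longleftrightarrow> M = N" for M N by (simp add: vec_eq_iff)
  have "\<exists>M. A = ?R M" if "mconj A = A"
  proof
    have "cnj (A $ i $ j) = A $ i $ j" for i j using that mconj_nth[of A i j] by simp
    then show "A = ?R (\<chi> i j. Re (A $ i $ j))"
      by (simp add: vec_eq_iff complex_eq_iff)
  qed
  moreover have "mconj (?R M) = ?R M" for M by (simp add: vec_eq_iff)
  moreover have "?R M \<in> SO \<longleftrightarrow> transpose (?R M) ** ?R M = mat 1 \<and> det (?R M) = 1" for M
  proof -
    have "?R M \<in> SO \<longleftrightarrow> orthogonal_matrix M \<and> det M = 1"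
      unfolding SO_def using inj by auto
    moreover have "transpose (?R M) ** ?R M = mat 1 \<longleftrightarrow> orthogonal_matrix M"
      unfolding t m o[symmetric] inj orthogonal_matrix ..
    ultimately show ?thesis using d[of M] by simp
  qed
  ultimately show ?thesis unfolding SO_def by (metis (no_types, lifting) imageE SO_def)
qed

lemma lie_algebra_SU: "lie_algebra SU = {X. madj X = - X \<and> trace X = 0}"
proof -
  have "X \<in> lie_algebra SU \<longleftrightarrow> (\<forall>t. mexp (t *\<^sub>R madj X) ** mat 1 ** mexp (t *\<^sub>R X) = mat 1) \<and> (\<forall>t. det (mexp (t *\<^sub>R X)) = 1)"
    for X :: "complex^'a^'a"
    by (auto simp: lie_algebra_def SU_def mexp_madj)
  then show ?thesis
    unfolding mexp_preserves_form_iff det_mexp_eq_1_iff by (auto simp: eq_neg_iff_add_eq_0)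
qed

lemma trace_transpose: "trace (transpose A) = trace A"
  by (simp add: trace_def)

text \<open>Given skew-symmetry, realness amounts to being skew-Hermitian, the condition shared by
  all three Lie algebras. Skew-symmetry also makes the trace vanish, as the determinant
  demands.\<close>

lemma lie_algebra_SO: "lie_algebra SO = {X. madj X = - X \<and> transpose X = - X}"
proof -
  have "X \<in> lie_algebra SO \<longleftrightarrow> (\<forall>t. mconj (mexp (t *\<^sub>R X)) = mexp (t *\<^sub>R X)) \<and>
      (\<forall>t. mexp (t *\<^sub>R transpose X) ** mat 1 ** mexp (t *\<^sub>R X) = mat 1) \<and> (\<forall>t. det (mexp (t *\<^sub>R X)) = 1)"
    for X :: "complex^'a^'a"
    by (auto simp: lie_algebra_def SO_iff mexp_transpose)
  also have "\<dots> X \<longleftrightarrow> mconj X = X \<and> transpose X = - X \<and> trace X = 0" for X :: "complex^'a^'a"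
    unfolding mexp_preserves_form_iff det_mexp_eq_1_iff mexp_mconj
    by (auto simp: eq_neg_iff_add_eq_0 intro: mexp_inject)
  also have "\<dots> X \<longleftrightarrow> madj X = - X \<and> transpose X = - X" for X :: "complex^'a^'a"
  proof -
    have "trace X = 0" if "transpose X = - X"
    proof -
      have "trace X = trace (- X)" using that trace_transpose[of X] by simp
      then show ?thesis by (simp add: trace_def sum_negf)
    qed
    moreover have "madj X = - mconj X" if "transpose X = - X"
      using that by (simp add: madj_eq linear_neg[OF bounded_linear.linear[OF bounded_linear_mconj]])
    ultimately show ?thesis by auto
  qed
  finally show ?thesis by auto
qed

lemma lie_algebra_Sp: "lie_algebra Sp = {X. madj X = - X \<and> transpose X ** Omega + Omega ** X = 0}"
proof -
  have "X \<in> lie_algebra Sp \<longleftrightarrow> (\<forall>t. mexp (t *\<^sub>R transpose X) ** Omega ** mexp (t *\<^sub>R X) = Omega) \<and>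
      (\<forall>t. mexp (t *\<^sub>R madj X) ** mat 1 ** mexp (t *\<^sub>R X) = mat 1)"
    for X :: "complex^('a \<times> 2)^('a \<times> 2)"
    by (auto simp: lie_algebra_def Sp_def mexp_madj mexp_transpose)
  then show ?thesis
    unfolding mexp_preserves_form_iff by (auto simp: eq_neg_iff_add_eq_0)
qed

section \<open>Contraction identities\<close>

text \<open>Up to the factor c, the inner products on the Lie algebras are the ambient Euclidean
  one.\<close>

lemma inner_eq_trace: "X \<bullet> Y = Re (trace (X ** madj (Y :: complex^'m^'m)))"
  by (simp add: inner_vec_def trace_def matrix_matrix_mult_def inner_complex_def)

text \<open>Basis elements have squared Euclidean length 1/c, so the sum is 1/c times the Euclidean
  projection of \<open>C\<close> onto the Lie algebra, which \<open>orth\<close> identifies with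
  \<open>P\<close>. The basis thus disappears from the answer.\<close>

lemma orthonormal_basis_projection:
  fixes B :: "(complex^'m^'m) set"
  assumes onb: "lie_orthonormal_basis c G B" and c: "c > 0" and P: "P \<in> lie_algebra G"
    and orth: "\<And>Z. Z \<in> lie_algebra G \<Longrightarrow> C \<bullet> Z = P \<bullet> Z"
  shows "(\<Sum>X\<in>B. (C \<bullet> X) *\<^sub>R X) = (1 / c) *\<^sub>R P"
proof -
  have span: "span B = lie_algebra G" using onb by (simp add: lie_orthonormal_basis_def)
  have on: "c * (X \<bullet> Y) = (if X = Y then 1 else 0)" if "X \<in> B" "Y \<in> B" for X Y
    using onb that by (auto simp: lie_orthonormal_basis_def tr_inner_def inner_eq_trace)
  have on': "X \<bullet> Y = (if X = Y then 1 / c else 0)" if "X \<in> B" "Y \<in> B" for X Y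
    using on[OF that] c by (auto simp: field_simps split: if_splits)
  have "pairwise orthogonal B" by (auto simp: pairwise_def orthogonal_def on')
  moreover have "0 \<notin> B" using on'[of 0 0] c by auto
  ultimately have "independent B" by (rule pairwise_orthogonal_independent)
  then have fin: "finite B" by (rule independent_imp_finite)
  show ?thesis
  proof (rule vector_eq_dot_span[of _ B])
    show "(\<Sum>X\<in>B. (C \<bullet> X) *\<^sub>R X) \<in> span B" by (intro span_sum span_scale span_base)
    show "(1 / c) *\<^sub>R P \<in> span B" using P span by (auto intro: span_scale)
    fix Y assume Y: "Y \<in> B"
    have "Y \<bullet> (\<Sum>X\<in>B. (C \<bullet> X) *\<^sub>R X) = (\<Sum>X\<in>B. (C \<bullet> X) * (if Y = X then 1 / c else 0))"
      unfolding inner_sum_right inner_scaleR_right using on'[OF Y] by (intro sum.cong) auto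
    also have "\<dots> = (C \<bullet> Y) / c" using Y fin by (simp add: if_distrib cong: if_cong)
    also have "C \<bullet> Y = P \<bullet> Y" using orth Y span span_base by metis
    finally show "Y \<bullet> (\<Sum>X\<in>B. (C \<bullet> X) *\<^sub>R X) = Y \<bullet> ((1 / c) *\<^sub>R P)"
      by (simp add: inner_commute)
  qed
qed

lemma trace_cnj: "trace (madj A) = cnj (trace A)"
  by (simp add: trace_def)

lemma inner_madj: "madj C \<bullet> Z = C \<bullet> madj (Z :: complex^'m^'m)"
proof -
  have "trace (madj C ** madj Z) = cnj (trace (Z ** C))" by (simp flip: madj_mult trace_cnj)
  then show ?thesis by (simp add: inner_eq_trace trace_mul_sym[of Z C])
qed

section \<open>Sums over a basis in terms of the projection onto the Lie algebra\<close>

definition unit_matrix :: "'m \<Rightarrow> 'm \<Rightarrow> complex^'m^'m" where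
  "unit_matrix a b = (\<chi> i j. if i = a \<and> j = b then 1 else 0)"

lemma trace_unit_matrix_mult: "trace (unit_matrix a b ** X) = X $ b $ a"
proof -
  have "(\<Sum>k\<in>UNIV. (if i = a \<and> k = b then 1 else 0) * X $ k $ i) = (if i = a then X $ b $ i else 0)" for i
    by (cases "i = a") (simp_all add: if_distrib[of "\<lambda>x. x * _"] cong: if_cong)
  then show ?thesis by (simp add: trace_def matrix_matrix_mult_def unit_matrix_def)
qed

lemma scaleR_eq_mscale: "r *\<^sub>R A = mscale (of_real r) A"
  by (simp add: vec_eq_iff scaleR_conv_of_real[where 'a=complex])

text \<open>The complexification of the Lie algebra is the range of the complex linear projection \<open>p\<close>, and
  \<open>C \<mapsto> (p C - p (madj C)) / 2\<close> is the real orthogonal projection onto the Lie algebra itself.\<close>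

locale lie_projection =
  fixes c :: real and G :: "(complex^'m^'m) set" and p :: "complex^'m^'m \<Rightarrow> complex^'m^'m"
    and B :: "(complex^'m^'m) set"
  assumes onb: "lie_orthonormal_basis c G B" and c: "c > 0"
    and lie: "lie_algebra G = {Z. madj Z = - Z \<and> p Z = Z}"
    and p_add: "p (C + D) = p C + p D" and p_mscale: "p (mscale z C) = mscale z (p C)"
    and p_madj: "p (madj C) = madj (p C)" and p_idem: "p (p C) = p C"
    and p_inner: "p C \<bullet> Z = C \<bullet> p Z"
begin

lemma basis_lie: "X \<in> B \<Longrightarrow> X \<in> lie_algebra G"
  using onb by (auto simp: lie_orthonormal_basis_def intro: span_base)

definition proj :: "complex^'m^'m \<Rightarrow> complex^'m^'m" where
  "proj C = mscale (1 / 2) (p C - p (madj C))"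

lemma p_diff: "p (C - D) = p C - p D"
proof -
  have "p (- D) = - p D" using p_mscale[of "-1" D] by (simp add: mscale_uminus_left)
  then show ?thesis using p_add[of C "- D"] by simp
qed

lemma sum_inner_basis: "(\<Sum>X\<in>B. (C \<bullet> X) *\<^sub>R X) = (1 / c) *\<^sub>R proj C"
proof (rule orthonormal_basis_projection[OF onb c])
  have "madj (proj C) = - proj C"
    unfolding proj_def p_madj by (simp add: vec_eq_iff field_simps)
  moreover have "p (proj C) = proj C" by (simp add: proj_def p_mscale p_diff p_idem)
  ultimately show "proj C \<in> lie_algebra G" by (simp add: lie)
  fix Z assume "Z \<in> lie_algebra G"
  then have Z: "madj Z = - Z" "p Z = Z" by (simp_all add: lie)
  have "proj C = (1 / 2) *\<^sub>R (p C - p (madj C))" by (simp add: proj_def scaleR_eq_mscale)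
  then have "proj C \<bullet> Z = (1 / 2) * (C \<bullet> p Z - madj C \<bullet> p Z)"
    by (simp add: inner_diff_left p_inner)
  then show "C \<bullet> Z = proj C \<bullet> Z" by (simp add: Z inner_madj)
qed

text \<open>The Euclidean product sees only the real part of \<open>trace (C ** X)\<close>; the
  imaginary part comes from \<open>mscale \<i> C\<close>. In the combination the terms with
  \<open>madj C\<close> cancel, leaving the complex linear \<open>p\<close>.\<close>

lemma sum_trace_basis: "(\<Sum>X\<in>B. mscale (trace (C ** X)) X) = mscale (- 1 / c) (p C)"
proof -
  have tr: "trace (C ** X) = - of_real (C \<bullet> X) + \<i> * of_real (mscale \<i> C \<bullet> X)" if "X \<in> B" for X
  proof -
    have "madj X = - X" using basis_lie[OF that] by (simp add: lie)
    then have "C \<bullet> X = - Re (trace (C ** X))" "mscale \<i> C \<bullet> X = - Re (\<i> * trace (C ** X))"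
      by (simp_all add: inner_eq_trace matrix_mult.minus_right mscale_matrix_mult trace_mscale
          flip: trace_mscale) (simp_all add: trace_def sum_negf)
    then show ?thesis by (simp add: complex_eq_iff)
  qed
  have "(\<Sum>X\<in>B. mscale (trace (C ** X)) X) =
      - (\<Sum>X\<in>B. (C \<bullet> X) *\<^sub>R X) + mscale \<i> (\<Sum>X\<in>B. (mscale \<i> C \<bullet> X) *\<^sub>R X)"
    unfolding mscale_sum sum_negf[symmetric] sum.distrib[symmetric]
    by (intro sum.cong refl) (simp add: tr mscale_add_left mscale_uminus_left mscale_diff_left scaleR_eq_mscale)
  also have "\<dots> = - ((1 / c) *\<^sub>R proj C) + mscale \<i> ((1 / c) *\<^sub>R proj (mscale \<i> C))"
    by (simp only: sum_inner_basis)
  also have "\<dots> = mscale (- 1 / c) (p C)"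
  proof -
    have m: "madj (mscale \<i> C) = mscale (- \<i>) (madj C)" by (simp add: vec_eq_iff)
    have "proj (mscale \<i> C) = mscale (1 / 2) (mscale \<i> (p C) + mscale \<i> (p (madj C)))"
      unfolding proj_def m p_mscale unfolding mscale_uminus_left by simp
    then show ?thesis unfolding proj_def[of C]
      using c by (simp only:) (simp add: vec_eq_iff scaleR_conv_of_real[where 'a=complex] field_simps)
  qed
  finally show ?thesis .
qed

text \<open>The entry (a, q) of \<open>X\<close> is \<open>trace (unit_matrix q a ** X)\<close>, so
  the sum of products of two entries is an entry of \<open>sum_trace_basis\<close>.\<close>

lemma sum_sandwich_basis:
  "(\<Sum>X\<in>B. X ** C ** X) $ a $ b = (- 1 / c) * (\<Sum>q\<in>UNIV. \<Sum>r\<in>UNIV. C $ q $ r * p (unit_matrix q a) $ r $ b)"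
proof -
  have *: "(\<Sum>X\<in>B. X $ a $ q * X $ r $ b) = (- 1 / c) * p (unit_matrix q a) $ r $ b" for q r
  proof -
    have "(\<Sum>X\<in>B. X $ a $ q * X $ r $ b) = (\<Sum>X\<in>B. mscale (trace (unit_matrix q a ** X)) X) $ r $ b"
      by (simp add: trace_unit_matrix_mult)
    then show ?thesis unfolding sum_trace_basis by simp
  qed
  have "(X ** C ** X) $ a $ b = (\<Sum>q\<in>UNIV. \<Sum>r\<in>UNIV. C $ q $ r * (X $ a $ q * X $ r $ b))" for X
    unfolding matrix_matrix_mult_def by (simp add: sum_distrib_right) (subst sum.swap, simp add: mult_ac)
  then have "(\<Sum>X\<in>B. X ** C ** X) $ a $ b = (\<Sum>X\<in>B. \<Sum>q\<in>UNIV. \<Sum>r\<in>UNIV. C $ q $ r * (X $ a $ q * X $ r $ b))"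
    by simp
  also have "\<dots> = (\<Sum>q\<in>UNIV. \<Sum>r\<in>UNIV. \<Sum>X\<in>B. C $ q $ r * (X $ a $ q * X $ r $ b))"
    by (subst sum.swap) (intro sum.cong refl sum.swap)
  also have "\<dots> = (\<Sum>q\<in>UNIV. \<Sum>r\<in>UNIV. C $ q $ r * ((- 1 / c) * p (unit_matrix q a) $ r $ b))"
    by (simp only: * flip: sum_distrib_left)
  finally show ?thesis by (simp add: sum_distrib_left mult_ac sum_negf sum_divide_distrib)
qed

end

text \<open>Meant for the transpose on \<open>SO\<close> and \<open>symp\<close> on
  \<open>Sp\<close>: it turns the reflected half of the projection into negative powers. The
  reversed order does no harm among powers of one matrix.\<close>

lemma antihom_mpowi:
  fixes A :: "complex^'m^'m"
  assumes L: "\<And>C D. L (C ** D) = L D ** L C" "L (mat 1) = mat 1" "L A = matrix_inv A" and A: "invertible A"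
  shows "L (mpowi A k) = mpowi A (- k)"
proof (induction k rule: int_induct[of _ 0])
  case base
  then show ?case by (simp add: L)
next
  case (step1 k)
  have "L (mpowi A (k + 1)) = mpowi A (- k) ** mpowi A (- 1)"
    by (simp add: mpowi_plus1[OF A] L step1 mpowi_m1)
  then show ?case by (simp flip: mpowi_add[OF A])
next
  case (step2 k)
  have "matrix_inv A ** L (matrix_inv A) = mat 1"
    using L(1)[of "matrix_inv A" A] by (simp add: L(2,3) matrix_inv[OF A])
  then have Li: "L (matrix_inv A) = A"
    using matrix_inv(1)[OF A] by (metis matrix_mul_assoc matrix_mul_lid matrix_mul_rid)
  have "mpowi A (k - 1) = matrix_inv A ** mpowi A k"
    using mpowi_add[OF A, of "-1" k] by (simp add: mpowi_m1)
  then have "L (mpowi A (k - 1)) = mpowi A (- k) ** mpowi A 1"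
    by (simp add: L(1) step2 Li)
  then show ?case using mpowi_add[OF A, of "- k" 1] by simp
qed

lemma ntr_unit_matrix: "ntr (unit_matrix a b :: complex^'m^'m) = (if a = b then 1 / of_nat CARD('m) else 0)"
proof -
  have "trace (unit_matrix a b) = (mat 1 :: complex^'m^'m) $ b $ a"
    using trace_unit_matrix_mult[of a b "mat 1"] by simp
  then show ?thesis by (auto simp: ntr_def mat_def)
qed

lemma transpose_linear:
  "transpose (A + B) = transpose A + transpose B" "transpose (A - B) = transpose A - transpose B"
  "transpose (mscale c C) = mscale c (transpose C)"
  by (simp_all add: vec_eq_iff)

lemma trace_madj_madj: "trace (A ** madj B) = (\<Sum>i\<in>UNIV. \<Sum>j\<in>UNIV. A $ i $ j * cnj (B $ i $ j))"
  by (simp add: trace_def matrix_matrix_mult_def)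

lemma inner_transpose: "transpose C \<bullet> Z = C \<bullet> transpose (Z :: complex^'m^'m)"
  unfolding inner_eq_trace trace_madj_madj by (subst sum.swap) simp

lemma inner_mscale_half:
  "mscale (1 / 2) C \<bullet> Z = 1 / 2 * (C \<bullet> Z)" "C \<bullet> mscale (1 / 2) Z = 1 / 2 * (C \<bullet> Z)"
proof -
  have "mscale (1 / 2) A = (1 / 2) *\<^sub>R A" for A :: "complex^'a^'a" by (simp add: scaleR_eq_mscale)
  then show "mscale (1 / 2) C \<bullet> Z = 1 / 2 * (C \<bullet> Z)" "C \<bullet> mscale (1 / 2) Z = 1 / 2 * (C \<bullet> Z)"
    by simp_all
qed

lemma lie_projection_SU:
  assumes "lie_orthonormal_basis (real CARD('m)) (SU :: (complex^'m^'m) set) B"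
  shows "lie_projection (real CARD('m)) SU (\<lambda>C. C - mscale (ntr C) (mat 1)) B"
proof (rule lie_projection.intro[OF assms])
  let ?p = "\<lambda>C :: complex^'m^'m. C - mscale (ntr C) (mat 1)"
  show "lie_algebra SU = {Z. madj Z = - Z \<and> ?p Z = Z}"
  proof -
    have "mscale (ntr Z) (mat 1) = 0 \<longleftrightarrow> trace Z = 0" for Z :: "complex^'m^'m"
      by (auto simp: vec_eq_iff mat_def ntr_def split: if_splits)
    then show ?thesis unfolding lie_algebra_SU by auto
  qed
  show "?p (C + D) = ?p C + ?p D" "?p (mscale z C) = mscale z (?p C)" for C D z
    by (simp_all add: ntr_add ntr_mscale mscale_add_left mscale_diff)
  show "?p (madj C) = madj (?p C)" for C
    by (simp add: vec_eq_iff mat_def ntr_def trace_cnj)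
  show "?p (?p C) = ?p C" for C
    by (simp add: ntr_diff ntr_mscale)
  have t1: "trace (mscale (ntr C) (mat 1) ** madj Z) = ntr C * cnj (trace Z)" for C Z :: "complex^'m^'m"
    by (simp add: mscale_matrix_mult trace_mscale trace_cnj)
  have t2: "trace (C ** madj (mscale (ntr Z) (mat 1))) = trace C * cnj (ntr Z)" for C Z :: "complex^'m^'m"
  proof -
    have "madj (mscale (ntr Z) (mat 1)) = mscale (cnj (ntr Z)) (mat 1 :: complex^'m^'m)"
      by (simp add: vec_eq_iff mat_def)
    then show ?thesis by (simp add: mscale_matrix_mult trace_mscale)
  qed
  have t3: "ntr C * cnj (trace Z) = trace C * cnj (ntr Z)" for C Z :: "complex^'m^'m"
    by (simp add: ntr_def)
  show "?p C \<bullet> Z = C \<bullet> ?p Z" for C Z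
    unfolding inner_diff_left inner_diff_right unfolding inner_eq_trace t1 t2 t3 ..
qed simp

lemma lie_projection_SO:
  assumes "lie_orthonormal_basis (real CARD('m) / 2) (SO :: (complex^'m^'m) set) B"
  shows "lie_projection (real CARD('m) / 2) SO (\<lambda>C. mscale (1 / 2) (C - transpose C)) B"
proof (rule lie_projection.intro[OF assms])
  let ?p = "\<lambda>C :: complex^'m^'m. mscale (1 / 2) (C - transpose C)"
  show "lie_algebra SO = {Z. madj Z = - Z \<and> ?p Z = Z}"
  proof -
    have "?p Z = Z \<longleftrightarrow> transpose Z = - Z" for Z :: "complex^'m^'m"
      by (auto simp: vec_eq_iff field_simps eq_neg_iff_add_eq_0 add.commute)
    then show ?thesis unfolding lie_algebra_SO by simp
  qed
  show "?p (C + D) = ?p C + ?p D" "?p (mscale z C) = mscale z (?p C)" "?p (madj C) = madj (?p C)"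
    "?p (?p C) = ?p C" for C D z
    by (simp_all add: vec_eq_iff field_simps)
  show "?p C \<bullet> Z = C \<bullet> ?p Z" for C Z
    by (simp add: inner_mscale_half inner_diff_left inner_diff_right inner_transpose)
qed simp

section \<open>The symplectic anti-involution\<close>

abbreviation Om :: "complex^('n::finite \<times> 2)^('n \<times> 2)" where
  "Om \<equiv> Omega"

lemma Omega_nth: "Om $ (a, s) $ (b, t) = (if a = b then Omega0 $ s $ t else 0)"
  by (simp add: Omega_def)

lemma Omega0_nth: "Omega0 $ 1 $ 1 = 0" "Omega0 $ 1 $ 2 = 1" "Omega0 $ 2 $ 1 = -1" "Omega0 $ 2 $ 2 = 0"
  by (simp_all add: Omega0_def)

lemma transpose_Omega: "transpose Om = - Om"
  by (auto simp: vec_eq_iff Omega_nth forall_2 Omega0_nth)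

lemma madj_Omega: "madj Om = - Om"
  by (auto simp: vec_eq_iff Omega_nth forall_2 Omega0_nth)

lemma Omega_squared: "Om ** Om = - mat 1"
proof -
  have "(\<Sum>x\<in>UNIV. Om $ p $ x * Om $ x $ q) = (\<Sum>b\<in>UNIV. \<Sum>t\<in>UNIV. Om $ p $ (b, t) * Om $ (b, t) $ q)" for p q :: "'a \<times> 2"
    unfolding UNIV_Times_UNIV[symmetric] by (rule sum.cartesian_product[symmetric, where g="\<lambda>b t. Om $ p $ (b, t) * Om $ (b, t) $ q", simplified])
  then show ?thesis
    by (auto simp: vec_eq_iff matrix_matrix_mult_def Omega_nth forall_2 Omega0_nth sum_2 mat_def if_distrib cong: if_cong)
qed

text \<open>The adjoint with respect to the bilinear form \<open>Omega\<close>: as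
  \<open>Omega\<close> squares to -1, this is the inverse of \<open>Omega\<close> times the
  transpose times \<open>Omega\<close>.\<close>

definition symp :: "complex^('n::finite \<times> 2)^('n \<times> 2) \<Rightarrow> complex^('n \<times> 2)^('n \<times> 2)" where
  "symp C = - (Omega ** transpose C ** Omega)"

lemma symp_linear:
  "symp (A + B) = symp A + symp B" "symp (A - B) = symp A - symp B" "symp (mscale z A) = mscale z (symp A)"
  by (simp_all add: symp_def transpose_linear matrix_mult.add_left matrix_mult.add_right matrix_mult.diff_left
      matrix_mult.diff_right mscale_matrix_mult mscale_uminus)

lemma symp_mult: "symp (C ** D) = symp D ** symp C"
proof -
  have "symp D ** symp C = Omega ** transpose D ** (Omega ** Omega) ** transpose C ** Omega"
    by (simp add: symp_def matrix_mult.minus_left matrix_mult.minus_right matrix_mul_assoc)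
  then show ?thesis
    by (simp add: symp_def Omega_squared matrix_transpose_mul matrix_mult.minus_left matrix_mult.minus_right matrix_mul_assoc)
qed

lemma symp_mat_1: "symp (mat 1) = mat 1"
  by (simp add: symp_def Omega_squared)

lemma symp_symp: "symp (symp C) = C"
proof -
  have "symp (symp C) = (Omega ** Omega) ** C ** (Omega ** Omega)"
    by (simp add: symp_def matrix_transpose_mul transpose_Omega linear_neg[OF bounded_linear.linear[OF bounded_linear_transpose]]
        matrix_mult.minus_left matrix_mult.minus_right matrix_mul_assoc)
  then show ?thesis by (simp add: Omega_squared matrix_mult.minus_left matrix_mult.minus_right)
qed

lemma symp_madj: "symp (madj C) = madj (symp C)"
proof -
  have "madj (transpose C) = transpose (madj C)" by (simp add: vec_eq_iff)
  then show ?thesis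
    by (simp add: symp_def madj_mult madj_Omega linear_neg[OF bounded_linear.linear[OF bounded_linear_madj]]
        matrix_mult.minus_left matrix_mult.minus_right matrix_mul_assoc)
qed

lemma symp_inner: "symp C \<bullet> Z = C \<bullet> symp Z"
proof -
  have t: "trace (symp M) = trace M" for M :: "complex^('a \<times> 2)^('a \<times> 2)"
  proof -
    have "trace (Omega ** transpose M ** Omega) = trace (Omega ** (Omega ** transpose M))"
      by (rule trace_mul_sym)
    also have "\<dots> = trace (- transpose M)"
      by (simp add: matrix_mul_assoc Omega_squared matrix_mult.minus_left)
    finally show ?thesis
      by (simp add: symp_def trace_def sum_negf)
  qed
  have "trace (symp C ** madj Z) = trace (symp (symp (madj Z) ** C))"
    by (simp add: symp_mult symp_symp)
  then show ?thesis by (simp add: inner_eq_trace t trace_mul_sym[of _ C] symp_madj)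
qed

lemma lie_projection_Sp:
  assumes "lie_orthonormal_basis (real CARD('n::finite)) (Sp :: (complex^('n \<times> 2)^('n \<times> 2)) set) B"
  shows "lie_projection (real CARD('n)) Sp (\<lambda>C. mscale (1 / 2) (C - symp C)) B"
proof (rule lie_projection.intro[OF assms])
  let ?p = "\<lambda>C :: complex^('n \<times> 2)^('n \<times> 2). mscale (1 / 2) (C - symp C)"
  show "lie_algebra Sp = {Z. madj Z = - Z \<and> ?p Z = Z}"
  proof -
    have "?p Z = Z \<longleftrightarrow> symp Z = - Z" for Z :: "complex^('n \<times> 2)^('n \<times> 2)"
      by (auto simp: vec_eq_iff field_simps eq_neg_iff_add_eq_0 add.commute)
    moreover have "symp Z = - Z \<longleftrightarrow> transpose Z ** Omega + Omega ** Z = 0" for Z :: "complex^('n \<times> 2)^('n \<times> 2)"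
    proof -
      have i: "Omega ** X = Omega ** Y \<longleftrightarrow> X = Y" for X Y :: "complex^('n \<times> 2)^('n \<times> 2)"
      proof
        assume "Omega ** X = Omega ** Y"
        then have "(Omega ** Omega) ** X = (Omega ** Omega) ** Y" by (simp flip: matrix_mul_assoc)
        then show "X = Y" by (simp add: Omega_squared matrix_mult.minus_left)
      qed simp
      have e: "Omega ** (- (Omega ** Z)) = Z"
        by (simp add: matrix_mult.minus_left matrix_mult.minus_right matrix_mul_assoc Omega_squared)
      have "symp Z = - Z \<longleftrightarrow> Omega ** (transpose Z ** Omega) = Z"
        by (simp add: symp_def matrix_mul_assoc)
      also have "\<dots> \<longleftrightarrow> Omega ** (transpose Z ** Omega) = Omega ** (- (Omega ** Z))"
        unfolding e ..
      finally show ?thesis by (simp add: i eq_neg_iff_add_eq_0)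
    qed
    ultimately show ?thesis unfolding lie_algebra_Sp by simp
  qed
  show "?p (C + D) = ?p C + ?p D" "?p (mscale z C) = mscale z (?p C)" "?p (?p C) = ?p C" for C D z
    by (simp_all add: symp_linear symp_symp) (simp_all add: vec_eq_iff field_simps)
  show "?p (madj C) = madj (?p C)" for C
    unfolding symp_madj by (simp add: vec_eq_iff)
  show "?p C \<bullet> Z = C \<bullet> ?p Z" for C Z
    by (simp add: inner_mscale_half inner_diff_left inner_diff_right symp_inner)
qed simp

section \<open>The three families of groups\<close>

text \<open>Here the plus and minus parts of \<open>op_K1\<close> and \<open>op_K2\<close> have
  equal weight. \<open>D_op_Beta2\<close> has the minus parts alone, which is why \<epsilon> and
  \<delta> are separate constants.\<close>

lemma D_op_Beta1: "D_op Beta1 N = contraction_constants.Dop (1 / of_nat N) (1 / of_nat N ^ 2) (1 / of_nat N ^ 2) 0"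
  by (simp add: fun_eq_iff D_op_def contraction_constants.Dop_def L2_real_def op_K1_def op_K2_def
      scl_def algebra_simps)

lemma D_op_Beta2: "D_op Beta2 N = contraction_constants.Dop 0 0 (1 / of_nat N ^ 2) (1 / of_nat N ^ 2)"
  by (simp add: fun_eq_iff D_op_def contraction_constants.Dop_def scl_def algebra_simps)

lemma D_op_Beta4: "D_op Beta4 N = contraction_constants.Dop (- 1 / (2 * of_nat N)) (1 / (4 * of_nat N ^ 2)) (1 / (4 * of_nat N ^ 2)) 0"
proof -
  have "scl (1 / of_nat N) (scl (- 1 / 2) P) = scl (- 1 / (2 * of_nat N)) P"
    "scl (1 / of_nat N ^ 2) (scl (1 / 4) P) = scl (1 / (4 * of_nat N ^ 2)) P" for P
    by (simp_all add: mult.commute)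
  then show ?thesis
    unfolding fun_eq_iff D_op_def contraction_constants.Dop_def L1.simps L2.simps L2_real_def op_K1_def op_K2_def
    by (simp only: scl_0) (simp add: scl_def algebra_simps)
qed

text \<open>The number c times the matrix size is N^2/2 for \<open>SO\<close>, N^2 for
  \<open>SU\<close> and 2 N^2 for \<open>Sp\<close>. With the factor 1/2 in \<open>p\<close> for
  \<open>SO\<close> and \<open>Sp\<close> this gives the weights 1/N^2, 1/N^2 and 1/(4 N^2).\<close>

lemma (in lie_projection) sum_ntr_basis:
  "(\<Sum>X\<in>B. mscale (ntr (C ** X)) X) = mscale (- 1 / (of_real c * of_nat CARD('m))) (p C)"
proof -
  have "(\<Sum>X\<in>B. mscale (ntr (C ** X)) X) = mscale (1 / of_nat CARD('m)) (\<Sum>X\<in>B. mscale (trace (C ** X)) X)"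
    by (simp add: ntr_def mscale_sum)
  then show ?thesis unfolding sum_trace_basis by (simp add: mult.commute)
qed

lemma (in lie_projection) flow_closed:
  assumes "\<And>A C. A \<in> G \<Longrightarrow> C \<in> G \<Longrightarrow> A ** C \<in> G" "A \<in> G" "X \<in> B"
  shows "A ** mexp (t *\<^sub>R X) \<in> G"
  using assms basis_lie[of X] by (auto simp: lie_algebra_def)

text \<open>The two ways in which \<open>sum_sandwich_basis\<close> contracts \<open>C\<close>: the
  identity part of \<open>p\<close> yields the trace, a transposing part the transposed
  matrix.\<close>

lemma sum_unit_matrix:
  fixes C :: "complex^'m^'m"
  shows "(\<Sum>q\<in>UNIV. \<Sum>r\<in>UNIV. C $ q $ r * unit_matrix q a $ r $ b) = (trace C * mat 1 $ a $ b)"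
    and "(\<Sum>q\<in>UNIV. \<Sum>r\<in>UNIV. C $ q $ r * unit_matrix q a $ b $ r) = C $ b $ a"
proof -
  have "(\<Sum>r\<in>UNIV. C $ q $ r * unit_matrix q a $ r $ b) = (if a = b then C $ q $ q else 0)" for q
    by (cases "a = b") (auto simp: unit_matrix_def if_distrib cong: if_cong)
  then show "(\<Sum>q\<in>UNIV. \<Sum>r\<in>UNIV. C $ q $ r * unit_matrix q a $ r $ b) = (trace C * mat 1 $ a $ b)"
    by (simp add: trace_def mat_def)
  have "(\<Sum>r\<in>UNIV. C $ q $ r * unit_matrix q a $ b $ r) = (if q = b then C $ q $ a else 0)" for q
    by (cases "q = b") (auto simp: unit_matrix_def if_distrib cong: if_cong)
  then show "(\<Sum>q\<in>UNIV. \<Sum>r\<in>UNIV. C $ q $ r * unit_matrix q a $ b $ r) = C $ b $ a"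
    by simp
qed

lemma tp_eval_contr:
  "tp_eval (contraction_constants.contr \<alpha> \<gamma> k) A =
    - mat (ntr (mpowi A k)) + mscale \<alpha> (mpowi A (- k)) + mscale \<gamma> (mpowi A k)"
  by (simp add: contraction_constants.contr_def tp_eval_linear tp_eval_v_var tp_eval_u_pow)

lemma tp_eval_contr2:
  "tp_eval (contraction_constants.contr2 \<epsilon> \<delta> \<gamma> k) A =
    mscale \<epsilon> (mpowi A (- k)) - mscale \<delta> (mpowi A k) + mscale (\<gamma> * ntr (mpowi A k)) (mat 1)"
  by (simp add: contraction_constants.contr2_def tp_eval_linear tp_eval_v_var tp_eval_u_pow
      mat_eq_mscale[of "ntr _"])

lemma contraction_basis_SU:
  assumes "lie_orthonormal_basis (real CARD('n)) (SU :: (complex^'n^'n) set) B"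
  shows "contraction_basis 0 0 (1 / of_nat CARD('n) ^ 2) (1 / of_nat CARD('n) ^ 2) B SU"
proof
  interpret lie_projection "real CARD('n)" SU "\<lambda>C. C - mscale (ntr C) (mat 1)" B
    using assms by (rule lie_projection_SU)
  fix A :: "complex^'n^'n" and k assume "A \<in> SU"
  then have A: "madj A ** A = mat 1" by (simp add: SU_def)
  then show "invertible A" by (auto simp: invertible_left_inverse)
  show "(\<Sum>X\<in>B. X ** mpowi A k ** X) = tp_eval (contraction_constants.contr 0 (1 / of_nat CARD('n) ^ 2) k) A"
  proof -
    let ?C = "mpowi A k"
    have "(\<Sum>X\<in>B. X ** ?C ** X) $ a $ b = (- ntr ?C * mat 1 $ a $ b + 1 / of_nat CARD('n) ^ 2 * ?C $ a $ b)" for a b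
    proof -
      \<comment> \<open>The subtracted trace is nonzero only for q = a and reproduces
        \<open>?C\<close> itself; this is the origin of \<gamma>.\<close>
      have "(\<Sum>r\<in>UNIV. ?C $ q $ r * (ntr (unit_matrix q a) * mat 1 $ r $ b)) = (if q = a then ?C $ q $ b / of_nat CARD('n) else 0)" for q
        by (cases "q = a") (simp_all add: ntr_unit_matrix mat_def if_distrib cong: if_cong)
      then have "(\<Sum>q\<in>UNIV. \<Sum>r\<in>UNIV. ?C $ q $ r * (unit_matrix q a - mscale (ntr (unit_matrix q a)) (mat 1)) $ r $ b)
        = trace ?C * mat 1 $ a $ b - ?C $ a $ b / of_nat CARD('n)"
        by (simp add: right_diff_distrib sum_subtractf sum_unit_matrix)
      then show ?thesis unfolding sum_sandwich_basis by (simp add: ntr_def field_simps power2_eq_square)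
    qed
    then show ?thesis by (simp add: tp_eval_contr vec_eq_iff mat_eq_mscale[of "ntr _"])
  qed
  show "(\<Sum>X\<in>B. mscale (ntr (mpowi A k ** X)) X) =
      tp_eval (contraction_constants.contr2 0 (1 / of_nat CARD('n) ^ 2) (1 / of_nat CARD('n) ^ 2) k) A"
    unfolding sum_ntr_basis tp_eval_contr2 by (simp add: mscale_diff mscale_uminus_left power2_eq_square)
qed

lemma SU_mult: "A \<in> SU \<Longrightarrow> C \<in> SU \<Longrightarrow> A ** C \<in> SU"
proof -
  assume "A \<in> SU" "C \<in> SU"
  moreover have "madj (A ** C) ** (A ** C) = madj C ** (madj A ** A) ** C"
    by (simp add: madj_mult matrix_mul_assoc)
  ultimately show ?thesis by (simp add: SU_def det_mul)
qed

lemma SO_mult: "A \<in> SO \<Longrightarrow> C \<in> SO \<Longrightarrow> A ** C \<in> SO"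
proof -
  assume "A \<in> SO" "C \<in> SO"
  moreover have "transpose (A ** C) ** (A ** C) = transpose C ** (transpose A ** A) ** C"
    by (simp add: matrix_transpose_mul matrix_mul_assoc)
  ultimately show ?thesis by (simp add: SO_iff det_mul mconj_mult)
qed

lemma Sp_mult: "A \<in> Sp \<Longrightarrow> C \<in> Sp \<Longrightarrow> A ** C \<in> Sp"
proof -
  assume "A \<in> Sp" "C \<in> Sp"
  moreover have "madj (A ** C) ** (A ** C) = madj C ** (madj A ** A) ** C"
    by (simp add: madj_mult matrix_mul_assoc)
  moreover have "transpose (A ** C) ** Omega ** (A ** C) = transpose C ** (transpose A ** Omega ** A) ** C"
    by (simp add: matrix_transpose_mul matrix_mul_assoc)
  ultimately show ?thesis by (simp add: Sp_def)
qed

lemma contraction_basis_SO: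
  assumes "lie_orthonormal_basis (real CARD('n) / 2) (SO :: (complex^'n^'n) set) B"
  shows "contraction_basis (1 / of_nat CARD('n)) (1 / of_nat CARD('n) ^ 2) (1 / of_nat CARD('n) ^ 2) 0 B SO"
proof
  interpret lie_projection "real CARD('n) / 2" SO "\<lambda>C. mscale (1 / 2) (C - transpose C)" B
    using assms by (rule lie_projection_SO)
  fix A :: "complex^'n^'n" and k assume "A \<in> SO"
  then have A: "transpose A ** A = mat 1" by (simp add: SO_iff)
  then show iA: "invertible A" by (auto simp: invertible_left_inverse)
  have "A ** transpose A = mat 1" using A by (simp add: matrix_left_right_inverse)
  then have T: "transpose (mpowi A k) = mpowi A (- k)"
    by (intro antihom_mpowi[OF _ _ _ iA]) (auto simp: matrix_transpose_mul matrix_inv_unique)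
  show "(\<Sum>X\<in>B. X ** mpowi A k ** X) = tp_eval (contraction_constants.contr (1 / of_nat CARD('n)) 0 k) A"
  proof -
    let ?C = "mpowi A k"
    have "(\<Sum>X\<in>B. X ** ?C ** X) $ a $ b = (- ntr ?C * mat 1 $ a $ b + 1 / of_nat CARD('n) * transpose ?C $ a $ b)" for a b
    proof -
      \<comment> \<open>Multiplied by - 1/c = - 2/N, the trace becomes - \<open>ntr ?C\<close> and
        the transpose gets the weight \<alpha> = 1/N.\<close>
      have "(\<Sum>q\<in>UNIV. \<Sum>r\<in>UNIV. ?C $ q $ r * mscale (1 / 2) (unit_matrix q a - transpose (unit_matrix q a)) $ r $ b)
        = 1 / 2 * (trace ?C * mat 1 $ a $ b - transpose ?C $ a $ b)"
        unfolding transpose_nth sum_unit_matrix(2)[of ?C a b, symmetric] sum_unit_matrix(1)[of ?C a b, symmetric]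
        by (simp add: right_diff_distrib sum_subtractf sum_divide_distrib diff_divide_distrib)
      then show ?thesis unfolding sum_sandwich_basis by (simp add: ntr_def field_simps)
    qed
    then show ?thesis by (simp add: tp_eval_contr vec_eq_iff mat_eq_mscale[of "ntr _"] flip: T)
  qed
  show "(\<Sum>X\<in>B. mscale (ntr (mpowi A k ** X)) X) =
      tp_eval (contraction_constants.contr2 (1 / of_nat CARD('n) ^ 2) (1 / of_nat CARD('n) ^ 2) 0 k) A"
    unfolding sum_ntr_basis tp_eval_contr2 T by (simp add: mscale_diff mscale_uminus_left power2_eq_square)
qed

lemma contraction_basis_Sp:
  assumes "lie_orthonormal_basis (real CARD('n::finite)) (Sp :: (complex^('n \<times> 2)^('n \<times> 2)) set) B"
  shows "contraction_basis (- 1 / (2 * of_nat CARD('n))) (1 / (4 * of_nat CARD('n) ^ 2)) (1 / (4 * of_nat CARD('n) ^ 2)) 0 B Sp"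
proof
  interpret lie_projection "real CARD('n)" Sp "\<lambda>C. mscale (1 / 2) (C - symp C)" B
    using assms by (rule lie_projection_Sp)
  fix A :: "complex^('n \<times> 2)^('n \<times> 2)" and k assume "A \<in> Sp"
  then have A: "madj A ** A = mat 1" "transpose A ** Omega ** A = Omega" by (simp_all add: Sp_def)
  then show iA: "invertible A" by (auto simp: invertible_left_inverse)
  have "symp A ** A = - (Omega ** (transpose A ** Omega ** A))"
    by (simp add: symp_def matrix_mult.minus_left matrix_mul_assoc)
  then have "symp A ** A = mat 1" by (simp add: A Omega_squared)
  then have "A ** symp A = mat 1" by (simp add: matrix_left_right_inverse)
  then have T: "symp (mpowi A k) = mpowi A (- k)"
    by (intro antihom_mpowi[OF _ _ _ iA]) (auto simp: symp_mult symp_mat_1 matrix_inv_unique)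
  show "(\<Sum>X\<in>B. X ** mpowi A k ** X) = tp_eval (contraction_constants.contr (- 1 / (2 * of_nat CARD('n))) 0 k) A"
  proof -
    let ?C = "mpowi A k"
    have "(\<Sum>X\<in>B. X ** ?C ** X) $ a $ b = (- ntr ?C * mat 1 $ a $ b - 1 / (2 * of_nat CARD('n)) * symp ?C $ a $ b)" for a b
    proof -
      have "(Omega ** transpose (unit_matrix q a) ** Omega) $ r $ b = Omega $ r $ a * Omega $ q $ b" for q r
      proof -
        have "(Omega ** transpose (unit_matrix q a)) $ r $ s = (if s = q then Omega $ r $ a else 0)" for s
          by (cases "s = q") (simp_all add: matrix_matrix_mult_def unit_matrix_def if_distrib cong: if_cong)
        then show ?thesis
          unfolding matrix_matrix_mult_def[of "_ ** _"] by (simp add: if_distrib[of "\<lambda>x. x * _"] cong: if_cong)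
      qed
      then have "(\<Sum>q\<in>UNIV. \<Sum>r\<in>UNIV. ?C $ q $ r * symp (unit_matrix q a) $ r $ b) = (\<Sum>q\<in>UNIV. \<Sum>r\<in>UNIV. transpose Omega $ a $ r * transpose ?C $ r $ q * - Omega $ q $ b)"
        by (simp add: symp_def mult_ac)
      \<comment> \<open>Since \<open>transpose Omega\<close> is - \<open>Omega\<close>, the result
        is minus \<open>symp ?C\<close>, where the orthogonal case has plus the transpose. Hence
        \<alpha> is negative here.\<close>
      also have "\<dots> = (transpose Omega ** transpose ?C ** (- Omega)) $ a $ b"
        unfolding matrix_matrix_mult_def by (simp add: sum_distrib_right sum_negf)
      also have "\<dots> = - symp ?C $ a $ b"
        by (simp add: symp_def transpose_Omega matrix_mult.minus_left matrix_mult.minus_right)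
      finally have "(\<Sum>q\<in>UNIV. \<Sum>r\<in>UNIV. ?C $ q $ r * mscale (1 / 2) (unit_matrix q a - symp (unit_matrix q a)) $ r $ b)
        = 1 / 2 * (trace ?C * mat 1 $ a $ b + symp ?C $ a $ b)"
        unfolding sum_unit_matrix(1)[symmetric]
        by (simp add: right_diff_distrib sum_subtractf diff_divide_distrib add_divide_distrib flip: sum_divide_distrib)
      then show ?thesis unfolding sum_sandwich_basis by (simp add: ntr_def field_simps)
    qed
    then show ?thesis by (simp add: tp_eval_contr vec_eq_iff mat_eq_mscale[of "ntr _"] flip: T)
  qed
  show "(\<Sum>X\<in>B. mscale (ntr (mpowi A k ** X)) X) =
      tp_eval (contraction_constants.contr2 (1 / (4 * of_nat CARD('n) ^ 2)) (1 / (4 * of_nat CARD('n) ^ 2)) 0 k) A"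
    unfolding sum_ntr_basis tp_eval_contr2 T by (simp add: mscale_diff mscale_uminus_left power2_eq_square)
qed

theorem theorem1p4:
  shows "first_order_pseudodiff_op L0 \<and>
    (\<forall>b. first_order_pseudodiff_op (L1 b) \<and> second_order_diff_op (L2 b)) \<and>
    (\<forall>B. lie_orthonormal_basis (real CARD('n) / 2) (SO :: (complex^'n^'n) set) B \<longrightarrow>
       (\<forall>P. \<forall>A\<in>SO. laplacian B (tp_eval P) A = tp_eval (D_op Beta1 CARD('n) P) A) \<and>
       (\<forall>\<tau> P. \<forall>A\<in>SO. fun_exp (\<tau> / 2) (laplacian B) (tp_eval P) A
                       = tp_eval (tp_exp (\<tau> / 2) (D_op Beta1 CARD('n)) P) A)) \<and>
    (\<forall>B. lie_orthonormal_basis (real CARD('n)) (SU :: (complex^'n^'n) set) B \<longrightarrow>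
       (\<forall>P. \<forall>A\<in>SU. laplacian B (tp_eval P) A = tp_eval (D_op Beta2 CARD('n) P) A) \<and>
       (\<forall>\<tau> P. \<forall>A\<in>SU. fun_exp (\<tau> / 2) (laplacian B) (tp_eval P) A
                       = tp_eval (tp_exp (\<tau> / 2) (D_op Beta2 CARD('n)) P) A)) \<and>
    (\<forall>B. lie_orthonormal_basis (real CARD('n)) (Sp :: (complex^('n \<times> 2)^('n \<times> 2)) set) B \<longrightarrow>
       (\<forall>P. \<forall>A\<in>Sp. laplacian B (tp_eval P) A = tp_eval (D_op Beta4 CARD('n) P) A) \<and>
       (\<forall>\<tau> P. \<forall>A\<in>Sp. fun_exp (\<tau> / 2) (laplacian B) (tp_eval P) A
                       = tp_eval (tp_exp (\<tau> / 2) (D_op Beta4 CARD('n)) P) A))"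
proof (intro conjI allI impI first_order_L0 first_order_L1 second_order_L2)
  fix B assume onb: "lie_orthonormal_basis (real CARD('n) / 2) (SO :: (complex^'n^'n) set) B"
  interpret contraction_basis "1 / of_nat CARD('n)" "1 / of_nat CARD('n) ^ 2" "1 / of_nat CARD('n) ^ 2" 0 B SO
    by (rule contraction_basis_SO[OF onb])
  show "\<forall>A\<in>SO. laplacian B (tp_eval P) A = tp_eval (D_op Beta1 CARD('n) P) A" for P
    unfolding D_op_Beta1 by (intro ballI laplacian_tp_eval)
  show "\<forall>A\<in>SO. fun_exp (\<tau> / 2) (laplacian B) (tp_eval P) A
      = tp_eval (tp_exp (\<tau> / 2) (D_op Beta1 CARD('n)) P) A" for \<tau> P
    unfolding D_op_Beta1 using lie_projection.flow_closed[OF lie_projection_SO[OF onb] SO_mult]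
    by (intro ballI fun_exp_tp_eval) auto
next
  fix B assume onb: "lie_orthonormal_basis (real CARD('n)) (SU :: (complex^'n^'n) set) B"
  interpret contraction_basis 0 0 "1 / of_nat CARD('n) ^ 2" "1 / of_nat CARD('n) ^ 2" B SU
    by (rule contraction_basis_SU[OF onb])
  show "\<forall>A\<in>SU. laplacian B (tp_eval P) A = tp_eval (D_op Beta2 CARD('n) P) A" for P
    unfolding D_op_Beta2 by (intro ballI laplacian_tp_eval)
  show "\<forall>A\<in>SU. fun_exp (\<tau> / 2) (laplacian B) (tp_eval P) A
      = tp_eval (tp_exp (\<tau> / 2) (D_op Beta2 CARD('n)) P) A" for \<tau> P
    unfolding D_op_Beta2 using lie_projection.flow_closed[OF lie_projection_SU[OF onb] SU_mult]
    by (intro ballI fun_exp_tp_eval) auto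
next
  fix B assume onb: "lie_orthonormal_basis (real CARD('n)) (Sp :: (complex^('n \<times> 2)^('n \<times> 2)) set) B"
  interpret contraction_basis "- 1 / (2 * of_nat CARD('n))" "1 / (4 * of_nat CARD('n) ^ 2)"
      "1 / (4 * of_nat CARD('n) ^ 2)" 0 B Sp
    by (rule contraction_basis_Sp[OF onb])
  show "\<forall>A\<in>Sp. laplacian B (tp_eval P) A = tp_eval (D_op Beta4 CARD('n) P) A" for P
    unfolding D_op_Beta4 by (intro ballI laplacian_tp_eval)
  show "\<forall>A\<in>Sp. fun_exp (\<tau> / 2) (laplacian B) (tp_eval P) A
      = tp_eval (tp_exp (\<tau> / 2) (D_op Beta4 CARD('n)) P) A" for \<tau> P
    unfolding D_op_Beta4 using lie_projection.flow_closed[OF lie_projection_Sp[OF onb] Sp_mult]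
    by (intro ballI fun_exp_tp_eval) auto
qed

end
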